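(* Let $G$ be a connected complex reductive group. There is an isomorphism of categories $D:\mathrm{Rep}(\mathbb{C}\ltimes\mathbb{A},G)\to\mathcal{JC}$ defined on objects by sending a representation $(P,\Phi)$ to the tuple $(P,\sigma_\Phi\circ\Phi,M_u)$, where $M_u$ is the unipotent part of the monodromy of $\Phi$ and $$\sigma_\Phi(\lambda,z)=\exp\Big(\frac{-\lambda}{2\pi i}\log\big(M_u(e^\lambda z)\big)\Big),$$ and defined on morphisms to be the identity. The inverse functor $D^{-1}$ sends a tuple $(P,\Psi,U)$ to the representation $(P,\tau_U\circ\Psi)$, where $\tau_U$ is the $1$-cocycle defined by $$\tau_U(\lambda,z)=\exp\Big(\frac{\lambda}{2\pi i}\log\big(U(e^\lambda z)\big)\Big).$$
   Context: Everything is holomorphic. $G$ is a connected complex reductive group. $\mathbb{A}$ is the complex affine line with coordinate $z$. $\mathbb{C}\ltimes\mathbb{A}$ is the action groupoid with arrows $(\lambda,z)\in\mathbb{C}\times\mathbb{A}$, source $z$, target $e^{\lambda}z$ and product $(\lambda_1,e^{\lambda_2}z)*(\lambda_2,z)=(\lambda_1+\lambda_2,z)$. A representation is a pair $(P,\Phi)$ with $P\to\mathbb{A}$ a holomorphic right principal $G$-bundle and $\Phi$ a holomorphic groupoid homomorphism to the gauge groupoid of $P$, i.e. $G$-equivariant maps $\Phi(\lambda,z):P_z\to P_{e^\lambda z}$, holomorphic in $(\lambda,z)$ and multiplicative. Morphisms in $\mathrm{Rep}(\mathbb{C}\ltimes\mathbb{A},G)$ are morphisms of principal bundles $T$ over $\mathrm{id}_{\mathbb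 A}$ with $T_{e^\lambda z}\Phi(\lambda,z)=\Phi'(\lambda,z)T_z$. The monodromy of $(P,\Phi)$ is $M(z)=\Phi(2\pi i,z)\in\mathrm{Aut}_G(P_z)$; it is an automorphism of $(P,\Phi)$. $M_s(z)$ and $M_u(z)$ are the semisimple and unipotent parts of $M(z)$ in its multiplicative Jordan-Chevalley decomposition (the group $\mathrm{Aut}_G(P_z)$ is non-canonically isomorphic to $G$). For a unipotent element $u$, $\log u$ denotes the unique nilpotent Lie algebra element with exponential $u$. A $1$-cocycle for $\mathbb{C}\ltimes\mathbb{A}$ valued in $(P,\Phi)$ is a holomorphic section $\sigma$ of the bundle of groups $t^*\mathrm{Aut}_G(P)$ over $\mathbb{C}\times\mathbb{A}$ (so $\sigma(\lambda,z)\in\mathrm{Aut}_G(P_{e^\lambda z})$) satisfying $\sigma(\mu,e^\lambda z)\Phi(\mu,e^\lambda z)\sigma(\lambda,z)=\sigma(\mu+\lambda,z)\Phi(\mu,e^\lambda z)$ for all $\mu,\lambda,z$. Then $(\sigma\circ\Phi)(\lambda,z):=\sigma(\lambda,z)\circ\Phi(\lambda,z)$ defines a new representation on $P$. $\mathcal{JC}$ is the category whose objects are tuples $(P,\Psi,U)$, where $(P,\Psi)$ is a representation of $\mathbb{C}\ltimes\mathbb{A}$ with semisimple monodromy and $U$ is a unipotent automorphism of $(P,\Psi)$ (an automorphism with each $U(z)\in\mathrm{Aut}_G(P_z)$ unipotent); morphisms are morphisms of representations that intertwine the unipotent automorphisms. *)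

theory Defs
  imports "HOL-Analysis.Analysis"
begin

section \<open>Complex matrices\<close>

type_synonym 'n cmat = "complex^'n^'n"

text \<open>The library's multiplication \<open>*\<close> and power on \<open>complex^'n^'n\<close> act componentwise, so powers and the
  exponential have to be based on \<open>**\<close>.\<close>

definition mpow :: "'n::finite cmat \<Rightarrow> nat \<Rightarrow> 'n cmat" where
  "mpow A k = (((**) A) ^^ k) (mat 1)"

definition mexp :: "'n::finite cmat \<Rightarrow> 'n cmat" where
  "mexp A = (\<Sum>k. (1 / fact k) *\<^sub>R mpow A k)"

definition mat_nilpotent :: "'n::finite cmat \<Rightarrow> bool" where
  "mat_nilpotent A \<longleftrightarrow> (\<exists>k. mpow A k = 0)"

definition mat_unipotent :: "'n::finite cmat \<Rightarrow> bool" where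
  "mat_unipotent A \<longleftrightarrow> mat_nilpotent (A - mat 1)"

definition mat_semisimple :: "'n::finite cmat \<Rightarrow> bool" where
  "mat_semisimple A \<longleftrightarrow>
     (\<exists>S (d :: 'n \<Rightarrow> complex). invertible S \<and>
        A = S ** (\<chi> i j. if i = j then d i else 0) ** matrix_inv S)"

section \<open>Connected complex reductive groups\<close>

text \<open>Complex reductive groups are taken in a faithful linear representation, i.e. as linear algebraic
  groups: Zariski closed subgroups of the general linear group. The holomorphic structure is the
  one induced from the space of matrices.\<close>

inductive mat_polynomial :: "('n::finite cmat \<Rightarrow> complex) \<Rightarrow> bool" where
  const: "mat_polynomial (\<lambda>A. c)"
| entry: "mat_polynomial (\<lambda>A. A $ i $ j)"
| add: "mat_polynomial f \<Longrightarrow> mat_polynomial g \<Longrightarrow> mat_polynomial (\<lambda>A. f A + g A)"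
| mult: "mat_polynomial f \<Longrightarrow> mat_polynomial g \<Longrightarrow> mat_polynomial (\<lambda>A. f A * g A)"

definition linear_algebraic_group :: "'n::finite cmat set \<Rightarrow> bool" where
  "linear_algebraic_group G \<longleftrightarrow>
     (\<exists>F. (\<forall>f\<in>F. mat_polynomial f) \<and> G = {A. invertible A \<and> (\<forall>f\<in>F. f A = 0)}) \<and>
     mat 1 \<in> G \<and> (\<forall>A\<in>G. \<forall>B\<in>G. A ** B \<in> G) \<and> (\<forall>A\<in>G. matrix_inv A \<in> G)"

text \<open>Reductive: the unipotent radical is trivial. For complex linear algebraic groups,
  connectedness in the Euclidean and in the Zariski topology agree.\<close>

definition reductive_group :: "'n::finite cmat set \<Rightarrow> bool" where
  "reductive_group G \<longleftrightarrow> linear_algebraic_group G \<and>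
     (\<forall>N. linear_algebraic_group N \<and> N \<subseteq> G \<and> connected N \<and>
          (\<forall>g\<in>G. \<forall>x\<in>N. g ** x ** matrix_inv g \<in> N) \<and> (\<forall>x\<in>N. mat_unipotent x)
        \<longrightarrow> N = {mat 1})"

definition connected_reductive_group :: "'n::finite cmat set \<Rightarrow> bool" where
  "connected_reductive_group G \<longleftrightarrow> reductive_group G \<and> connected G"

definition lie_algebra :: "'n::finite cmat set \<Rightarrow> 'n cmat set" where
  "lie_algebra G = {X. \<forall>t::real. mexp (t *\<^sub>R X) \<in> G}"

section \<open>Holomorphic matrix-valued functions of one and two variables\<close>

definition mat_holo_on :: "(complex \<Rightarrow> 'n::finite cmat) \<Rightarrow> complex set \<Rightarrow> bool" where
  "mat_holo_on g W \<longleftrightarrow> (\<forall>i j. (\<lambda>z. g z $ i $ j) holomorphic_on W)"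

text \<open>Complex differentiability on an open subset of \<open>\<complex>\<^sup>2\<close>: the total derivative is \<open>\<complex>\<close>-linear.\<close>

definition holo2_on :: "(complex \<times> complex \<Rightarrow> complex) \<Rightarrow> (complex \<times> complex) set \<Rightarrow> bool" where
  "holo2_on f W \<longleftrightarrow> (\<forall>x\<in>W. \<exists>a b. (f has_derivative (\<lambda>(u, v). a * u + b * v)) (at x))"

definition mat_holo2_on ::
    "(complex \<times> complex \<Rightarrow> 'n::finite cmat) \<Rightarrow> (complex \<times> complex) set \<Rightarrow> bool" where
  "mat_holo2_on g W \<longleftrightarrow> (\<forall>i j. holo2_on (\<lambda>x. g x $ i $ j) W)"

section \<open>Holomorphic right principal bundles over the affine line\<close>

text \<open>\<open>trivs\<close> is the maximal holomorphic atlas of local trivializations; a pair \<open>(V, \<phi>)\<close> in it stands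
  for the trivialization \<open>p \<mapsto> (proj p, \<phi> p)\<close> of the bundle over \<open>V\<close>. It carries the complex structure
  of the total space.

  All functions attached to a bundle (the structure maps here, and below the fibre maps, bundle
  maps and Lie algebra elements) take the value \<open>undefined\<close> outside their domain. This makes
  equality of HOL functions coincide with equality of the mathematical maps.\<close>

record ('p, 'n) pbundle =
  total :: "'p set"
  proj :: "'p \<Rightarrow> complex"
  act :: "'p \<Rightarrow> 'n cmat \<Rightarrow> 'p"
  trivs :: "(complex set \<times> ('p \<Rightarrow> 'n cmat)) set"

definition over :: "('p, 'n) pbundle \<Rightarrow> complex set \<Rightarrow> 'p set" where
  "over P V = {p \<in> total P. proj P p \<in> V}"

definition fibre :: "('p, 'n) pbundle \<Rightarrow> complex \<Rightarrow> 'p set" where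
  "fibre P z = {p \<in> total P. proj P p = z}"

definition local_triv ::
    "'n::finite cmat set \<Rightarrow> ('p, 'n) pbundle \<Rightarrow> complex set \<Rightarrow> ('p \<Rightarrow> 'n cmat) \<Rightarrow> bool" where
  "local_triv G P V \<phi> \<longleftrightarrow> open V \<and> \<phi> \<in> extensional (over P V) \<and>
     bij_betw (\<lambda>p. (proj P p, \<phi> p)) (over P V) (V \<times> G) \<and>
     (\<forall>p\<in>over P V. \<forall>g\<in>G. \<phi> (act P p g) = \<phi> p ** g)"

text \<open>Holomorphic transition functions. The function \<open>h\<close> is determined on \<open>V \<inter> W\<close> and takes values in \<open>G\<close>.\<close>

definition compatible_trivs ::
    "('p, 'n::finite) pbundle \<Rightarrow> complex set \<times> ('p \<Rightarrow> 'n cmat) \<Rightarrow> complex set \<times> ('p \<Rightarrow> 'n cmat) \<Rightarrow> bool"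
  where
  "compatible_trivs P = (\<lambda>(V, \<phi>) (W, \<psi>).
     \<exists>h. mat_holo_on h (V \<inter> W) \<and> (\<forall>p\<in>over P (V \<inter> W). \<psi> p = h (proj P p) ** \<phi> p))"

definition principal_bundle :: "'n::finite cmat set \<Rightarrow> ('p, 'n) pbundle \<Rightarrow> bool" where
  "principal_bundle G P \<longleftrightarrow>
     proj P \<in> extensional (total P) \<and>
     (\<forall>p g. p \<notin> total P \<or> g \<notin> G \<longrightarrow> act P p g = undefined) \<and>
     (\<forall>p\<in>total P. \<forall>g\<in>G. act P p g \<in> total P \<and> proj P (act P p g) = proj P p) \<and>
     (\<forall>p\<in>total P. act P p (mat 1) = p) \<and>
     (\<forall>p\<in>total P. \<forall>g\<in>G. \<forall>h\<in>G. act P (act P p g) h = act P p (g ** h)) \<and>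
     (\<forall>(V, \<phi>)\<in>trivs P. local_triv G P V \<phi>) \<and>
     (\<forall>z. \<exists>(V, \<phi>)\<in>trivs P. z \<in> V) \<and>
     (\<forall>a\<in>trivs P. \<forall>b\<in>trivs P. compatible_trivs P a b) \<and>
     (\<forall>V \<phi>. local_triv G P V \<phi> \<and> (\<forall>b\<in>trivs P. compatible_trivs P (V, \<phi>) b \<and> compatible_trivs P b (V, \<phi>))
        \<longrightarrow> (V, \<phi>) \<in> trivs P)"

text \<open>Morphisms of principal bundles over the identity of the base.\<close>

definition bundle_morphism ::
    "'n::finite cmat set \<Rightarrow> ('p, 'n) pbundle \<Rightarrow> ('p, 'n) pbundle \<Rightarrow> ('p \<Rightarrow> 'p) \<Rightarrow> bool" where
  "bundle_morphism G P P' T \<longleftrightarrow>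
     T \<in> total P \<rightarrow>\<^sub>E total P' \<and>
     (\<forall>p\<in>total P. proj P' (T p) = proj P p) \<and>
     (\<forall>p\<in>total P. \<forall>g\<in>G. T (act P p g) = act P' (T p) g) \<and>
     (\<forall>(V, \<phi>)\<in>trivs P. \<forall>(W, \<psi>)\<in>trivs P'.
        \<exists>h. mat_holo_on h (V \<inter> W) \<and> (\<forall>p\<in>over P (V \<inter> W). \<psi> (T p) = h (proj P p) ** \<phi> p))"

section \<open>Gauge groupoid\<close>

text \<open>Arrows from \<open>z\<close> to \<open>w\<close>. Composition is composition of maps.\<close>

definition gauge_arrows ::
    "'n::finite cmat set \<Rightarrow> ('p, 'n) pbundle \<Rightarrow> complex \<Rightarrow> complex \<Rightarrow> ('p \<Rightarrow> 'p) set" where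
  "gauge_arrows G P z w =
     {F \<in> fibre P z \<rightarrow>\<^sub>E fibre P w. \<forall>p\<in>fibre P z. \<forall>g\<in>G. F (act P p g) = act P (F p) g}"

abbreviation gauge_aut ::
    "'n::finite cmat set \<Rightarrow> ('p, 'n) pbundle \<Rightarrow> complex \<Rightarrow> ('p \<Rightarrow> 'p) set" where
  "gauge_aut G P z \<equiv> gauge_arrows G P z z"

text \<open>A point \<open>p\<close> of the fibre induces the isomorphism sending \<open>A\<close> in \<open>gauge_aut G P z\<close> to the \<open>g\<close> in \<open>G\<close> with
  \<open>A p = p g\<close>. Changing \<open>p\<close> changes \<open>g\<close> by conjugation.\<close>

definition gauge_semisimple ::
    "'n::finite cmat set \<Rightarrow> ('p, 'n) pbundle \<Rightarrow> complex \<Rightarrow> ('p \<Rightarrow> 'p) \<Rightarrow> bool" where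
  "gauge_semisimple G P z A \<longleftrightarrow> A \<in> gauge_aut G P z \<and>
     (\<forall>p\<in>fibre P z. \<forall>g\<in>G. A p = act P p g \<longrightarrow> mat_semisimple g)"

definition gauge_unipotent ::
    "'n::finite cmat set \<Rightarrow> ('p, 'n) pbundle \<Rightarrow> complex \<Rightarrow> ('p \<Rightarrow> 'p) \<Rightarrow> bool" where
  "gauge_unipotent G P z A \<longleftrightarrow> A \<in> gauge_aut G P z \<and>
     (\<forall>p\<in>fibre P z. \<forall>g\<in>G. A p = act P p g \<longrightarrow> mat_unipotent g)"

definition unipotent_part ::
    "'n::finite cmat set \<Rightarrow> ('p, 'n) pbundle \<Rightarrow> complex \<Rightarrow> ('p \<Rightarrow> 'p) \<Rightarrow> ('p \<Rightarrow> 'p)" where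
  "unipotent_part G P z A =
     (THE u. gauge_unipotent G P z u \<and>
        (\<exists>s. gauge_semisimple G P z s \<and>
             compose (fibre P z) s u = A \<and> compose (fibre P z) u s = A))"

text \<open>The Lie algebra of \<open>gauge_aut G P z\<close> is the fibre of the adjoint bundle; its elements are the
  \<open>G\<close>-equivariant maps from the fibre of \<open>P\<close> to the Lie algebra of \<open>G\<close>.\<close>

definition gauge_lie ::
    "'n::finite cmat set \<Rightarrow> ('p, 'n) pbundle \<Rightarrow> complex \<Rightarrow> ('p \<Rightarrow> 'n cmat) set" where
  "gauge_lie G P z =
     {\<xi> \<in> fibre P z \<rightarrow>\<^sub>E lie_algebra G.
        \<forall>p\<in>fibre P z. \<forall>g\<in>G. \<xi> (act P p g) = matrix_inv g ** \<xi> p ** g}"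

definition gauge_scale ::
    "('p, 'n::finite) pbundle \<Rightarrow> complex \<Rightarrow> complex \<Rightarrow> ('p \<Rightarrow> 'n cmat) \<Rightarrow> ('p \<Rightarrow> 'n cmat)" where
  "gauge_scale P z c \<xi> = (\<lambda>p\<in>fibre P z. map_matrix ((*) c) (\<xi> p))"

definition gauge_exp ::
    "('p, 'n::finite) pbundle \<Rightarrow> complex \<Rightarrow> ('p \<Rightarrow> 'n cmat) \<Rightarrow> ('p \<Rightarrow> 'p)" where
  "gauge_exp P z \<xi> = (\<lambda>p\<in>fibre P z. act P p (mexp (\<xi> p)))"

definition gauge_log ::
    "'n::finite cmat set \<Rightarrow> ('p, 'n) pbundle \<Rightarrow> complex \<Rightarrow> ('p \<Rightarrow> 'p) \<Rightarrow> ('p \<Rightarrow> 'n cmat)" where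
  "gauge_log G P z u =
     (THE \<xi>. \<xi> \<in> gauge_lie G P z \<and> (\<forall>p\<in>fibre P z. mat_nilpotent (\<xi> p)) \<and> gauge_exp P z \<xi> = u)"

section \<open>Representations of the action groupoid\<close>

text \<open>Arrows of the action groupoid are pairs \<open>(l, z)\<close> with source \<open>z\<close> and target \<open>exp l * z\<close>.\<close>

type_synonym 'p arrows_family = "complex \<Rightarrow> complex \<Rightarrow> 'p \<Rightarrow> 'p"

definition groupoid_rep ::
    "'n::finite cmat set \<Rightarrow> ('p, 'n) pbundle \<Rightarrow> 'p arrows_family \<Rightarrow> bool" where
  "groupoid_rep G P \<Phi> \<longleftrightarrow>
     principal_bundle G P \<and>
     (\<forall>l z. \<Phi> l z \<in> gauge_arrows G P z (exp l * z)) \<and>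
     (\<forall>l m z. compose (fibre P z) (\<Phi> m (exp l * z)) (\<Phi> l z) = \<Phi> (m + l) z) \<and>
     (\<forall>(V, \<phi>)\<in>trivs P. \<forall>(W, \<psi>)\<in>trivs P.
        \<exists>h. mat_holo2_on h {(l, z). z \<in> V \<and> exp l * z \<in> W} \<and>
            (\<forall>l. \<forall>z\<in>V. exp l * z \<in> W \<longrightarrow> (\<forall>p\<in>fibre P z. \<psi> (\<Phi> l z p) = h (l, z) ** \<phi> p)))"

definition rep_morphism ::
    "'n::finite cmat set \<Rightarrow> ('p, 'n) pbundle \<times> 'p arrows_family \<Rightarrow>
     ('p, 'n) pbundle \<times> 'p arrows_family \<Rightarrow> ('p \<Rightarrow> 'p) \<Rightarrow> bool" where
  "rep_morphism G = (\<lambda>(P, \<Phi>) (P', \<Phi>') T. bundle_morphism G P P' T \<and>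
     (\<forall>l z. \<forall>p\<in>fibre P z. T (\<Phi> l z p) = \<Phi>' l z (T p)))"

definition rep_automorphism ::
    "'n::finite cmat set \<Rightarrow> ('p, 'n) pbundle \<Rightarrow> 'p arrows_family \<Rightarrow> ('p \<Rightarrow> 'p) \<Rightarrow> bool" where
  "rep_automorphism G P \<Phi> T \<longleftrightarrow> rep_morphism G (P, \<Phi>) (P, \<Phi>) T \<and>
     (\<exists>T'. rep_morphism G (P, \<Phi>) (P, \<Phi>) T' \<and>
        (\<forall>p\<in>total P. T' (T p) = p \<and> T (T' p) = p))"

definition monodromy :: "'p arrows_family \<Rightarrow> complex \<Rightarrow> 'p \<Rightarrow> 'p" where
  "monodromy \<Phi> z = \<Phi> (2 * of_real pi * \<i>) z"

text \<open>The fibrewise unipotent parts of the monodromy, glued to one map on the total space.\<close>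

definition monodromy_unip ::
    "'n::finite cmat set \<Rightarrow> ('p, 'n) pbundle \<Rightarrow> 'p arrows_family \<Rightarrow> 'p \<Rightarrow> 'p" where
  "monodromy_unip G P \<Phi> =
     (\<lambda>p\<in>total P. unipotent_part G P (proj P p) (monodromy \<Phi> (proj P p)) p)"

definition one_cocycle ::
    "'n::finite cmat set \<Rightarrow> ('p, 'n) pbundle \<Rightarrow> 'p arrows_family \<Rightarrow> 'p arrows_family \<Rightarrow> bool" where
  "one_cocycle G P \<Phi> \<sigma> \<longleftrightarrow>
     (\<forall>l z. \<sigma> l z \<in> gauge_aut G P (exp l * z)) \<and>
     (\<forall>(V, \<phi>)\<in>trivs P. \<exists>h. mat_holo2_on h {(l, z). exp l * z \<in> V} \<and>
        (\<forall>l z. exp l * z \<in> V \<longrightarrow> (\<forall>p\<in>fibre P (exp l * z). \<phi> (\<sigma> l z p) = h (l, z) ** \<phi> p))) \<and>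
     (\<forall>m l z. \<forall>p\<in>fibre P (exp l * z).
        \<sigma> m (exp l * z) (\<Phi> m (exp l * z) (\<sigma> l z p)) = \<sigma> (m + l) z (\<Phi> m (exp l * z) p))"

definition twist :: "('p, 'n) pbundle \<Rightarrow> 'p arrows_family \<Rightarrow> 'p arrows_family \<Rightarrow> 'p arrows_family" where
  "twist P \<sigma> \<Phi> = (\<lambda>l z. compose (fibre P z) (\<sigma> l z) (\<Phi> l z))"

definition sigma_cocycle ::
    "'n::finite cmat set \<Rightarrow> ('p, 'n) pbundle \<Rightarrow> 'p arrows_family \<Rightarrow> 'p arrows_family" where
  "sigma_cocycle G P \<Phi> = (\<lambda>l z. let w = exp l * z in
     gauge_exp P w (gauge_scale P w (- l / (2 * of_real pi * \<i>))
       (gauge_log G P w (unipotent_part G P w (monodromy \<Phi> w)))))"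

definition tau_cocycle ::
    "'n::finite cmat set \<Rightarrow> ('p, 'n) pbundle \<Rightarrow> ('p \<Rightarrow> 'p) \<Rightarrow> 'p arrows_family" where
  "tau_cocycle G P U = (\<lambda>l z. let w = exp l * z in
     gauge_exp P w (gauge_scale P w (l / (2 * of_real pi * \<i>))
       (gauge_log G P w (restrict U (fibre P w)))))"

section \<open>Categories and isomorphisms of categories\<close>

record ('o, 'm) cat =
  Obj :: "'o set"
  Hom :: "'o \<Rightarrow> 'o \<Rightarrow> 'm set"
  Idt :: "'o \<Rightarrow> 'm"
  Cmp :: "'o \<Rightarrow> 'o \<Rightarrow> 'o \<Rightarrow> 'm \<Rightarrow> 'm \<Rightarrow> 'm"

text \<open>\<open>Cmp C X Y Z g f\<close> is the composite of \<open>f : X \<rightarrow> Y\<close> followed by \<open>g : Y \<rightarrow> Z\<close>. Homs need not be disjoint: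
  a morphism is an element of a hom set together with its source and target.\<close>

definition category :: "('o, 'm) cat \<Rightarrow> bool" where
  "category C \<longleftrightarrow>
     (\<forall>X\<in>Obj C. Idt C X \<in> Hom C X X) \<and>
     (\<forall>X\<in>Obj C. \<forall>Y\<in>Obj C. \<forall>Z\<in>Obj C. \<forall>f\<in>Hom C X Y. \<forall>g\<in>Hom C Y Z. Cmp C X Y Z g f \<in> Hom C X Z) \<and>
     (\<forall>X\<in>Obj C. \<forall>Y\<in>Obj C. \<forall>f\<in>Hom C X Y.
        Cmp C X X Y f (Idt C X) = f \<and> Cmp C X Y Y (Idt C Y) f = f) \<and>
     (\<forall>W\<in>Obj C. \<forall>X\<in>Obj C. \<forall>Y\<in>Obj C. \<forall>Z\<in>Obj C.
        \<forall>f\<in>Hom C W X. \<forall>g\<in>Hom C X Y. \<forall>h\<in>Hom C Y Z.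
        Cmp C W Y Z h (Cmp C W X Y g f) = Cmp C W X Z (Cmp C X Y Z h g) f)"

definition cat_functor ::
    "('o, 'm) cat \<Rightarrow> ('o2, 'm2) cat \<Rightarrow> ('o \<Rightarrow> 'o2) \<Rightarrow> ('o \<Rightarrow> 'o \<Rightarrow> 'm \<Rightarrow> 'm2) \<Rightarrow> bool" where
  "cat_functor C E F Fm \<longleftrightarrow> category C \<and> category E \<and>
     (\<forall>X\<in>Obj C. F X \<in> Obj E) \<and>
     (\<forall>X\<in>Obj C. \<forall>Y\<in>Obj C. \<forall>f\<in>Hom C X Y. Fm X Y f \<in> Hom E (F X) (F Y)) \<and>
     (\<forall>X\<in>Obj C. Fm X X (Idt C X) = Idt E (F X)) \<and>
     (\<forall>X\<in>Obj C. \<forall>Y\<in>Obj C. \<forall>Z\<in>Obj C. \<forall>f\<in>Hom C X Y. \<forall>g\<in>Hom C Y Z.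
        Fm X Z (Cmp C X Y Z g f) = Cmp E (F X) (F Y) (F Z) (Fm Y Z g) (Fm X Y f))"

definition inverse_functors ::
    "('o, 'm) cat \<Rightarrow> ('o2, 'm2) cat \<Rightarrow> ('o \<Rightarrow> 'o2) \<Rightarrow> ('o \<Rightarrow> 'o \<Rightarrow> 'm \<Rightarrow> 'm2) \<Rightarrow>
     ('o2 \<Rightarrow> 'o) \<Rightarrow> ('o2 \<Rightarrow> 'o2 \<Rightarrow> 'm2 \<Rightarrow> 'm) \<Rightarrow> bool" where
  "inverse_functors C E F Fm H Hm \<longleftrightarrow> cat_functor C E F Fm \<and> cat_functor E C H Hm \<and>
     (\<forall>X\<in>Obj C. H (F X) = X) \<and> (\<forall>Y\<in>Obj E. F (H Y) = Y) \<and>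
     (\<forall>X\<in>Obj C. \<forall>Y\<in>Obj C. \<forall>f\<in>Hom C X Y. Hm (F X) (F Y) (Fm X Y f) = f) \<and>
     (\<forall>X\<in>Obj E. \<forall>Y\<in>Obj E. \<forall>f\<in>Hom E X Y. Fm (H X) (H Y) (Hm X Y f) = f)"

section \<open>The two categories\<close>

text \<open>The total spaces of the bundles are subsets of an arbitrary fixed type \<open>'p\<close>.\<close>

definition Rep_cat ::
    "'n::finite cmat set \<Rightarrow> (('p, 'n) pbundle \<times> 'p arrows_family, 'p \<Rightarrow> 'p) cat" where
  "Rep_cat G =
     \<lparr>Obj = {(P, \<Phi>). groupoid_rep G P \<Phi>},
      Hom = (\<lambda>X Y. {T. rep_morphism G X Y T}),
      Idt = (\<lambda>(P, \<Phi>). \<lambda>p\<in>total P. p),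
      Cmp = (\<lambda>(P, \<Phi>) _ _ g f. compose (total P) g f)\<rparr>"

definition JC_cat ::
    "'n::finite cmat set \<Rightarrow> (('p, 'n) pbundle \<times> 'p arrows_family \<times> ('p \<Rightarrow> 'p), 'p \<Rightarrow> 'p) cat" where
  "JC_cat G =
     \<lparr>Obj = {(P, \<Psi>, U). groupoid_rep G P \<Psi> \<and> (\<forall>z. gauge_semisimple G P z (monodromy \<Psi> z)) \<and>
               rep_automorphism G P \<Psi> U \<and> (\<forall>z. gauge_unipotent G P z (restrict U (fibre P z)))},
      Hom = (\<lambda>(P, \<Psi>, U) (P', \<Psi>', U').
               {T. rep_morphism G (P, \<Psi>) (P', \<Psi>') T \<and> (\<forall>p\<in>total P. T (U p) = U' (T p))}),
      Idt = (\<lambda>(P, \<Psi>, U). \<lambda>p\<in>total P. p),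
      Cmp = (\<lambda>(P, \<Psi>, U) _ _ g f. compose (total P) g f)\<rparr>"

end

theory Submission
  imports Defs "HOL-Computational_Algebra.Polynomial_FPS"
    "HOL-Computational_Algebra.Polynomial_Factorial"
    "HOL-Computational_Algebra.Field_as_Ring"
    "HOL-Computational_Algebra.Fundamental_Theorem_Algebra"
begin

text \<open>
  The matrix of the monodromy \<open>M\<close> in a frame \<open>p\<close> of the bundle does not change when \<open>p\<close> is moved along by an
  arrow, because the times of arrows add up commutatively. The nonzero points of the affine line form
  one orbit. So the matrices of \<open>M\<close> over all of them are conjugate, and a polynomial which annihilates
  one of them annihilates all of them, by continuity also those over \<open>0\<close> (\<open>annihilator_propagates\<close>).
  For matrices annihilated by a fixed polynomial the Jordan-Chevalley parts are fixed polynomials in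
  the matrix (\<open>jordan_chevalley_polynomials\<close>). Consequently \<open>M\<^sub>u\<close> is holomorphic in \<open>z\<close>, although the
  decomposition of a varying matrix is discontinuous in general, and \<open>M\<^sub>u\<close> is an automorphism of the
  representation (\<open>unip_endo_monodromy_unip\<close>).

  Let \<open>U\<close> be any unipotent automorphism of \<open>(P, \<Phi>)\<close>. By the same propagation the nilpotency order of \<open>U - 1\<close>
  is bounded uniformly in \<open>z\<close>, so \<open>exp (c log U)\<close> is a finite binomial series in \<open>U\<close> and is holomorphic in
  \<open>(c, z)\<close>. Its values commute with \<open>\<Phi>\<close> and turn sums of exponents into products, and so \<open>exp (k l log U)\<close>
  is a cocycle for each constant \<open>k\<close> (\<open>one_cocycle_flow\<close>). Twisting by it multiplies the monodromy by
  \<open>exp (2\<pi>i k log U)\<close>. For \<open>U = M\<^sub>u\<close> and \<open>k = -1/(2\<pi>i)\<close> the result is \<open>M\<^sub>s\<close>. For semisimple \<open>M\<close> and \<open>k = 1/(2\<pi>i)\<close> the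
  result is \<open>M U\<close>, whose unipotent part is \<open>U\<close>. Twists with opposite \<open>k\<close> cancel, which makes the two object
  maps mutually inverse. On morphisms nothing has to be done: a morphism preserves the matrices in
  frames, hence intertwines everything computed from them.

  Two facts about a linear algebraic group \<open>G\<close> enter: the parts of \<open>A \<in> G\<close> are unique, and they lie in
  \<open>G\<close> together with all powers \<open>u\<^sup>c\<close> of the unipotent part. Both follow from one elementary observation. For
  \<open>A = s u\<close> the entries of \<open>s\<^sup>a u\<^sup>c\<close> are sums of terms \<open>\<mu>\<^sup>a q(c)\<close> with polynomials \<open>q\<close>, and such a function of \<open>a\<close> and \<open>c\<close>
  vanishes if it vanishes for \<open>a = c = n\<close>, where \<open>s\<^sup>n u\<^sup>n = A\<^sup>n\<close> (\<open>exp_poly_eq_zero\<close>).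
\<close>

section \<open>Polynomials evaluated at matrices\<close>

lemma matrix_mat_mult_nth [simp]: "(mat c ** A) $ i $ j = c * A $ i $ j"
  for A :: "'n::finite cmat"
  by (simp add: matrix_matrix_mult_def mat_def if_distrib[of "\<lambda>x. x * _"] cong: if_cong)

lemma matrix_mult_mat_nth [simp]: "(A ** mat c) $ i $ j = c * A $ i $ j"
  for A :: "'n::finite cmat"
  by (simp add: matrix_matrix_mult_def mat_def if_distrib[of "\<lambda>x. _ * x"] cong: if_cong)

lemma mat_mult_commute: "A ** mat c = mat c ** A" for A :: "'n::finite cmat"
  by (simp add: vec_eq_iff)

lemma mat_add: "mat (a + b) = (mat a + mat b :: 'n::finite cmat)"
  by (simp add: vec_eq_iff mat_def)

lemma mat_mult_mat: "mat a ** mat b = (mat (a * b) :: 'n::finite cmat)"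
  by (simp add: vec_eq_iff) (simp add: mat_def)

lemma mat_mult_eqs:
  fixes A :: "'n::finite cmat"
  shows map_matrix_mult: "map_matrix ((*) c) A = mat c ** A"
    and scaleR_matrix: "r *\<^sub>R A = mat (of_real r) ** A"
  by (simp_all add: vec_eq_iff scaleR_conv_of_real[where 'a = complex])

lemma matrix_add_rdistrib: "(B + C) ** A = B ** A + C ** A" for A :: "'n::finite cmat"
  by (vector matrix_matrix_mult_def sum.distrib[symmetric] field_simps)

lemma matrix_diff_distribs:
  fixes A :: "'n::finite cmat"
  shows "(B - C) ** A = B ** A - C ** A" "A ** (B - C) = A ** B - A ** C"
  by (vector matrix_matrix_mult_def sum_subtractf[symmetric] field_simps)+

lemma matrix_inv_unique:
  fixes A :: "'n::finite cmat"
  assumes "A ** B = mat 1"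
  shows "invertible A" "matrix_inv A = B"
proof -
  have BA: "B ** A = mat 1"
    using assms matrix_left_right_inverse by blast
  show inv: "invertible A"
    using assms BA by (auto simp: invertible_def)
  have "\<exists>C. A ** C = mat 1 \<and> C ** A = mat 1"
    using assms BA by blast
  then have "A ** matrix_inv A = mat 1"
    unfolding matrix_inv_def by (rule someI2_ex) blast
  then show "matrix_inv A = B"
    by (metis BA matrix_mul_assoc matrix_mul_lid matrix_mul_rid)
qed

lemma matrix_inv_cancel:
  fixes A :: "'n::finite cmat"
  assumes "invertible A"
  shows "A ** matrix_inv A = mat 1" "matrix_inv A ** A = mat 1"
  using assms matrix_inv_unique unfolding invertible_def by metis+

lemma matrix_inv_cancel':
  fixes A :: "'n::finite cmat"
  assumes "invertible A"
  shows "B ** A ** matrix_inv A = B" "B ** matrix_inv A ** A = B"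
  using matrix_inv_cancel[OF assms] by (metis matrix_mul_assoc matrix_mul_rid)+

text \<open>Polynomials in a matrix commute with each other and with conjugation, and they depend
  holomorphically on the matrix. Everything below that has to be natural and holomorphic at the same
  time (Jordan-Chevalley parts, logarithms, complex powers of unipotent matrices) is therefore
  exhibited as a polynomial.\<close>

definition mpeval :: "complex poly \<Rightarrow> 'n::finite cmat \<Rightarrow> 'n cmat" where
  "mpeval p A = fold_coeffs (\<lambda>a B. mat a + A ** B) p 0"

lemma mpeval_0 [simp]: "mpeval 0 A = 0"
  by (simp add: mpeval_def)

lemma mpeval_pCons [simp]: "mpeval (pCons a p) A = mat a + A ** mpeval p A"
  by (cases "p = 0 \<and> a = 0") (auto simp: mpeval_def)

lemma mpeval_1 [simp]: "mpeval 1 A = mat 1"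
  by (simp add: one_pCons)

lemma mpeval_add: "mpeval (p + q) A = mpeval p A + mpeval q A"
  by (induction p q rule: poly_induct2) (simp_all add: mat_add matrix_add_ldistrib)

lemma mpeval_smult: "mpeval (smult c p) A = mat c ** mpeval p A"
proof (induction p)
  case (pCons a p)
  have "A ** (mat c ** mpeval p A) = mat c ** (A ** mpeval p A)"
    by (metis mat_mult_commute matrix_mul_assoc)
  then show ?case
    using pCons by (simp add: matrix_add_ldistrib mat_mult_mat)
qed simp

lemma mpeval_diff: "mpeval (p - q) A = mpeval p A - mpeval q A"
  using mpeval_add[of "p - q" q A] by simp

lemma mpeval_mult: "mpeval (p * q) A = mpeval p A ** mpeval q A"
proof (induction p)
  case (pCons a p)
  then show ?case
    by (simp add: mpeval_add mpeval_smult matrix_add_rdistrib matrix_mul_assoc)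
qed simp

lemma mpeval_commute: "mpeval p A ** mpeval q A = mpeval q A ** mpeval p A"
  by (metis mpeval_mult mult.commute)

lemma mpeval_sum: "mpeval (\<Sum>i\<in>I. f i) A = (\<Sum>i\<in>I. mpeval (f i) A)"
  by (induction I rule: infinite_finite_induct) (auto simp: mpeval_add)

lemma mpow_0 [simp]: "mpow A 0 = mat 1"
  and mpow_Suc [simp]: "mpow A (Suc k) = A ** mpow A k"
  by (simp_all add: mpow_def)

lemma mpeval_power: "mpeval (p ^ k) A = mpow (mpeval p A) k"
  by (induction k) (auto simp: mpeval_mult)

lemma mpeval_monom: "mpeval (monom c k) A = mat c ** mpow A k"
  by (induction k) (simp_all add: monom_0 monom_Suc, metis mat_mult_commute matrix_mul_assoc)

lemma mpow_add: "mpow A (j + k) = mpow A j ** mpow A k"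
  by (induction j) (simp_all add: matrix_mul_assoc)

lemma mpow_zero_mono: "mpow A K = 0 \<Longrightarrow> K \<le> k \<Longrightarrow> mpow A k = 0"
  using mpow_add[of A K "k - K"] by simp

lemma mpow_mult:
  assumes "A ** B = B ** A"
  shows "mpow (A ** B) k = mpow A k ** mpow B k"
proof (induction k)
  case (Suc k)
  have comm: "mpow A j ** B = B ** mpow A j" for j
    by (induction j) (simp_all, metis assms matrix_mul_assoc)
  then show ?case
    using Suc by simp (metis matrix_mul_assoc)
qed simp

lemma mpeval_dvd_zero: "p dvd q \<Longrightarrow> mpeval p A = 0 \<Longrightarrow> mpeval q A = 0"
  by (auto simp: mpeval_mult elim!: dvdE)

lemma mpeval_conj:
  fixes S :: "'n::finite cmat"
  assumes "S ** S' = mat 1"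
  shows "mpeval p (S' ** A ** S) = S' ** mpeval p A ** S"
proof (induction p)
  case (pCons a p)
  have S: "S' ** S = mat 1"
    using assms matrix_left_right_inverse by blast
  have "S' ** A ** S ** (S' ** mpeval p A ** S) = S' ** (A ** (S ** S') ** mpeval p A) ** S"
    by (simp add: matrix_mul_assoc)
  moreover have "mat a = S' ** mat a ** S"
    by (metis S mat_mult_commute matrix_mul_assoc matrix_mul_rid)
  ultimately show ?case
    using pCons assms by (simp add: matrix_add_ldistrib matrix_add_rdistrib matrix_mul_assoc)
qed simp

lemma mpow_conj:
  fixes S :: "'n::finite cmat"
  assumes "S ** S' = mat 1"
  shows "mpow (S' ** A ** S) k = S' ** mpow A k ** S"
  using mpeval_conj[OF assms, of "monom 1 k" A] by (simp add: mpeval_monom)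

text \<open>The powers of \<open>A\<close> live in a finite-dimensional real vector space, so either two of them coincide or
  finitely many are linearly dependent over the reals.\<close>

lemma annihilating_polynomial_exists:
  fixes A :: "'n::finite cmat"
  obtains p where "p \<noteq> 0" "mpeval p A = 0"
proof -
  let ?N = "DIM('n cmat)"
  show thesis
  proof (cases "inj_on (mpow A) {..?N}")
    case False
    then obtain j k where jk: "mpow A j = mpow A k" "j \<noteq> k"
      by (auto simp: inj_on_def)
    show thesis
    proof (rule that[of "monom 1 j - monom 1 k"])
      show "monom 1 j - monom 1 k \<noteq> (0 :: complex poly)"
        using jk(2) by (metis coeff_monom diff_eq_diff_eq diff_self zero_neq_one)
    qed (simp add: mpeval_diff mpeval_monom jk(1))
  next
    case True
    then have "card (mpow A ` {..?N}) > ?N"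
      by (simp add: card_image)
    then have "dependent (mpow A ` {..?N})"
      by (intro dependent_biggerset) simp
    then obtain c where c: "\<exists>v\<in>mpow A ` {..?N}. c v \<noteq> 0"
        "(\<Sum>v\<in>mpow A ` {..?N}. c v *\<^sub>R v) = 0"
      by (subst (asm) dependent_finite) auto
    define p where "p = (\<Sum>k\<le>?N. monom (of_real (c (mpow A k)) :: complex) k)"
    have coeff: "coeff p k = of_real (c (mpow A k))" if "k \<le> ?N" for k
      using that by (simp add: p_def coeff_sum)
    show thesis
    proof (rule that[of p])
      show "p \<noteq> 0"
        using c(1) coeff by fastforce
      show "mpeval p A = 0"
        using c(2) True
        by (simp add: p_def mpeval_sum mpeval_monom sum.reindex scaleR_matrix o_def)
    qed
  qed
qed

text \<open>Powers of an invertible matrix can be cancelled from \<open>p(A) = 0\<close>, so a factor \<open>X\<^sup>k\<close> of \<open>p\<close> can be removed.\<close>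

lemma annihilating_polynomial_invertible:
  fixes A :: "'n::finite cmat"
  assumes "invertible A"
  obtains p where "poly p 0 \<noteq> 0" "mpeval p A = 0"
proof -
  obtain p where p: "p \<noteq> 0" "mpeval p A = 0"
    by (rule annihilating_polynomial_exists)
  from order_decomp[OF p(1), of 0] obtain q
    where q: "p = [:0, 1:] ^ order 0 p * q" "\<not> [:0, 1:] dvd q"
    by auto
  define k where "k = order 0 p"
  have A: "mpeval [:0, 1:] A = A"
    by simp
  have "mpow A k ** mpeval q A = 0"
    using p(2) q(1) unfolding k_def[symmetric]
    by (metis A mpeval_mult mpeval_power)
  moreover have "mpow A j ** B = 0 \<Longrightarrow> B = 0" for j B
  proof (induction j)
    case (Suc j)
    then have "matrix_inv A ** (A ** (mpow A j ** B)) = 0"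
      by (simp add: matrix_mul_assoc)
    then have "mpow A j ** B = 0"
      by (metis assms matrix_inv_cancel(2) matrix_mul_assoc matrix_mul_lid)
    then show ?case
      by (rule Suc.IH)
  qed simp
  ultimately have "mpeval q A = 0"
    by blast
  moreover have "poly q 0 \<noteq> 0"
    using q(2) by (simp add: poly_eq_0_iff_dvd)
  ultimately show thesis
    using that by blast
qed

section \<open>Powers, exponentials and logarithms of unipotent matrices\<close>

text \<open>If \<open>N\<^sup>K = 0\<close>, only the first \<open>K\<close> coefficients of a power series contribute to its value at \<open>N\<close>.
  Evaluation is then a ring homomorphism on power series which is compatible with composition, and
  formal identities between the exponential, logarithmic and binomial series become identities of
  matrices.\<close>

abbreviation nil_eval :: "nat \<Rightarrow> complex fps \<Rightarrow> 'n::finite cmat \<Rightarrow> 'n cmat" where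
  "nil_eval K f N \<equiv> mpeval (truncate_fps K f) N"

text \<open>Polynomials that agree below degree \<open>K\<close> differ by a multiple of \<open>X\<^sup>K\<close>.\<close>

lemma nil_eval_cong:
  assumes "mpow N K = 0" "\<And>k. k < K \<Longrightarrow> coeff p k = coeff q k"
  shows "mpeval p N = mpeval q N"
proof -
  have "monom 1 K dvd p - q"
    using assms(2) by (simp add: monom_1_dvd_iff')
  then have "mpeval (p - q) N = 0"
    by (rule mpeval_dvd_zero) (simp add: mpeval_monom assms(1))
  then show ?thesis
    by (simp add: mpeval_diff)
qed

lemma nil_eval_sum: "nil_eval K f N = (\<Sum>k<K. mat (fps_nth f k) ** mpow N k)"
proof -
  have "truncate_fps K f = (\<Sum>k<K. monom (fps_nth f k) k)"
    by (rule poly_eqI) (auto simp: coeff_sum coeff_truncate_fps)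
  then show ?thesis
    by (simp add: mpeval_sum mpeval_monom)
qed

lemma nil_eval_mult:
  assumes "mpow N K = 0"
  shows "nil_eval K (f * g) N = nil_eval K f N ** nil_eval K g N"
  unfolding mpeval_mult[symmetric]
  by (rule nil_eval_cong[OF assms])
    (auto simp: coeff_mult fps_mult_nth coeff_truncate_fps atLeast0AtMost intro!: sum.cong)

lemma nil_eval_one:
  assumes "mpow N K = 0"
  shows "nil_eval K 1 N = mat 1"
  unfolding mpeval_1[of N, symmetric]
  by (rule nil_eval_cong[OF assms]) (simp add: coeff_truncate_fps)

lemma nil_eval_power:
  assumes "mpow N K = 0"
  shows "nil_eval K (f ^ k) N = mpow (nil_eval K f N) k"
  by (induction k) (simp_all add: nil_eval_mult nil_eval_one assms)

lemma fps_power_nth_below: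
  assumes "fps_nth f 0 = (0::complex)" "n < k"
  shows "fps_nth (f ^ k) n = 0"
  using assms startsby_zero_power_prefix by blast

lemma nilpotent_nil_eval:
  assumes "mpow N K = 0" "fps_nth g 0 = 0"
  shows "mpow (nil_eval K g N) K = 0"
proof -
  have "truncate_fps K (g ^ K) = 0"
    using fps_power_nth_below[OF assms(2)] by (intro poly_eqI) (simp add: coeff_truncate_fps)
  then show ?thesis
    by (simp add: nil_eval_power[OF assms(1), symmetric])
qed

lemma nil_eval_compose:
  assumes "mpow N K = 0" "fps_nth g 0 = 0"
  shows "nil_eval K (f oo g) N = nil_eval K f (nil_eval K g N)"
proof -
  have "nil_eval K (f oo g) N = mpeval (\<Sum>i<K. smult (fps_nth f i) (truncate_fps K (g ^ i))) N"
  proof (rule nil_eval_cong[OF assms(1)])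
    fix k assume "k < K"
    have "(\<Sum>i=0..k. fps_nth f i * fps_nth (g ^ i) k) = (\<Sum>i<K. fps_nth f i * fps_nth (g ^ i) k)"
      using \<open>k < K\<close> by (intro sum.mono_neutral_left) (auto simp: fps_power_nth_below[OF assms(2)])
    then show "coeff (truncate_fps K (f oo g)) k =
        coeff (\<Sum>i<K. smult (fps_nth f i) (truncate_fps K (g ^ i))) k"
      using \<open>k < K\<close> by (simp add: coeff_sum fps_compose_nth)
  qed
  also have "\<dots> = nil_eval K f (nil_eval K g N)"
    by (simp add: mpeval_sum mpeval_smult nil_eval_power[OF assms(1)] nil_eval_sum[of K f])
  finally show ?thesis .
qed

lemma mexp_nilpotent:
  assumes "mpow N K = 0"
  shows "mexp (map_matrix ((*) c) N) = nil_eval K (fps_exp c) N"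
proof -
  have pow: "(1 / fact k) *\<^sub>R mpow (mat c ** N) k = mat (fps_nth (fps_exp c) k) ** mpow N k" for k
  proof -
    have "mpow (mat c ** N) k = mat (c ^ k) ** mpow N k"
    proof (induction k)
      case (Suc k)
      have "mat c ** N ** (mat (c ^ k) ** mpow N k) = mat c ** mat (c ^ k) ** (N ** mpow N k)"
        by (metis mat_mult_commute matrix_mul_assoc)
      then show ?case
        by (simp add: Suc mat_mult_mat)
    qed simp
    then show ?thesis
      by (simp add: scaleR_matrix matrix_mul_assoc mat_mult_mat field_simps)
  qed
  have "mexp (map_matrix ((*) c) N) = (\<Sum>k. mat (fps_nth (fps_exp c) k) ** mpow N k)"
    by (simp only: mexp_def map_matrix_mult pow)
  also have "\<dots> = nil_eval K (fps_exp c) N"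
    unfolding nil_eval_sum using mpow_zero_mono[OF assms]
    by (intro suminf_finite) (auto simp: not_less)
  finally show ?thesis .
qed

text \<open>Both sides solve \<open>(1 + X) y' = c y\<close> with \<open>y(0) = 1\<close>.\<close>

lemma fps_exp_compose_ln: "fps_exp c oo fps_ln 1 = fps_binomial (c::complex)"
proof -
  have "fps_deriv (fps_exp c oo fps_ln 1) =
      ((fps_const c * fps_exp c) oo fps_ln 1) * inverse (1 + fps_X)"
    by (simp add: fps_compose_deriv fps_ln_deriv)
  also have "\<dots> = fps_const c * (fps_exp c oo fps_ln 1) / (1 + fps_X)"
    by (simp add: fps_compose_mult_distrib fps_divide_unit)
  finally show ?thesis
    by (subst fps_binomial_ODE_unique'[symmetric]) simp
qed

definition mlog :: "'n::finite cmat \<Rightarrow> 'n cmat" where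
  "mlog u = (THE N. mat_nilpotent N \<and> mexp N = u)"

lemma map_matrix_one [simp]: "map_matrix ((*) 1) A = A" for A :: "'n::finite cmat"
  by (simp add: map_matrix_mult)

text \<open>The logarithm is the series of \<open>ln (1 + X)\<close> at \<open>u - 1\<close>, by the case \<open>c = 1\<close> of \<open>fps_exp_compose_ln\<close>. It is
  unique because a nilpotent \<open>N\<close> is recovered from \<open>exp N - 1\<close> through the same series. The bound \<open>K\<close> is
  kept as a parameter: it will be chosen uniformly for a whole family of unipotent matrices.\<close>

lemma mlog_nil_eval:
  assumes "mpow (u - mat 1) K = 0"
  shows "mlog u = nil_eval K (fps_ln 1) (u - mat 1)" (is "_ = ?L")
    and "mpow (mlog u) K = 0" "mexp (mlog u) = u"
    and "\<And>N. mat_nilpotent N \<Longrightarrow> mexp N = u \<Longrightarrow> N = mlog u"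
proof -
  define B where "B = u - mat 1"
  have nilL: "mpow ?L K = 0"
    by (rule nilpotent_nil_eval[OF assms]) simp
  have "mexp ?L = nil_eval K (fps_exp 1) ?L"
    using mexp_nilpotent[OF nilL, of 1] by simp
  also have "\<dots> = nil_eval K (fps_binomial 1) B"
    using nil_eval_compose[OF assms, of "fps_ln 1" "fps_exp 1"]
    by (simp add: fps_exp_compose_ln B_def)
  also have "\<dots> = mpeval [:1, 1:] B"
    using assms unfolding B_def
    by (rule nil_eval_cong) (auto simp: fps_binomial_1 coeff_pCons split: nat.split)
  also have "\<dots> = u"
    by (simp add: B_def)
  finally have expL: "mexp ?L = u" .
  have uniq: "N = ?L" if "mat_nilpotent N" "mexp N = u" for N
  proof -
    obtain J where J: "mpow N J = 0"
      using \<open>mat_nilpotent N\<close> by (auto simp: mat_nilpotent_def)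
    define M where "M = max J K"
    have M: "mpow N M = 0" "mpow B M = 0"
      using J assms by (auto simp: M_def B_def intro: mpow_zero_mono)
    define e where "e = fps_exp (1::complex) - 1"
    have e: "nil_eval M e N = B"
      using mexp_nilpotent[OF M(1), of 1] that(2) nil_eval_one[OF M(1)]
      by (simp add: e_def B_def truncate_fps_diff mpeval_diff)
    have "N = mpeval [:0, 1:] N"
      by simp
    also have "\<dots> = nil_eval M (fps_ln 1 oo e) N"
      using M(1) by (rule nil_eval_cong)
        (auto simp: e_def fps_ln_fps_exp_inv fps_inv_fps_exp_compose coeff_pCons split: nat.split)
    also have "\<dots> = nil_eval M (fps_ln 1) B"
      by (subst nil_eval_compose[OF M(1)]) (simp_all add: e, simp add: e_def)
    also have "\<dots> = nil_eval K (fps_ln 1) B"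
      using assms unfolding B_def
      by (rule nil_eval_cong) (auto simp: coeff_truncate_fps M_def)
    finally show ?thesis
      by (simp add: B_def)
  qed
  have "mat_nilpotent ?L"
    using nilL mat_nilpotent_def by blast
  then show eq: "mlog u = ?L"
    unfolding mlog_def using expL by (intro the_equality uniq conjI) blast+
  show "mpow (mlog u) K = 0" "mexp (mlog u) = u"
    using nilL expL by (simp_all add: eq)
  show "N = mlog u" if "mat_nilpotent N" "mexp N = u" for N
    unfolding eq using that by (rule uniq)
qed

lemma mat_unipotentE:
  assumes "mat_unipotent u"
  obtains K where "mpow (u - mat 1) K = 0"
  using assms by (auto simp: mat_unipotent_def mat_nilpotent_def)

lemma mlog_unipotent:
  assumes "mat_unipotent u"
  shows mat_nilpotent_mlog: "mat_nilpotent (mlog u)"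
    and mexp_mlog: "mexp (mlog u) = u"
    and mlog_unique: "mat_nilpotent N \<Longrightarrow> mexp N = u \<Longrightarrow> N = mlog u"
  using assms mlog_nil_eval by (metis mat_unipotentE mat_nilpotent_def)+

text \<open>The complex power \<open>u\<^sup>c\<close> of a unipotent matrix, which is the binomial series of \<open>(1 + X)\<^sup>c\<close> at \<open>u - 1\<close>.\<close>

definition upow :: "'n::finite cmat \<Rightarrow> complex \<Rightarrow> 'n cmat" where
  "upow u c = mexp (map_matrix ((*) c) (mlog u))"

lemma upow_nil_eval:
  assumes "mpow (u - mat 1) K = 0"
  shows "upow u c = nil_eval K (fps_binomial c) (u - mat 1)"
  using mexp_nilpotent[OF mlog_nil_eval(2)[OF assms], of c]
    nil_eval_compose[OF assms, of "fps_ln 1" "fps_exp c"]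
  by (simp add: upow_def mlog_nil_eval(1)[OF assms] fps_exp_compose_ln)

lemma upow_0 [simp]: "mat_unipotent u \<Longrightarrow> upow u 0 = mat 1"
  by (elim mat_unipotentE) (simp add: upow_nil_eval nil_eval_one)

lemma upow_1 [simp]: "mat_unipotent u \<Longrightarrow> upow u 1 = u"
  by (simp add: upow_def mexp_mlog)

lemma upow_add: "mat_unipotent u \<Longrightarrow> upow u (a + b) = upow u a ** upow u b"
  by (elim mat_unipotentE) (simp add: upow_nil_eval fps_binomial_add_mult nil_eval_mult)

lemma upow_of_nat: "mat_unipotent u \<Longrightarrow> upow u (of_nat n) = mpow u n"
  by (induction n) (simp_all add: upow_add)

lemma upow_minus: "mat_unipotent u \<Longrightarrow> upow u c ** upow u (- c) = mat 1"
  by (metis add.right_inverse upow_0 upow_add)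

lemma upow_commute:
  assumes "mat_unipotent u" "A ** u = u ** A"
  shows "A ** upow u c = upow u c ** A"
proof -
  obtain K where K: "mpow (u - mat 1) K = 0"
    using assms(1) by (rule mat_unipotentE)
  have AB: "A ** (u - mat 1) = (u - mat 1) ** A"
    by (simp add: matrix_diff_distribs assms(2))
  have "A ** mpeval p (u - mat 1) = mpeval p (u - mat 1) ** A" for p
  proof (induction p)
    case (pCons a p)
    then show ?case
      by (simp add: matrix_add_ldistrib matrix_add_rdistrib mat_mult_commute)
        (metis AB matrix_mul_assoc)
  qed simp
  then show ?thesis
    by (simp add: upow_nil_eval[OF K])
qed

lemma unipotent_conj:
  fixes S :: "'n::finite cmat"
  assumes "S ** S' = mat 1" "mat_unipotent u"
  shows "mat_unipotent (S' ** u ** S)"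
    and "mlog (S' ** u ** S) = S' ** mlog u ** S"
    and "upow (S' ** u ** S) c = S' ** upow u c ** S"
proof -
  obtain K where K: "mpow (u - mat 1) K = 0"
    using assms(2) by (rule mat_unipotentE)
  have "S' ** S = mat 1"
    using assms(1) matrix_left_right_inverse by blast
  then have eq: "S' ** u ** S - mat 1 = S' ** (u - mat 1) ** S"
    by (simp add: matrix_diff_distribs)
  then have K': "mpow (S' ** u ** S - mat 1) K = 0"
    by (simp add: mpow_conj[OF assms(1)] K)
  then show "mat_unipotent (S' ** u ** S)"
    by (auto simp: mat_unipotent_def mat_nilpotent_def)
  show "mlog (S' ** u ** S) = S' ** mlog u ** S"
    by (simp add: mlog_nil_eval(1)[OF K] mlog_nil_eval(1)[OF K'] eq mpeval_conj[OF assms(1)])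
  show "upow (S' ** u ** S) c = S' ** upow u c ** S"
    by (simp add: upow_nil_eval[OF K] upow_nil_eval[OF K'] eq mpeval_conj[OF assms(1)])
qed

section \<open>Exponential polynomials\<close>

text \<open>The sums \<open>\<Sum> \<mu>\<^sup>a q(c)\<close> with \<open>\<mu> \<noteq> 0\<close> and polynomials \<open>q\<close>. The entries of \<open>s\<^sup>a u\<^sup>c\<close>, for \<open>s\<close> invertible semisimple
  and \<open>u\<close> unipotent, have this form. The two exponents are independent variables; the point of this
  section is that such a function is nevertheless determined by its values at \<open>a = c = n\<close>.\<close>

inductive exp_poly :: "(nat \<Rightarrow> complex \<Rightarrow> complex) \<Rightarrow> bool" where
  exp_poly_zero: "exp_poly (\<lambda>a c. 0)"
| exp_poly_add_term:
    "exp_poly h \<Longrightarrow> \<mu> \<noteq> 0 \<Longrightarrow> exp_poly (\<lambda>a c. h a c + \<mu> ^ a * poly q c)"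

lemma exp_poly_term: "\<mu> \<noteq> 0 \<Longrightarrow> exp_poly (\<lambda>a c. \<mu> ^ a * poly q c)"
  using exp_poly_add_term[OF exp_poly_zero] by simp

lemma exp_poly_poly: "exp_poly (\<lambda>a c. poly q c)"
  using exp_poly_term[of 1] by simp

lemma exp_poly_const: "exp_poly (\<lambda>a c. k)"
  using exp_poly_poly[of "[:k:]"] by simp

lemma exp_poly_add: "exp_poly k \<Longrightarrow> exp_poly h \<Longrightarrow> exp_poly (\<lambda>a c. h a c + k a c)"
proof (induction k rule: exp_poly.induct)
  case (exp_poly_add_term k \<mu> q)
  then show ?case
    using exp_poly.exp_poly_add_term[of "\<lambda>a c. h a c + k a c" \<mu> q] by (simp add: add.assoc)
qed simp

lemma exp_poly_mult_term:
  "exp_poly h \<Longrightarrow> \<nu> \<noteq> 0 \<Longrightarrow> exp_poly (\<lambda>a c. h a c * (\<nu> ^ a * poly r c))"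
proof (induction h rule: exp_poly.induct)
  case (exp_poly_add_term h \<mu> q)
  then show ?case
    using exp_poly.exp_poly_add_term[of "\<lambda>a c. h a c * (\<nu> ^ a * poly r c)" "\<mu> * \<nu>" "q * r"]
    by (simp add: algebra_simps power_mult_distrib)
qed (simp add: exp_poly_zero)

lemma exp_poly_mult: "exp_poly k \<Longrightarrow> exp_poly h \<Longrightarrow> exp_poly (\<lambda>a c. h a c * k a c)"
proof (induction k rule: exp_poly.induct)
  case (exp_poly_add_term k \<mu> q)
  then show ?case
    using exp_poly_add[OF exp_poly_mult_term[of h \<mu> q]] by (simp add: algebra_simps)
qed (simp add: exp_poly_zero)

lemma exp_poly_sum:
  "(\<And>i. i \<in> I \<Longrightarrow> exp_poly (h i)) \<Longrightarrow> exp_poly (\<lambda>a c. \<Sum>i\<in>I. h i a c)"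
  by (induction I rule: infinite_finite_induct) (auto simp: exp_poly_zero intro!: exp_poly_add)

lemma exp_poly_normal_form:
  assumes "exp_poly h"
  obtains M Q where "finite M" "0 \<notin> M" "h = (\<lambda>a c. \<Sum>\<mu>\<in>M. \<mu> ^ a * poly (Q \<mu>) c)"
  using assms
proof (induction arbitrary: thesis rule: exp_poly.induct)
  case exp_poly_zero
  show ?case
    by (rule exp_poly_zero[of "{}"]) auto
next
  case (exp_poly_add_term h \<mu> q)
  from exp_poly_add_term.IH obtain M Q
    where MQ: "finite M" "0 \<notin> M" "h = (\<lambda>a c. \<Sum>\<mu>\<in>M. \<mu> ^ a * poly (Q \<mu>) c)"
    by blast
  define Q' where "Q' = (\<lambda>\<nu>. (if \<nu> \<in> M then Q \<nu> else 0) + (if \<nu> = \<mu> then q else 0))"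
  have "(\<Sum>\<nu>\<in>insert \<mu> M. \<nu> ^ a * poly (Q' \<nu>) c) = h a c + \<mu> ^ a * poly q c" for a c
  proof -
    have "(\<Sum>\<nu>\<in>insert \<mu> M. if \<nu> \<in> M then \<nu> ^ a * poly (Q \<nu>) c else 0) =
        (\<Sum>\<nu>\<in>M. \<nu> ^ a * poly (Q \<nu>) c)"
      using MQ(1) by (intro sum.mono_neutral_cong_right) auto
    moreover have "(\<Sum>\<nu>\<in>insert \<mu> M. if \<nu> = \<mu> then \<mu> ^ a * poly q c else 0) = \<mu> ^ a * poly q c"
      using MQ(1) by (subst sum.delta) auto
    moreover have "\<nu> ^ a * poly (Q' \<nu>) c = (if \<nu> \<in> M then \<nu> ^ a * poly (Q \<nu>) c else 0) +
        (if \<nu> = \<mu> then \<mu> ^ a * poly q c else 0)" for \<nu>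
      by (simp add: Q'_def algebra_simps)
    ultimately show ?thesis
      by (simp only: sum.distrib MQ(3))
  qed
  then show ?case
    using MQ(1,2) exp_poly_add_term.hyps(2)
    by (intro exp_poly_add_term.prems[of "insert \<mu> M" Q']) auto
qed

lemma degree_shift_diff_less:
  fixes q :: "complex poly"
  assumes "pcompose q [:1, 1:] - q \<noteq> 0"
  shows "degree (pcompose q [:1, 1:] - q) < degree q"
proof -
  have deg: "degree (pcompose q [:1, 1:]) = degree q"
    by (simp add: degree_pcompose)
  have "coeff (pcompose q [:1, 1:]) (degree q) = coeff q (degree q)"
    using lead_coeff_comp[of "[:1, 1::complex:]" q] by (simp add: degree_pcompose)
  then have "coeff (pcompose q [:1, 1:] - q) (degree q) = 0"
    by simp
  moreover have "degree (pcompose q [:1, 1:] - q) \<le> degree q"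
    by (intro degree_diff_le) (simp_all add: deg)
  ultimately show ?thesis
    using assms by (metis le_neq_implies_less leading_coeff_0_iff)
qed

text \<open>The operator taking \<open>h(n)\<close> to \<open>h(n + 1) - \<nu> h(n)\<close> lowers the degree of the polynomial in front of \<open>\<nu>\<^sup>n\<close>,
  while it multiplies the leading coefficient in front of \<open>\<mu>\<^sup>n\<close> by \<open>\<mu> - \<nu> \<noteq> 0\<close>. This gives an induction on the
  number of bases and, for a fixed set of bases, on the degree in front of \<open>\<nu>\<^sup>n\<close>.\<close>

lemma exp_poly_independent:
  fixes Q :: "complex \<Rightarrow> complex poly"
  assumes "finite M" "0 \<notin> M" "\<And>n. (\<Sum>\<mu>\<in>M. \<mu> ^ n * poly (Q \<mu>) (of_nat n)) = 0"
  shows "\<forall>\<mu>\<in>M. Q \<mu> = 0"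
  using assms
proof (induction M arbitrary: Q rule: finite_induct)
  case (insert \<nu> M)
  have "\<nu> \<noteq> 0"
    using insert.prems(1) by auto
  have "\<forall>\<mu>\<in>insert \<nu> M. Q \<mu> = 0"
    if "\<And>n. (\<Sum>\<mu>\<in>insert \<nu> M. \<mu> ^ n * poly (Q \<mu>) (of_nat n)) = 0" for Q
    using that
  proof (induction "if Q \<nu> = 0 then 0 else Suc (degree (Q \<nu>))" arbitrary: Q rule: less_induct)
    case (less Q)
    show ?case
    proof (cases "Q \<nu> = 0")
      case True
      then have "\<And>n. (\<Sum>\<mu>\<in>M. \<mu> ^ n * poly (Q \<mu>) (of_nat n)) = 0"
        using less.prems insert.hyps by simp
      then show ?thesis
        using insert.IH[of Q] insert.prems(1) True by simp
    next
      case False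
      \<comment> \<open>the polynomial in front of \<open>\<mu>\<^sup>n\<close> after the operator has been applied\<close>
      define Q' where "Q' = (\<lambda>\<mu>. smult \<mu> (pcompose (Q \<mu>) [:1, 1:]) - smult \<nu> (Q \<mu>))"
      have Q'\<nu>: "Q' \<nu> = smult \<nu> (pcompose (Q \<nu>) [:1, 1:] - Q \<nu>)"
        by (simp add: Q'_def smult_diff_right)
      have "\<forall>\<mu>\<in>insert \<nu> M. Q' \<mu> = 0"
      proof (rule less.hyps)
        show "(if Q' \<nu> = 0 then 0 else Suc (degree (Q' \<nu>))) <
            (if Q \<nu> = 0 then 0 else Suc (degree (Q \<nu>)))"
          using False degree_shift_diff_less[of "Q \<nu>"] \<open>\<nu> \<noteq> 0\<close> by (auto simp: Q'\<nu>)
      next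
        fix n
        have "(\<Sum>\<mu>\<in>insert \<nu> M. \<mu> ^ n * poly (Q' \<mu>) (of_nat n)) =
            (\<Sum>\<mu>\<in>insert \<nu> M. \<mu> ^ Suc n * poly (Q \<mu>) (of_nat (Suc n))) -
            \<nu> * (\<Sum>\<mu>\<in>insert \<nu> M. \<mu> ^ n * poly (Q \<mu>) (of_nat n))"
          unfolding sum_distrib_left sum_subtractf[symmetric]
          by (intro sum.cong) (auto simp: Q'_def poly_pcompose algebra_simps)
        then show "(\<Sum>\<mu>\<in>insert \<nu> M. \<mu> ^ n * poly (Q' \<mu>) (of_nat n)) = 0"
          by (simp only: less.prems mult_zero_right diff_self)
      qed
      then have Q'0: "\<And>\<mu>. \<mu> \<in> M \<Longrightarrow> Q' \<mu> = 0"
        by simp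
      have M0: "Q \<mu> = 0" if "\<mu> \<in> M" for \<mu>
      proof -
        have "smult \<mu> (pcompose (Q \<mu>) [:1, 1:]) = smult \<nu> (Q \<mu>)"
          using Q'0[OF that] by (simp add: Q'_def)
        then have "\<mu> * lead_coeff (pcompose (Q \<mu>) [:1, 1:]) = \<nu> * lead_coeff (Q \<mu>)"
          by (metis lead_coeff_smult)
        then have "\<mu> * lead_coeff (Q \<mu>) = \<nu> * lead_coeff (Q \<mu>)"
          by (simp add: lead_coeff_comp)
        then show ?thesis
          using that insert.hyps(2) by auto
      qed
      have "poly (Q \<nu>) (of_nat n) = 0" for n
      proof -
        have "(\<Sum>\<mu>\<in>M. \<mu> ^ n * poly (Q \<mu>) (of_nat n)) = 0"
          by (intro sum.neutral) (simp add: M0)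
        then show ?thesis
          using less.prems[of n] insert.hyps \<open>\<nu> \<noteq> 0\<close> by simp
      qed
      then have "range of_nat \<subseteq> {x. poly (Q \<nu>) x = 0}"
        by auto
      moreover have "infinite (range (of_nat :: nat \<Rightarrow> complex))"
        by (intro range_inj_infinite inj_of_nat)
      ultimately have "Q \<nu> = 0"
        using poly_roots_finite finite_subset by blast
      then show ?thesis
        using M0 by simp
    qed
  qed
  then show ?case
    using insert.prems(2) by blast
qed simp

lemma exp_poly_eq_zero:
  assumes "exp_poly h" "\<And>n. h n (of_nat n) = 0"
  shows "h a c = 0"
proof -
  obtain M Q where MQ: "finite M" "0 \<notin> M" "h = (\<lambda>a c. \<Sum>\<mu>\<in>M. \<mu> ^ a * poly (Q \<mu>) c)"
    using exp_poly_normal_form[OF assms(1)] .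
  then have "\<forall>\<mu>\<in>M. Q \<mu> = 0"
    using assms(2) by (intro exp_poly_independent) auto
  then show ?thesis
    by (simp add: MQ(3))
qed

lemma exp_poly_mat_polynomial:
  assumes "mat_polynomial f" "\<And>i j. exp_poly (\<lambda>a c. X a c $ i $ j)"
  shows "exp_poly (\<lambda>a c. f (X a c))"
  using assms(1)
  by induction (auto intro: exp_poly_const assms(2) exp_poly_add exp_poly_mult)

lemma exp_poly_matrix_mult:
  fixes X Y :: "nat \<Rightarrow> complex \<Rightarrow> 'n::finite cmat"
  assumes "\<And>i j. exp_poly (\<lambda>a c. X a c $ i $ j)" "\<And>i j. exp_poly (\<lambda>a c. Y a c $ i $ j)"
  shows "exp_poly (\<lambda>a c. (X a c ** Y a c) $ i $ j)"
  unfolding matrix_matrix_mult_def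
  by (simp add: exp_poly_sum exp_poly_mult[OF assms(2) assms(1)])

lemma gbinomial_poly: "\<exists>q. \<forall>c :: complex. poly q c = c gchoose k"
proof -
  have "poly (smult (1 / fact k) (\<Prod>i=0..<k. [:- of_nat i, 1:])) c = c gchoose k" for c :: complex
    by (simp add: gbinomial_prod_rev poly_prod)
  then show ?thesis
    by blast
qed

lemma exp_poly_upow:
  fixes u :: "'n::finite cmat"
  assumes "mat_unipotent u"
  shows "exp_poly (\<lambda>a c. upow u c $ i $ j)"
proof -
  obtain K where K: "mpow (u - mat 1) K = 0"
    using assms by (rule mat_unipotentE)
  obtain q where q: "\<And>k c :: complex. poly (q k) c = c gchoose k"
    using gbinomial_poly by metis
  have "upow u c $ i $ j = (\<Sum>k<K. poly (q k) c * mpow (u - mat 1) k $ i $ j)" for c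
    by (simp add: upow_nil_eval[OF K] nil_eval_sum q)
  then show ?thesis
    by (simp add: exp_poly_sum exp_poly_mult exp_poly_poly exp_poly_const)
qed

lemma mpow_diagonal:
  "mpow (\<chi> i j. if i = j then d i else 0) k =
     ((\<chi> i j. if i = j then d i ^ k else 0) :: 'n::finite cmat)"
  by (induction k)
    (auto simp: vec_eq_iff mat_def matrix_matrix_mult_def if_distrib[of "\<lambda>x. x * _"] cong: if_cong)

text \<open>The bases of the exponential polynomials are the eigenvalues of \<open>s\<close>, which do not vanish because \<open>s\<close>
  is invertible.\<close>

lemma exp_poly_mpow_semisimple:
  fixes s :: "'n::finite cmat"
  assumes "mat_semisimple s" "invertible s"
  shows "exp_poly (\<lambda>a c. mpow s a $ i $ j)"
proof -
  obtain S :: "'n cmat" and d where S: "invertible S" "s = S ** (\<chi> i j. if i = j then d i else 0) ** matrix_inv S"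
    using assms(1) unfolding mat_semisimple_def by blast
  define D :: "'n cmat" where "D = (\<chi> i j. if i = j then d i else 0)"
  note inv = matrix_inv_cancel[OF S(1)]
  have d: "d k \<noteq> 0" for k
  proof -
    have "s ** S = S ** D"
      by (simp add: S(2) D_def inv flip: matrix_mul_assoc)
    then have "D ** (matrix_inv S ** matrix_inv s ** S) = mat 1"
      using matrix_inv_cancel[OF assms(2)] inv
      by (metis matrix_mul_assoc matrix_mul_lid matrix_mul_rid)
    then have "(D ** (matrix_inv S ** matrix_inv s ** S)) $ k $ k = 1"
      by (simp add: mat_def)
    then show ?thesis
      by (auto simp: D_def matrix_matrix_mult_def[of "vec_lambda _"] if_distrib[of "\<lambda>x. x * _"] cong: if_cong)
  qed
  have "mpow s a = S ** (\<chi> i j. if i = j then d i ^ a else 0) ** matrix_inv S" for a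
    using mpow_conj[OF inv(2), of D a] by (simp add: S(2) D_def mpow_diagonal)
  moreover have "exp_poly (\<lambda>a c. ((\<chi> i j. if i = j then d i ^ a else 0) :: 'n cmat) $ i $ j)" for i j
    using exp_poly_term[OF d, of _ "[:1:]"] by (cases "i = j") (simp_all add: exp_poly_zero)
  ultimately show ?thesis
    by (simp only:) (intro exp_poly_matrix_mult exp_poly_const)
qed

section \<open>The multiplicative Jordan-Chevalley decomposition\<close>

definition jordan_chevalley :: "'n::finite cmat \<Rightarrow> 'n cmat \<Rightarrow> 'n cmat \<Rightarrow> bool" where
  "jordan_chevalley A s u \<longleftrightarrow> mat_semisimple s \<and> mat_unipotent u \<and> s ** u = A \<and> u ** s = A"

lemma jordan_chevalley_exp_poly:
  assumes "jordan_chevalley A s u" "invertible A"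
  shows "exp_poly (\<lambda>a c. (mpow s a ** upow u c) $ i $ j)"
    and "mpow s n ** upow u (of_nat n) = mpow A n"
proof -
  have su: "mat_semisimple s" "mat_unipotent u" "s ** u = A" "u ** s = A"
    using assms(1) by (auto simp: jordan_chevalley_def)
  have "s ** (u ** matrix_inv A) = mat 1"
    by (simp add: matrix_mul_assoc su matrix_inv_cancel assms(2))
  then have "invertible s"
    by (rule matrix_inv_unique)
  then show "exp_poly (\<lambda>a c. (mpow s a ** upow u c) $ i $ j)"
    using su by (intro exp_poly_matrix_mult) (simp_all add: exp_poly_mpow_semisimple exp_poly_upow)
  show "mpow s n ** upow u (of_nat n) = mpow A n"
    using mpow_mult[of s u n] su by (simp add: upow_of_nat)
qed

text \<open>The entries of \<open>s\<^sup>a u\<^sup>c\<close> and \<open>s'\<^sup>a u'\<^sup>c\<close> agree at \<open>a = c = n\<close>, where both products are \<open>A\<^sup>n\<close>. Hence they agree for all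
  exponents, in particular for \<open>a = 0\<close> and \<open>c = 1\<close>.\<close>

lemma jordan_chevalley_unique:
  fixes A :: "'n::finite cmat"
  assumes "jordan_chevalley A s u" "jordan_chevalley A s' u'" "invertible A"
  shows "u = u'" "s = s'"
proof -
  have unip: "mat_unipotent u" "mat_unipotent u'"
    using assms by (auto simp: jordan_chevalley_def)
  have "(mpow s a ** upow u c) $ i $ j + (- 1) * (mpow s' a ** upow u' c) $ i $ j = 0"
    (is "?h a c = 0") for a c i j
  proof (rule exp_poly_eq_zero[of ?h])
    have "exp_poly (\<lambda>a c. (- 1) * (mpow s' a ** upow u' c) $ i $ j)"
      by (rule exp_poly_mult[OF jordan_chevalley_exp_poly(1)[OF assms(2,3)] exp_poly_const])
    then show "exp_poly ?h"
      by (rule exp_poly_add[OF _ jordan_chevalley_exp_poly(1)[OF assms(1,3)]])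
    show "?h n (of_nat n) = 0" for n
      by (simp add: jordan_chevalley_exp_poly(2)[OF assms(1,3)]
          jordan_chevalley_exp_poly(2)[OF assms(2,3)])
  qed
  from this[of 0 1] show u: "u = u'"
    by (simp add: unip vec_eq_iff)
  have "s ** u ** upow u (- 1) = s' ** u ** upow u (- 1)"
    using assms by (simp add: jordan_chevalley_def u)
  then show "s = s'"
    using upow_minus[OF unip(1), of 1] by (simp add: unip flip: matrix_mul_assoc)
qed

lemma linear_algebraic_groupE:
  assumes "linear_algebraic_group G"
  obtains F where "\<And>f. f \<in> F \<Longrightarrow> mat_polynomial f"
    "\<And>A. A \<in> G \<longleftrightarrow> invertible A \<and> (\<forall>f\<in>F. f A = 0)"
proof -
  from assms obtain F where "\<forall>f\<in>F. mat_polynomial f" "G = {A. invertible A \<and> (\<forall>f\<in>F. f A = 0)}"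
    unfolding linear_algebraic_group_def by (elim exE conjE)
  then show thesis
    by (intro that[of F]) simp_all
qed

lemma linear_algebraic_groupD:
  assumes "linear_algebraic_group G"
  shows "mat 1 \<in> G" "A \<in> G \<Longrightarrow> B \<in> G \<Longrightarrow> A ** B \<in> G"
    "A \<in> G \<Longrightarrow> matrix_inv A \<in> G" "A \<in> G \<Longrightarrow> invertible A"
proof -
  show "mat 1 \<in> G" "A \<in> G \<Longrightarrow> B \<in> G \<Longrightarrow> A ** B \<in> G" "A \<in> G \<Longrightarrow> matrix_inv A \<in> G"
    using linear_algebraic_group_def[THEN iffD1, OF assms, THEN conjunct2] by simp_all
  show "A \<in> G \<Longrightarrow> invertible A"
    by (rule linear_algebraic_groupE[OF assms]) simp
qed

lemma mpow_in_group: "linear_algebraic_group G \<Longrightarrow> A \<in> G \<Longrightarrow> mpow A n \<in> G"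
  by (induction n) (simp_all add: linear_algebraic_groupD(1,2))

text \<open>A polynomial equation of \<open>G\<close> turns \<open>s\<^sup>a u\<^sup>c\<close> into an exponential polynomial that vanishes at \<open>a = c = n\<close>,
  because \<open>A\<^sup>n\<close> lies in \<open>G\<close>. It therefore vanishes identically, and \<open>a = 0\<close> shows that \<open>u\<^sup>c\<close> satisfies the
  equation.\<close>

lemma jordan_chevalley_in_group:
  fixes G :: "'n::finite cmat set"
  assumes G: "linear_algebraic_group G" and A: "A \<in> G" "jordan_chevalley A s u"
  shows "upow u c \<in> G" "u \<in> G" "s \<in> G"
proof -
  have unip: "mat_unipotent u"
    using A(2) by (auto simp: jordan_chevalley_def)
  obtain F where F: "\<And>f. f \<in> F \<Longrightarrow> mat_polynomial f"
      "\<And>A. A \<in> G \<longleftrightarrow> invertible A \<and> (\<forall>f\<in>F. f A = 0)"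
    by (rule linear_algebraic_groupE[OF G]) (rule that)
  have inv: "invertible A"
    using linear_algebraic_groupD(4)[OF G A(1)] .
  show *: "upow u c \<in> G" for c
  proof -
    have "f (mpow s 0 ** upow u c) = 0" if "f \<in> F" for f
    proof (rule exp_poly_eq_zero[of "\<lambda>a c. f (mpow s a ** upow u c)"])
      show "exp_poly (\<lambda>a c. f (mpow s a ** upow u c))"
        by (rule exp_poly_mat_polynomial[where f = f and X = "\<lambda>a c. mpow s a ** upow u c"])
          (rule F(1)[OF that], rule jordan_chevalley_exp_poly(1)[OF A(2) inv])
      show "f (mpow s n ** upow u (of_nat n)) = 0" for n
        unfolding jordan_chevalley_exp_poly(2)[OF A(2) inv]
        using mpow_in_group[OF G A(1), of n] that F(2)[of "mpow A n"] by blast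
    qed
    moreover have "invertible (upow u c)"
      using upow_minus[OF unip] by (rule matrix_inv_unique)
    ultimately show ?thesis
      using F(2) by simp
  qed
  from *[of 1] show "u \<in> G"
    by (simp add: unip)
  have "s ** u = A"
    using A(2) by (simp add: jordan_chevalley_def)
  then have "s = A ** upow u (- 1)"
    using upow_minus[OF unip, of 1] by (metis matrix_mul_assoc matrix_mul_rid unip upow_1)
  then show "s \<in> G"
    using linear_algebraic_groupD(2)[OF G A(1) *] by simp
qed

lemma mat_semisimple_1: "mat_semisimple (mat 1 :: 'n::finite cmat)"
proof -
  have "(\<chi> i j. if i = j then 1 else 0) = (mat 1 :: 'n cmat)"
    by (simp add: mat_def)
  moreover have "invertible (mat 1 :: 'n cmat)" "matrix_inv (mat 1 :: 'n cmat) = mat 1"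
    by (rule matrix_inv_unique[of _ "mat 1"], simp)+
  ultimately show ?thesis
    unfolding mat_semisimple_def by (intro exI[of _ "mat 1"] exI[of _ "\<lambda>i. 1"]) simp
qed

lemma unipotent_powers_in_group:
  assumes "linear_algebraic_group G" "u \<in> G" "mat_unipotent u"
  shows "upow u c \<in> G"
  using assms
  by (intro jordan_chevalley_in_group(1)[of G u "mat 1"])
    (auto simp: jordan_chevalley_def mat_semisimple_1)

lemma mlog_in_lie_algebra:
  assumes "linear_algebraic_group G" "u \<in> G" "mat_unipotent u"
  shows "mlog u \<in> lie_algebra G"
  using unipotent_powers_in_group[OF assms]
  by (auto simp: lie_algebra_def scaleR_matrix upow_def map_matrix_mult)

lemma coprime_linear_power:
  fixes \<alpha> \<mu> :: complex
  assumes "\<alpha> \<noteq> \<mu>"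
  shows "coprime ([:-\<alpha>, 1:] ^ m) ([:-\<mu>, 1:] ^ m)"
proof -
  have "coprime [:-\<alpha>, 1:] [:-\<mu>, 1:]"
  proof (rule coprimeI)
    fix d assume "d dvd [:-\<alpha>, 1:]" "d dvd [:-\<mu>, 1:]"
    then have "d dvd [:-\<alpha>, 1:] - [:-\<mu>, 1:]"
      by (rule dvd_diff)
    also have "[:-\<alpha>, 1:] - [:-\<mu>, 1:] = [:\<mu> - \<alpha>:]"
      by simp
    finally have "d dvd [:\<mu> - \<alpha>:]" .
    moreover have "[:\<mu> - \<alpha>:] dvd 1"
      using assms by (simp add: is_unit_const_poly_iff dvd_field_iff)
    ultimately show "is_unit d"
      by (rule dvd_trans)
  qed
  then show ?thesis
    by (simp only: coprime_power_left_iff coprime_power_right_iff simp_thms)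
qed

lemma coprime_linear_power_prod:
  fixes \<mu> :: complex
  assumes "\<mu> \<notin> R"
  shows "coprime ([:-\<mu>, 1:] ^ m) (\<Prod>\<alpha>\<in>R. [:-\<alpha>, 1:] ^ m)"
  using assms by (intro prod_coprime_right coprime_linear_power) auto

lemma prod_linear_power_dvd:
  fixes p :: "complex poly"
  assumes "finite R" "\<And>\<alpha>. \<alpha> \<in> R \<Longrightarrow> [:-\<alpha>, 1:] ^ m dvd p"
  shows "(\<Prod>\<alpha>\<in>R. [:-\<alpha>, 1:] ^ m) dvd p"
  using assms
  by (induction R rule: finite_induct) (auto intro!: divides_mult coprime_linear_power_prod)

text \<open>The Chinese remainder theorem for the pairwise coprime moduli \<open>(X - \<alpha>)\<^sup>m\<close>.\<close>

lemma interpolation: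
  fixes f :: "complex \<Rightarrow> complex"
  assumes "finite R"
  obtains P where "\<And>\<alpha>. \<alpha> \<in> R \<Longrightarrow> [:-\<alpha>, 1:] ^ m dvd P - [:f \<alpha>:]"
  using assms
proof (induction R arbitrary: thesis rule: finite_induct)
  case (insert \<mu> R)
  from insert.IH obtain P where P: "\<And>\<alpha>. \<alpha> \<in> R \<Longrightarrow> [:-\<alpha>, 1:] ^ m dvd P - [:f \<alpha>:]"
    by blast
  define E where "E = [:-\<mu>, 1:] ^ m"
  define Q where "Q = (\<Prod>\<alpha>\<in>R. [:-\<alpha>, 1:] ^ m)"
  have "coprime E Q"
    unfolding E_def Q_def using insert.hyps(2) by (rule coprime_linear_power_prod)
  then obtain x y where xy: "x * E + y * Q = 1"
    using bezout_coefficients_fst_snd[of E Q] by (auto simp: coprime_iff_gcd_eq_1)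
  define P' where "P' = P + y * Q * ([:f \<mu>:] - P)"
  show thesis
  proof (rule insert.prems)
    fix \<alpha> assume "\<alpha> \<in> insert \<mu> R"
    then consider "\<alpha> = \<mu>" | "\<alpha> \<in> R" by blast
    then show "[:-\<alpha>, 1:] ^ m dvd P' - [:f \<alpha>:]"
    proof cases
      case 1
      have "P' - [:f \<mu>:] = (P - [:f \<mu>:]) * (1 - y * Q)"
        by (simp add: P'_def algebra_simps)
      also have "\<dots> = (P - [:f \<mu>:]) * x * E"
        using xy by (simp add: algebra_simps flip: xy)
      finally show ?thesis
        by (simp add: 1 E_def)
    next
      case 2
      then have "[:-\<alpha>, 1:] ^ m dvd Q"
        unfolding Q_def using insert.hyps(1) by (intro dvd_prodI)
      then have "[:-\<alpha>, 1:] ^ m dvd (P - [:f \<alpha>:]) + y * ([:f \<mu>:] - P) * Q"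
        by (intro dvd_add P 2) simp
      then show ?thesis
        by (simp add: P'_def algebra_simps)
    qed
  qed
qed auto

lemma mpeval_linear: "mpeval [:-c, 1:] A = A - mat c"
  using mat_add[of c "- c", where 'n = 'a] by (simp add: eq_neg_iff_add_eq_0 add.commute)

text \<open>Let \<open>e \<mu>\<close> be a polynomial with value \<open>1\<close> at \<open>\<mu>\<close> and \<open>0\<close> at the other roots. The values of these polynomials
  at \<open>s\<close> sum to the identity, and that of \<open>e \<mu>\<close> maps every vector to zero or to an eigenvector for \<open>\<mu>\<close>. So the eigenvectors span, and a basis chosen among them diagonalizes \<open>s\<close>.\<close>

lemma mat_semisimple_if_simple_roots:
  fixes s :: "'n::finite cmat"
  assumes "finite R" "mpeval (\<Prod>\<alpha>\<in>R. [:-\<alpha>, 1:]) s = 0"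
  shows "mat_semisimple s"
proof -
  define E where "E = {v. \<exists>\<alpha>. s *v v = \<alpha> *s v}"
  have mult_mat: "mat c *v v = c *s v" for c and v :: "complex^'n"
    by (simp add: vec_eq_iff matrix_vector_mult_def mat_def if_distrib[of "\<lambda>x. x * _"] cong: if_cong)
  have ann: "mpeval p s = 0" if "\<And>\<alpha>. \<alpha> \<in> R \<Longrightarrow> poly p \<alpha> = 0" for p
    using prod_linear_power_dvd[OF assms(1), of 1 p] that assms(2)
    by (auto simp: poly_eq_0_iff_dvd intro: mpeval_dvd_zero)
  have "\<exists>P. \<forall>\<alpha>\<in>R. [:-\<alpha>, 1:] ^ 1 dvd P - [:if \<alpha> = \<mu> then 1 else 0:]" for \<mu>
    using interpolation[OF assms(1), of 1 "\<lambda>\<alpha>. if \<alpha> = \<mu> then 1 else 0"] by meson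
  then obtain e where "\<And>\<mu> \<alpha>. \<alpha> \<in> R \<Longrightarrow> [:-\<alpha>, 1:] ^ 1 dvd e \<mu> - [:if \<alpha> = \<mu> then 1 else 0:]"
    by metis
  then have e: "\<And>\<mu> \<alpha>. \<alpha> \<in> R \<Longrightarrow> poly (e \<mu>) \<alpha> = (if \<alpha> = \<mu> then 1 else 0)"
    by (simp flip: poly_eq_0_iff_dvd)
  have "v \<in> vec.span E" for v
  proof -
    have "mpeval ((\<Sum>\<mu>\<in>R. e \<mu>) - 1) s = 0"
      by (rule ann) (simp add: poly_sum e assms(1))
    then have "v = mpeval (\<Sum>\<mu>\<in>R. e \<mu>) s *v v"
      by (simp add: mpeval_diff)
    also have "\<dots> = (\<Sum>\<mu>\<in>R. mpeval (e \<mu>) s *v v)"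
      unfolding mpeval_sum
      by (induction R rule: infinite_finite_induct) (auto simp: matrix_vector_mult_add_rdistrib)
    also have "\<dots> \<in> vec.span E"
    proof (intro vec.span_sum vec.span_base)
      fix \<mu> assume "\<mu> \<in> R"
      have "mpeval ([:-\<mu>, 1:] * e \<mu>) s = 0"
        by (rule ann) (auto simp: e)
      then have "s ** mpeval (e \<mu>) s = mat \<mu> ** mpeval (e \<mu>) s"
        by (simp only: mpeval_mult mpeval_linear matrix_diff_distribs right_minus_eq)
      then have "s *v (mpeval (e \<mu>) s *v v) = \<mu> *s (mpeval (e \<mu>) s *v v)"
        by (metis matrix_vector_mul_assoc mult_mat)
      then show "mpeval (e \<mu>) s *v v \<in> E"
        by (auto simp: E_def)
    qed
    finally show ?thesis .
  qed
  then have span: "vec.span E = UNIV"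
    by blast
  obtain B where B: "B \<subseteq> E" "vec.independent B" "E \<subseteq> vec.span B" "card B = vec.dim E"
    by (rule vec.basis_exists[of E])
  have spanB: "vec.span B = UNIV"
    using vec.span_minimal[OF B(3) vec.subspace_span] span by (simp add: top.extremum_unique)
  have "card B = CARD('n)"
    using B(4) vec.dim_span[of E] by (simp only: span vec_dim_card)
  moreover have "finite B"
    using B(2) by (rule vec.finiteI_independent)
  ultimately obtain b :: "'n \<Rightarrow> complex^'n" where b: "bij_betw b UNIV B"
    using finite_same_card_bij[OF finite_class.finite_UNIV, of B] by auto
  define S :: "'n cmat" where "S = (\<chi> i j. b j $ i)"
  have col: "column j S = b j" for j
    by (simp add: S_def column_def vec_eq_iff)
  have rangeb: "range b = B"
    using b by (simp add: bij_betw_def)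
  have "columns S = range b"
    unfolding columns_def col by blast
  then have "vec.span (columns S) = UNIV"
    by (simp only: rangeb spanB)
  then obtain S' where S': "S ** S' = mat 1"
    using matrix_right_invertible_span_columns[of S] by blast
  have "b j \<in> E" for j
    using rangeb B(1) by blast
  then have "\<forall>j. \<exists>\<alpha>. s *v b j = \<alpha> *s b j"
    unfolding E_def by blast
  then obtain d where d: "\<And>j. s *v b j = d j *s b j"
    by metis
  have "s ** S = S ** (\<chi> i j. if i = j then d i else 0)"
  proof -
    have "(s ** S) $ i $ j = (S ** (\<chi> i j. if i = j then d i else 0)) $ i $ j" for i j
    proof -
      have "(s ** S) $ i $ j = (s *v b j) $ i"
        by (simp add: matrix_matrix_mult_def matrix_vector_mult_def S_def)
      also have "\<dots> = (S ** (\<chi> i j. if i = j then d i else 0)) $ i $ j"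
        by (simp add: d matrix_matrix_mult_def S_def if_distrib[of "\<lambda>x. _ * x"] cong: if_cong)
      finally show ?thesis .
    qed
    then show ?thesis
      by (simp add: vec_eq_iff)
  qed
  then have "s ** (S ** S') = S ** (\<chi> i j. if i = j then d i else 0) ** S'"
    by (simp only: matrix_mul_assoc)
  then have "s = S ** (\<chi> i j. if i = j then d i else 0) ** matrix_inv S"
    by (simp only: S' matrix_mul_rid matrix_inv_unique(2)[OF S'])
  then show ?thesis
    unfolding mat_semisimple_def using matrix_inv_unique(1)[OF S'] by blast
qed

lemma mpeval_pcompose: "mpeval (pcompose p q) A = mpeval p (mpeval q A)"
  by (induction p) (auto simp: pcompose_pCons mpeval_add mpeval_mult)

text \<open>With \<open>p\<close> dividing \<open>\<Prod> (X - \<alpha>)\<^sup>m\<close>, the semisimple part is \<open>P(A)\<close> for \<open>P\<close> congruent to \<open>\<alpha>\<close> modulo \<open>(X - \<alpha>)\<^sup>m\<close>, its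
  inverse is \<open>P'(A)\<close> for \<open>P'\<close> congruent to \<open>1/\<alpha>\<close>, and the unipotent part is \<open>A P'(A)\<close>. The polynomials depend
  on \<open>p\<close> only and serve all matrices annihilated by \<open>p\<close> at once; on the set of all matrices the
  decomposition is not even continuous.\<close>

lemma jordan_chevalley_polynomials:
  assumes "poly p 0 \<noteq> 0"
  obtains S Y where
    "\<And>A :: 'n::finite cmat. mpeval p A = 0 \<Longrightarrow> jordan_chevalley A (mpeval S A) (mpeval Y A)"
proof -
  define R where "R = {x. poly p x = 0}"
  define m where "m = Suc (degree p)"
  define Q where "Q = (\<Prod>\<alpha>\<in>R. [:-\<alpha>, 1:])"
  have "p \<noteq> 0"
    using assms by auto
  then have fin: "finite R"
    unfolding R_def by (rule poly_roots_finite)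
  have Qm: "Q ^ m = (\<Prod>\<alpha>\<in>R. [:-\<alpha>, 1:] ^ m)"
    by (simp add: Q_def prod_power_distrib)
  have decomp: "smult (lead_coeff p) (\<Prod>\<alpha>\<in>R. [:-\<alpha>, 1:] ^ order \<alpha> p) = p"
    unfolding R_def by (rule complex_poly_decompose)
  have "(\<Prod>\<alpha>\<in>R. [:-\<alpha>, 1:] ^ order \<alpha> p) dvd Q ^ m"
    unfolding Qm using order_degree[OF \<open>p \<noteq> 0\<close>]
    by (intro prod_dvd_prod le_imp_power_dvd) (simp add: m_def le_SucI)
  moreover have "lead_coeff p \<noteq> 0"
    using \<open>p \<noteq> 0\<close> by simp
  ultimately have "smult (lead_coeff p) (\<Prod>\<alpha>\<in>R. [:-\<alpha>, 1:] ^ order \<alpha> p) dvd Q ^ m"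
    by (rule smult_dvd)
  then have "p dvd Q ^ m"
    by (simp only: decomp)
  have nonzero: "\<alpha> \<noteq> 0" if "\<alpha> \<in> R" for \<alpha>
    using that assms by (auto simp: R_def)
  obtain P where P: "\<And>\<alpha>. \<alpha> \<in> R \<Longrightarrow> [:-\<alpha>, 1:] ^ m dvd P - [:\<alpha>:]"
    using interpolation[OF fin, of m "\<lambda>\<alpha>. \<alpha>"] by metis
  obtain P' where P': "\<And>\<alpha>. \<alpha> \<in> R \<Longrightarrow> [:-\<alpha>, 1:] ^ m dvd P' - [:inverse \<alpha>:]"
    using interpolation[OF fin, of m inverse] by metis
  define Y where "Y = [:0, 1:] * P'"
  have dvd1: "Q ^ m dvd pcompose Q P"
    unfolding Qm
  proof (rule prod_linear_power_dvd[OF fin])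
    fix \<alpha> assume "\<alpha> \<in> R"
    then have "P - [:\<alpha>:] dvd (\<Prod>\<alpha>\<in>R. P - [:\<alpha>:])"
      using fin by (intro dvd_prodI)
    also have "(\<Prod>\<alpha>\<in>R. P - [:\<alpha>:]) = pcompose Q P"
      by (simp add: Q_def pcompose_prod pcompose_pCons diff_conv_add_uminus add.commute del: add_uminus_conv_diff)
    finally show "[:-\<alpha>, 1:] ^ m dvd pcompose Q P"
      using P[OF \<open>\<alpha> \<in> R\<close>] dvd_trans by blast
  qed
  have dvd2: "Q ^ m dvd P * Y - [:0, 1:]"
    unfolding Qm
  proof (rule prod_linear_power_dvd[OF fin])
    fix \<alpha> assume "\<alpha> \<in> R"
    have split: "P * (x * P') - x = ((P - a) * P' + a * (P' - b) + (a * b - 1)) * x"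
      for a b x :: "complex poly"
      by (simp add: algebra_simps)
    have "[:\<alpha>:] * [:inverse \<alpha>:] - 1 = 0"
      using nonzero[OF \<open>\<alpha> \<in> R\<close>] by (simp add: one_pCons)
    then have "P * Y - [:0, 1:] =
        ((P - [:\<alpha>:]) * P' + [:\<alpha>:] * (P' - [:inverse \<alpha>:])) * [:0, 1:]"
      unfolding Y_def split[of "[:0, 1:]" "[:\<alpha>:]" "[:inverse \<alpha>:]"] by (simp only: add_0_right)
    moreover have "[:-\<alpha>, 1:] ^ m dvd (P - [:\<alpha>:]) * P' + [:\<alpha>:] * (P' - [:inverse \<alpha>:])"
      by (intro dvd_add dvd_mult dvd_mult2 P P' \<open>\<alpha> \<in> R\<close>)
    ultimately show "[:-\<alpha>, 1:] ^ m dvd P * Y - [:0, 1:]"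
      by (simp only: dvd_mult2)
  qed
  have dvd3: "Q dvd Y - 1"
    unfolding Q_def
  proof (rule prod_linear_power_dvd[OF fin, of 1, simplified])
    fix \<alpha> assume "\<alpha> \<in> R"
    have "[:-\<alpha>, 1:] dvd P' - [:inverse \<alpha>:]"
      using P'[OF \<open>\<alpha> \<in> R\<close>] by (simp add: m_def dvd_mult_left)
    then have "poly P' \<alpha> = inverse \<alpha>"
      by (simp flip: poly_eq_0_iff_dvd)
    then show "[:-\<alpha>, 1:] dvd Y - 1"
      using nonzero[OF \<open>\<alpha> \<in> R\<close>] by (simp add: Y_def flip: poly_eq_0_iff_dvd)
  qed
  show thesis
  proof (rule that)
    fix A :: "'n cmat"
    assume "mpeval p A = 0"
    then have 0: "mpeval (Q ^ m) A = 0"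
      using \<open>p dvd Q ^ m\<close> mpeval_dvd_zero by blast
    have "mat_semisimple (mpeval P A)"
      using mpeval_dvd_zero[OF dvd1 0] unfolding Q_def
      by (intro mat_semisimple_if_simple_roots[OF fin]) (simp add: mpeval_pcompose)
    moreover have "mpow (mpeval Y A - mat 1) m = 0"
    proof -
      have "mpeval ((Y - 1) ^ m) A = 0"
        using dvd_power_same[OF dvd3, of m] 0 mpeval_dvd_zero by blast
      then show ?thesis
        by (simp add: mpeval_power mpeval_diff)
    qed
    moreover have "mpeval P A ** mpeval Y A = A"
      using mpeval_dvd_zero[OF dvd2 0] by (simp add: mpeval_diff mpeval_mult)
    ultimately show "jordan_chevalley A (mpeval P A) (mpeval Y A)"
      by (auto simp: jordan_chevalley_def mat_unipotent_def mat_nilpotent_def mpeval_commute[of Y])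
  qed
qed

lemma jordan_chevalley_exists:
  fixes A :: "'n::finite cmat"
  assumes "invertible A"
  obtains s u where "jordan_chevalley A s u"
proof -
  obtain p where p: "poly p 0 \<noteq> 0" "mpeval p A = 0"
    using assms by (rule annihilating_polynomial_invertible)
  obtain S Y where "\<And>A :: 'n cmat. mpeval p A = 0 \<Longrightarrow> jordan_chevalley A (mpeval S A) (mpeval Y A)"
    using jordan_chevalley_polynomials[OF p(1), where 'n = 'n] by blast
  then show thesis
    using that p(2) by blast
qed

lemma jordan_chevalley_conj:
  fixes S :: "'n::finite cmat"
  assumes "jordan_chevalley A s u" "S ** S' = mat 1"
  shows "jordan_chevalley (S' ** A ** S) (S' ** s ** S) (S' ** u ** S)"
proof -
  have mult: "S' ** X ** S ** (S' ** Y ** S) = S' ** (X ** Y) ** S" for X Y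
    using assms(2) by (metis matrix_mul_assoc matrix_mul_rid)
  obtain T :: "'n cmat" and d where T: "invertible T" "s = T ** (\<chi> i j. if i = j then d i else 0) ** matrix_inv T"
    using assms(1) unfolding jordan_chevalley_def mat_semisimple_def by blast
  have "S' ** T ** (matrix_inv T ** S) = mat 1"
    using matrix_inv_cancel'[OF T(1)] assms(2) matrix_left_right_inverse by (metis matrix_mul_assoc)
  note inv = matrix_inv_unique[OF this]
  have "mat_semisimple (S' ** s ** S)"
    unfolding mat_semisimple_def
    by (intro exI[of _ "S' ** T"] exI[of _ d] conjI inv(1)) (simp add: inv(2) T(2) matrix_mul_assoc)
  then show ?thesis
    using assms unipotent_conj(1)[OF assms(2)] by (simp add: jordan_chevalley_def mult)
qed

definition msemi :: "'n::finite cmat \<Rightarrow> 'n cmat" where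
  "msemi A = (THE s. \<exists>u. jordan_chevalley A s u)"

definition munip :: "'n::finite cmat \<Rightarrow> 'n cmat" where
  "munip A = (THE u. \<exists>s. jordan_chevalley A s u)"

lemma
  assumes "invertible A" "jordan_chevalley A s u"
  shows msemi_eq: "msemi A = s" and munip_eq: "munip A = u"
  unfolding msemi_def munip_def
  using jordan_chevalley_unique(2)[OF _ assms(2,1)] jordan_chevalley_unique(1)[OF _ assms(2,1)] assms(2)
  by (blast intro: the_equality)+

lemma jordan_chevalley_msemi_munip:
  assumes "invertible A"
  shows "jordan_chevalley A (msemi A) (munip A)"
proof -
  obtain s u where su: "jordan_chevalley A s u"
    using assms by (rule jordan_chevalley_exists)
  then show ?thesis
    by (simp add: msemi_eq[OF assms su] munip_eq[OF assms su])
qed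

lemma mat_unipotent_munip: "invertible A \<Longrightarrow> mat_unipotent (munip A)"
  using jordan_chevalley_msemi_munip by (auto simp: jordan_chevalley_def)

lemma
  assumes "linear_algebraic_group G" "A \<in> G"
  shows msemi_in_group: "msemi A \<in> G" and munip_in_group: "munip A \<in> G"
  using jordan_chevalley_in_group(2,3)[OF assms]
    jordan_chevalley_msemi_munip[OF linear_algebraic_groupD(4)[OF assms]] by blast+

lemma
  fixes S :: "'n::finite cmat"
  assumes "S ** S' = mat 1" "invertible A"
  shows msemi_conj: "msemi (S' ** A ** S) = S' ** msemi A ** S"
    and munip_conj: "munip (S' ** A ** S) = S' ** munip A ** S"
proof -
  have S': "S' ** S = mat 1"
    using assms(1) matrix_left_right_inverse by blast
  have inv: "invertible (S' ** A ** S)"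
    using matrix_inv_unique(1)[OF assms(1)] matrix_inv_unique(1)[OF S'] assms(2)
    by (intro invertible_mult)
  note jc = jordan_chevalley_conj[OF jordan_chevalley_msemi_munip[OF assms(2)] assms(1)]
  show "msemi (S' ** A ** S) = S' ** msemi A ** S"
    by (rule msemi_eq[OF inv jc])
  show "munip (S' ** A ** S) = S' ** munip A ** S"
    by (rule munip_eq[OF inv jc])
qed

section \<open>Holomorphic matrix-valued functions\<close>

lemma holo2_onI:
  "(\<And>x. x \<in> W \<Longrightarrow> \<exists>a b. (f has_derivative (\<lambda>y. a * fst y + b * snd y)) (at x)) \<Longrightarrow> holo2_on f W"
  unfolding holo2_on_def case_prod_beta' by blast

lemma holo2_onD:
  assumes "holo2_on f W" "x \<in> W"
  obtains a b where "(f has_derivative (\<lambda>y. a * fst y + b * snd y)) (at x)"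
  using assms unfolding holo2_on_def case_prod_beta' by blast

lemma holo2_on_const: "holo2_on (\<lambda>x. c) W"
  by (rule holo2_onI, rule exI[of _ 0], rule exI[of _ 0]) simp

lemma holo2_on_fst: "holo2_on fst W"
  by (rule holo2_onI, rule exI[of _ 1], rule exI[of _ 0])
    (simp add: bounded_linear_imp_has_derivative bounded_linear_fst)

lemma holo2_on_snd: "holo2_on snd W"
  by (rule holo2_onI, rule exI[of _ 0], rule exI[of _ 1])
    (simp add: bounded_linear_imp_has_derivative bounded_linear_snd)

lemma holo2_on_add:
  assumes "holo2_on f W" "holo2_on g W"
  shows "holo2_on (\<lambda>x. f x + g x) W"
proof (rule holo2_onI)
  fix x assume "x \<in> W"
  obtain a b where f: "(f has_derivative (\<lambda>y. a * fst y + b * snd y)) (at x)"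
    using assms(1) \<open>x \<in> W\<close> by (rule holo2_onD)
  obtain a' b' where g: "(g has_derivative (\<lambda>y. a' * fst y + b' * snd y)) (at x)"
    using assms(2) \<open>x \<in> W\<close> by (rule holo2_onD)
  have "((\<lambda>x. f x + g x) has_derivative (\<lambda>y. (a + a') * fst y + (b + b') * snd y)) (at x)"
    by (rule has_derivative_eq_rhs[OF has_derivative_add[OF f g]]) (simp add: algebra_simps)
  then show "\<exists>a b. ((\<lambda>x. f x + g x) has_derivative (\<lambda>y. a * fst y + b * snd y)) (at x)"
    by blast
qed

lemma holo2_on_mult:
  assumes "holo2_on f W" "holo2_on g W"
  shows "holo2_on (\<lambda>x. f x * g x) W"
proof (rule holo2_onI)
  fix x assume "x \<in> W"
  obtain a b where f: "(f has_derivative (\<lambda>y. a * fst y + b * snd y)) (at x)"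
    using assms(1) \<open>x \<in> W\<close> by (rule holo2_onD)
  obtain a' b' where g: "(g has_derivative (\<lambda>y. a' * fst y + b' * snd y)) (at x)"
    using assms(2) \<open>x \<in> W\<close> by (rule holo2_onD)
  have "((\<lambda>x. f x * g x) has_derivative
      (\<lambda>y. (f x * a' + a * g x) * fst y + (f x * b' + b * g x) * snd y)) (at x)"
    by (rule has_derivative_eq_rhs[OF has_derivative_mult[OF f g]]) (simp add: algebra_simps)
  then show "\<exists>a b. ((\<lambda>x. f x * g x) has_derivative (\<lambda>y. a * fst y + b * snd y)) (at x)"
    by blast
qed

lemma holo2_on_sum:
  "(\<And>i. i \<in> I \<Longrightarrow> holo2_on (f i) W) \<Longrightarrow> holo2_on (\<lambda>x. \<Sum>i\<in>I. f i x) W"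
  by (induction I rule: infinite_finite_induct) (auto intro: holo2_on_const holo2_on_add)

lemma holo2_on_compose:
  assumes "f holomorphic_on V" "open V" "holo2_on g W" "\<And>x. x \<in> W \<Longrightarrow> g x \<in> V"
  shows "holo2_on (\<lambda>x. f (g x)) W"
proof (rule holo2_onI)
  fix x assume "x \<in> W"
  obtain a b where g: "(g has_derivative (\<lambda>y. a * fst y + b * snd y)) (at x)"
    using assms(3) \<open>x \<in> W\<close> by (rule holo2_onD)
  have "(f has_field_derivative deriv f (g x)) (at (g x))"
    using assms(1,2) assms(4)[OF \<open>x \<in> W\<close>] by (rule holomorphic_derivI)
  then have f: "(f has_derivative (*) (deriv f (g x))) (at (g x))"
    by (rule has_field_derivative_imp_has_derivative)
  have "((\<lambda>x. f (g x)) has_derivative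
      (\<lambda>y. (deriv f (g x) * a) * fst y + (deriv f (g x) * b) * snd y)) (at x)"
    by (rule has_derivative_eq_rhs[OF has_derivative_compose[OF g f]]) (simp add: algebra_simps)
  then show "\<exists>a b. ((\<lambda>x. f (g x)) has_derivative (\<lambda>y. a * fst y + b * snd y)) (at x)"
    by blast
qed

lemma holo2_on_poly: "holo2_on c W \<Longrightarrow> holo2_on (\<lambda>x. poly q (c x)) W"
  by (induction q) (auto intro: holo2_on_const holo2_on_add holo2_on_mult)

lemma holo2_on_target: "holo2_on (\<lambda>x. exp (fst x) * snd x) W"
  by (rule holo2_on_mult[OF holo2_on_compose[OF holomorphic_on_exp open_UNIV holo2_on_fst] holo2_on_snd])
    simp

lemma holomorphic_on_slice:
  assumes "holo2_on f W"
  shows "(\<lambda>z. f (l, z)) holomorphic_on {z. (l, z) \<in> W}"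
proof (rule holomorphic_onI)
  fix z assume "z \<in> {z. (l, z) \<in> W}"
  then have "(l, z) \<in> W"
    by simp
  then obtain a b where f: "(f has_derivative (\<lambda>y. a * fst y + b * snd y)) (at (l, z))"
    by (rule holo2_onD[OF assms])
  have "((\<lambda>z. (l, z)) has_derivative (\<lambda>v. (0, v))) (at z)"
    by (auto intro!: derivative_eq_intros)
  from has_derivative_compose[OF this f] have "((\<lambda>z. f (l, z)) has_derivative (*) b) (at z)"
    by simp
  then have "(\<lambda>z. f (l, z)) field_differentiable at z"
    by (auto simp: field_differentiable_def has_field_derivative_def)
  then show "(\<lambda>z. f (l, z)) field_differentiable at z within {z. (l, z) \<in> W}"
    by (rule field_differentiable_at_within)
qed

lemma mat_holo2_on_subset: "mat_holo2_on f W \<Longrightarrow> W' \<subseteq> W \<Longrightarrow> mat_holo2_on f W'"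
  unfolding mat_holo2_on_def holo2_on_def by blast

lemma mat_holo2_on_const: "mat_holo2_on (\<lambda>x. A) W"
  by (simp add: mat_holo2_on_def holo2_on_const)

lemma mat_holo2_on_mult:
  assumes "mat_holo2_on f W" "mat_holo2_on g W"
  shows "mat_holo2_on (\<lambda>x. f x ** g x) W"
  using assms unfolding mat_holo2_on_def matrix_matrix_mult_def
  by (simp add: holo2_on_sum holo2_on_mult)

lemma mat_holo2_on_sum:
  "(\<And>i. i \<in> I \<Longrightarrow> mat_holo2_on (f i) W) \<Longrightarrow> mat_holo2_on (\<lambda>x. \<Sum>i\<in>I. f i x) W"
  by (simp add: mat_holo2_on_def holo2_on_sum)

lemma mat_holo2_on_mpow: "mat_holo2_on f W \<Longrightarrow> mat_holo2_on (\<lambda>x. mpow (f x) k) W"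
  by (induction k) (auto intro: mat_holo2_on_const mat_holo2_on_mult)

lemma mat_holo2_on_compose:
  assumes "mat_holo_on f V" "open V" "holo2_on g W" "\<And>x. x \<in> W \<Longrightarrow> g x \<in> V"
  shows "mat_holo2_on (\<lambda>x. f (g x)) W"
  unfolding mat_holo2_on_def
proof (intro allI)
  fix i j
  have "(\<lambda>z. f z $ i $ j) holomorphic_on V"
    using assms(1) by (simp add: mat_holo_on_def)
  then show "holo2_on (\<lambda>x. f (g x) $ i $ j) W"
    using assms(2-4) by (rule holo2_on_compose)
qed

text \<open>The powers \<open>f\<^sup>c\<close> in their polynomial form: the coefficients \<open>c gchoose k\<close> are polynomials in \<open>c\<close>. The form
  makes sense, and is differentiable, also where \<open>f\<close> fails to be unipotent, so no neighbourhood of the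
  domain has to be controlled.\<close>

lemma mat_holo2_on_binomial:
  fixes f :: "complex \<times> complex \<Rightarrow> 'n::finite cmat"
  assumes "mat_holo2_on f W" "holo2_on c W"
  shows "mat_holo2_on (\<lambda>x. nil_eval K (fps_binomial (c x)) (f x - mat 1)) W"
proof -
  have minus_one: "mat_holo2_on (\<lambda>x. f x - mat 1) W"
    unfolding mat_holo2_on_def
  proof (intro allI)
    fix i j
    have "holo2_on (\<lambda>x. f x $ i $ j) W"
      using assms(1) by (simp add: mat_holo2_on_def)
    from holo2_on_add[OF this holo2_on_const[of "- (mat 1 :: 'n cmat) $ i $ j"]]
    show "holo2_on (\<lambda>x. (f x - mat 1) $ i $ j) W"
      by simp
  qed
  have "mat_holo2_on (\<lambda>x. mat (c x gchoose k) ** mpow (f x - mat 1) k) W" for k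
  proof -
    obtain q where "\<And>c :: complex. poly q c = c gchoose k"
      using gbinomial_poly by blast
    then have "holo2_on (\<lambda>x. c x gchoose k) W"
      using holo2_on_poly[OF assms(2), of q] by simp
    then show ?thesis
      using mat_holo2_on_mpow[OF minus_one, of k] by (simp add: mat_holo2_on_def holo2_on_mult)
  qed
  then show ?thesis
    by (simp add: nil_eval_sum mat_holo2_on_sum)
qed

lemma mat_holo_on_slice:
  "mat_holo2_on f W \<Longrightarrow> mat_holo_on (\<lambda>z. f (l, z)) {z. (l, z) \<in> W}"
  unfolding mat_holo_on_def mat_holo2_on_def using holomorphic_on_slice by blast

lemma mat_holo_on_subset: "mat_holo_on f W \<Longrightarrow> W' \<subseteq> W \<Longrightarrow> mat_holo_on f W'"
  unfolding mat_holo_on_def using holomorphic_on_subset by blast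

lemma mat_holo_on_const: "mat_holo_on (\<lambda>x. A) W"
  by (simp add: mat_holo_on_def)

lemma mat_holo_on_add: "mat_holo_on f W \<Longrightarrow> mat_holo_on g W \<Longrightarrow> mat_holo_on (\<lambda>x. f x + g x) W"
  by (simp add: mat_holo_on_def holomorphic_on_add)

lemma mat_holo_on_mult:
  assumes "mat_holo_on f W" "mat_holo_on g W"
  shows "mat_holo_on (\<lambda>x. f x ** g x) W"
  using assms unfolding mat_holo_on_def matrix_matrix_mult_def
  by (simp add: holomorphic_on_sum holomorphic_on_mult)

lemma mat_holo_on_mpeval: "mat_holo_on f W \<Longrightarrow> mat_holo_on (\<lambda>x. mpeval p (f x)) W"
  by (induction p) (auto intro: mat_holo_on_const mat_holo_on_add mat_holo_on_mult)

lemma mat_holo_on_local: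
  assumes "\<And>z. z \<in> W \<Longrightarrow> \<exists>B g. open B \<and> z \<in> B \<and> mat_holo_on g B \<and> (\<forall>w\<in>B. f w = g w)"
  shows "mat_holo_on f W"
  unfolding mat_holo_on_def
proof (intro allI holomorphic_onI)
  fix i j z assume "z \<in> W"
  then obtain B g where B: "open B" "z \<in> B" "mat_holo_on g B" "\<And>w. w \<in> B \<Longrightarrow> f w = g w"
    using assms by meson
  have "(\<lambda>w. f w $ i $ j) holomorphic_on B"
    using B(3,4) holomorphic_cong[of B B "\<lambda>w. f w $ i $ j" "\<lambda>w. g w $ i $ j"]
    by (simp add: mat_holo_on_def)
  then show "(\<lambda>w. f w $ i $ j) field_differentiable at z within W"
    using B(1,2) holomorphic_on_imp_differentiable_at field_differentiable_at_within by blast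
qed

lemma mat_holo_on_zero_extends:
  assumes "mat_holo_on f V" "open V" "a \<in> V" "\<And>z. z \<in> V \<Longrightarrow> z \<noteq> a \<Longrightarrow> f z = 0"
  shows "f a = 0"
proof -
  have "f a $ i $ j = 0" for i j
  proof -
    have "continuous_on V (\<lambda>z. f z $ i $ j)"
      using assms(1) by (simp add: mat_holo_on_def holomorphic_on_imp_continuous_on)
    then have "((\<lambda>z. f z $ i $ j) \<longlongrightarrow> f a $ i $ j) (at a)"
      using assms(2,3) by (simp add: continuous_on_eq_continuous_at isCont_def)
    moreover have "eventually (\<lambda>z. f z $ i $ j = 0) (at a)"
      using eventually_at_in_open[OF assms(2,3)] by eventually_elim (auto simp: assms(4))
    then have "((\<lambda>z. f z $ i $ j) \<longlongrightarrow> 0) (at a)"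
      by (rule tendsto_eventually)
    ultimately show ?thesis
      using tendsto_unique trivial_limit_at by blast
  qed
  then show ?thesis
    by (simp add: vec_eq_iff)
qed

section \<open>Gauge maps of a principal bundle\<close>

text \<open>A point \<open>p\<close> is a frame of its fibre, and this is the matrix of \<open>T\<close> in that frame. All constructions with gauge maps are carried out on these matrices.
  Passing to the frame \<open>p g\<close> conjugates the matrix by \<open>g\<close>, so the constructions have to be natural under
  conjugation.\<close>

definition gauge_matrix :: "'n::finite cmat set \<Rightarrow> ('p, 'n) pbundle \<Rightarrow> ('p \<Rightarrow> 'p) \<Rightarrow> 'p \<Rightarrow> 'n cmat" where
  "gauge_matrix G P T p = (THE g. g \<in> G \<and> T p = act P p g)"

locale algebraic_bundle =
  fixes G :: "'n::finite cmat set" and P :: "('p, 'n) pbundle"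
  assumes algebraic: "linear_algebraic_group G" and principal: "principal_bundle G P"
begin

lemmas group = linear_algebraic_groupD[OF algebraic]

lemma bundleD:
  shows act_total: "p \<in> total P \<Longrightarrow> g \<in> G \<Longrightarrow> act P p g \<in> total P"
    and proj_act: "p \<in> total P \<Longrightarrow> g \<in> G \<Longrightarrow> proj P (act P p g) = proj P p"
    and act_one: "p \<in> total P \<Longrightarrow> act P p (mat 1) = p"
    and act_act: "p \<in> total P \<Longrightarrow> g \<in> G \<Longrightarrow> h \<in> G \<Longrightarrow> act P (act P p g) h = act P p (g ** h)"
  using principal unfolding principal_bundle_def by blast+

lemma trivs_local_triv: "(V, \<phi>) \<in> trivs P \<Longrightarrow> local_triv G P V \<phi>"
  using principal unfolding principal_bundle_def by blast

lemma trivs_cover: obtains V \<phi> where "(V, \<phi>) \<in> trivs P" "z \<in> V"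
proof -
  have "\<forall>z. \<exists>(V, \<phi>)\<in>trivs P. z \<in> V"
    using principal unfolding principal_bundle_def by blast
  then show thesis
    using that by blast
qed

lemma trivs_compatible:
  assumes "(V, \<phi>) \<in> trivs P" "(W, \<psi>) \<in> trivs P"
  obtains h where "mat_holo_on h (V \<inter> W)"
    "\<And>p. p \<in> over P (V \<inter> W) \<Longrightarrow> \<psi> p = h (proj P p) ** \<phi> p"
proof -
  have "compatible_trivs P (V, \<phi>) (W, \<psi>)"
    using principal assms unfolding principal_bundle_def by blast
  then obtain h where "mat_holo_on h (V \<inter> W)" "\<forall>p\<in>over P (V \<inter> W). \<psi> p = h (proj P p) ** \<phi> p"
    unfolding compatible_trivs_def by auto
  then show thesis
    by (intro that[of h]) simp_all
qed

lemma fibreD: "p \<in> fibre P z \<Longrightarrow> p \<in> total P" "p \<in> fibre P z \<Longrightarrow> proj P p = z"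
  by (auto simp: fibre_def)

lemma fibre_proj: "p \<in> total P \<Longrightarrow> p \<in> fibre P (proj P p)"
  by (simp add: fibre_def)

lemma act_fibre: "p \<in> fibre P z \<Longrightarrow> g \<in> G \<Longrightarrow> act P p g \<in> fibre P z"
  by (auto simp: fibre_def act_total proj_act)

lemma trivsD:
  assumes "(V, \<phi>) \<in> trivs P"
  shows "open V"
    and triv_in_group: "p \<in> fibre P z \<Longrightarrow> z \<in> V \<Longrightarrow> \<phi> p \<in> G"
    and triv_act: "p \<in> fibre P z \<Longrightarrow> z \<in> V \<Longrightarrow> g \<in> G \<Longrightarrow> \<phi> (act P p g) = \<phi> p ** g"
    and triv_inj: "p \<in> fibre P z \<Longrightarrow> q \<in> fibre P z \<Longrightarrow> z \<in> V \<Longrightarrow> \<phi> p = \<phi> q \<Longrightarrow> p = q"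
    and triv_surj: "z \<in> V \<Longrightarrow> g \<in> G \<Longrightarrow> \<exists>p\<in>fibre P z. \<phi> p = g"
proof -
  have lt: "local_triv G P V \<phi>"
    using assms by (rule trivs_local_triv)
  then show "open V"
    by (simp add: local_triv_def)
  have bij: "bij_betw (\<lambda>p. (proj P p, \<phi> p)) (over P V) (V \<times> G)"
    using lt by (simp add: local_triv_def)
  show "p \<in> fibre P z \<Longrightarrow> z \<in> V \<Longrightarrow> \<phi> p \<in> G"
    using bij_betwE[OF bij] by (auto simp: over_def fibre_def)
  show "p \<in> fibre P z \<Longrightarrow> z \<in> V \<Longrightarrow> g \<in> G \<Longrightarrow> \<phi> (act P p g) = \<phi> p ** g"
    using lt by (auto simp: local_triv_def over_def fibre_def)
  show "p \<in> fibre P z \<Longrightarrow> q \<in> fibre P z \<Longrightarrow> z \<in> V \<Longrightarrow> \<phi> p = \<phi> q \<Longrightarrow> p = q"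
    using bij_betw_imp_inj_on[OF bij] by (auto simp: inj_on_def over_def fibre_def)
  show "z \<in> V \<Longrightarrow> g \<in> G \<Longrightarrow> \<exists>p\<in>fibre P z. \<phi> p = g"
  proof -
    assume "z \<in> V" "g \<in> G"
    then have "(z, g) \<in> (\<lambda>p. (proj P p, \<phi> p)) ` over P V"
      using bij_betw_imp_surj_on[OF bij] by simp
    then show ?thesis
      by (auto simp: over_def fibre_def)
  qed
qed

lemma fibre_nonempty: obtains p where "p \<in> fibre P z"
proof -
  obtain V \<phi> where "(V, \<phi>) \<in> trivs P" "z \<in> V"
    by (rule trivs_cover)
  then show thesis
    using triv_surj[OF _ _ group(1)] that by blast
qed

lemma act_free:
  assumes "p \<in> total P" "g \<in> G" "h \<in> G" "act P p g = act P p h"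
  shows "g = h"
proof -
  obtain V \<phi> where V: "(V, \<phi>) \<in> trivs P" "proj P p \<in> V"
    by (rule trivs_cover)
  note p = fibre_proj[OF assms(1)]
  have "\<phi> (act P p g) = \<phi> (act P p h)"
    by (simp only: assms(4))
  then have "\<phi> p ** g = \<phi> p ** h"
    by (simp only: triv_act[OF V(1) p V(2)] assms(2,3))
  then have "matrix_inv (\<phi> p) ** \<phi> p ** g = matrix_inv (\<phi> p) ** \<phi> p ** h"
    by (simp flip: matrix_mul_assoc)
  then show ?thesis
    by (simp add: matrix_inv_cancel group(4)[OF triv_in_group[OF V(1) p V(2)]])
qed

lemma act_transitive:
  assumes "p \<in> fibre P z" "q \<in> fibre P z"
  obtains g where "g \<in> G" "q = act P p g"
proof -
  obtain V \<phi> where V: "(V, \<phi>) \<in> trivs P" "z \<in> V"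
    by (rule trivs_cover)
  define g where "g = matrix_inv (\<phi> p) ** \<phi> q"
  note G = triv_in_group[OF V(1) assms(1) V(2)] triv_in_group[OF V(1) assms(2) V(2)]
  have g: "g \<in> G"
    using G by (simp add: g_def group)
  have "\<phi> (act P p g) = \<phi> p ** matrix_inv (\<phi> p) ** \<phi> q"
    by (simp only: triv_act[OF V(1) assms(1) V(2) g]) (simp only: g_def matrix_mul_assoc)
  then have "q = act P p g"
    using G by (intro triv_inj[OF V(1) assms(2) act_fibre[OF assms(1) g] V(2)])
      (simp add: matrix_inv_cancel group(4))
  then show thesis
    using g that by blast
qed

lemma gauge_matrix_eq:
  assumes "p \<in> total P" "g \<in> G" "T p = act P p g"
  shows "gauge_matrix G P T p = g"
  unfolding gauge_matrix_def
proof (rule the_equality)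
  show "g \<in> G \<and> T p = act P p g"
    using assms(2,3) by blast
  show "h = g" if "h \<in> G \<and> T p = act P p h" for h
    using act_free[OF assms(1), of h g] that assms(2,3) by simp
qed

lemma
  assumes "p \<in> fibre P z" "T p \<in> fibre P z"
  shows gauge_matrix_in_group: "gauge_matrix G P T p \<in> G"
    and act_gauge_matrix: "act P p (gauge_matrix G P T p) = T p"
proof -
  obtain g where g: "g \<in> G" "T p = act P p g"
    using assms by (rule act_transitive)
  moreover have "gauge_matrix G P T p = g"
    using fibreD(1)[OF assms(1)] g by (rule gauge_matrix_eq)
  ultimately show "gauge_matrix G P T p \<in> G" "act P p (gauge_matrix G P T p) = T p"
    by simp_all
qed

lemma gauge_matrix_act:
  assumes "p \<in> fibre P z" "g \<in> G" "T p \<in> fibre P z" "T (act P p g) = act P (T p) g"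
  shows "gauge_matrix G P T (act P p g) = matrix_inv g ** gauge_matrix G P T p ** g"
proof (rule gauge_matrix_eq)
  let ?a = "gauge_matrix G P T p"
  note a = gauge_matrix_in_group[where T = T, OF assms(1,3)] act_gauge_matrix[where T = T, OF assms(1,3)]
  note p = fibreD(1)[OF assms(1)]
  show "act P p g \<in> total P" "matrix_inv g ** ?a ** g \<in> G"
    using assms(2) a p by (simp_all add: act_total group)
  have "act P (act P p g) (matrix_inv g ** ?a ** g) = act P p (g ** matrix_inv g ** ?a ** g)"
    using assms(2) a p by (simp add: act_act group matrix_mul_assoc)
  also have "\<dots> = act P (act P p ?a) g"
    using assms(2) a(1) p by (simp add: act_act matrix_inv_cancel group(4))
  finally show "T (act P p g) = act P (act P p g) (matrix_inv g ** ?a ** g)"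
    by (simp add: assms(4) a)
qed

lemma gauge_autD:
  assumes "A \<in> gauge_aut G P z"
  shows "p \<in> fibre P z \<Longrightarrow> A p \<in> fibre P z"
    and "p \<in> fibre P z \<Longrightarrow> g \<in> G \<Longrightarrow> A (act P p g) = act P (A p) g"
    and "A \<in> extensional (fibre P z)"
  using assms unfolding gauge_arrows_def PiE_def by blast+

lemma gauge_aut_matrix:
  assumes "A \<in> gauge_aut G P z" "p \<in> fibre P z"
  shows "gauge_matrix G P A p \<in> G" "act P p (gauge_matrix G P A p) = A p"
    "g \<in> G \<Longrightarrow> gauge_matrix G P A (act P p g) = matrix_inv g ** gauge_matrix G P A p ** g"
proof -
  note A = gauge_autD(1)[OF assms]
  show "gauge_matrix G P A p \<in> G" "act P p (gauge_matrix G P A p) = A p"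
    using gauge_matrix_in_group[where T = A, OF assms(2) A] act_gauge_matrix[where T = A, OF assms(2) A] .
  show "gauge_matrix G P A (act P p g) = matrix_inv g ** gauge_matrix G P A p ** g" if "g \<in> G"
    by (rule gauge_matrix_act[where T = A, OF assms(2) that A gauge_autD(2)[OF assms that]])
qed

lemma conj_in_gauge_aut:
  assumes "\<And>p. p \<in> fibre P z \<Longrightarrow> f p \<in> G"
    and "\<And>p g. p \<in> fibre P z \<Longrightarrow> g \<in> G \<Longrightarrow> f (act P p g) = matrix_inv g ** f p ** g"
  shows "(\<lambda>p\<in>fibre P z. act P p (f p)) \<in> gauge_aut G P z"
proof -
  have "act P (act P p g) (matrix_inv g ** f p ** g) = act P (act P p (f p)) g"
    if "p \<in> fibre P z" "g \<in> G" for p g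
  proof -
    have "g ** (matrix_inv g ** f p ** g) = f p ** g"
      using that by (simp add: matrix_mul_assoc matrix_inv_cancel group(4))
    then show ?thesis
      using that assms(1) fibreD(1) by (simp add: act_act group)
  qed
  then show ?thesis
    by (auto simp: gauge_arrows_def assms act_fibre)
qed

lemma gauge_aut_act:
  assumes "A \<in> gauge_aut G P z" "p \<in> fibre P z" "g \<in> G"
  shows "A (act P p g) = act P p (gauge_matrix G P A p ** g)"
proof -
  have "A (act P p g) = act P (act P p (gauge_matrix G P A p)) g"
    by (simp only: gauge_autD(2)[OF assms] gauge_aut_matrix(2)[OF assms(1,2)])
  then show ?thesis
    by (simp only: act_act[OF fibreD(1)[OF assms(2)] gauge_aut_matrix(1)[OF assms(1,2)] assms(3)])
qed

lemma gauge_aut_matrix_iff: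
  assumes "A \<in> gauge_aut G P z"
  shows "(\<forall>p\<in>fibre P z. \<forall>g\<in>G. A p = act P p g \<longrightarrow> R g) \<longleftrightarrow> (\<forall>p\<in>fibre P z. R (gauge_matrix G P A p))"
proof (intro iffI ballI impI)
  fix p assume p: "p \<in> fibre P z"
  show "R (gauge_matrix G P A p)" if "\<forall>p\<in>fibre P z. \<forall>g\<in>G. A p = act P p g \<longrightarrow> R g"
    using that p gauge_aut_matrix(1,2)[OF assms p] by simp
  show "R g" if "\<forall>p\<in>fibre P z. R (gauge_matrix G P A p)" "g \<in> G" "A p = act P p g" for g
    using that(1) p gauge_matrix_eq[where T = A, OF fibreD(1)[OF p] that(2,3)] by auto
qed

lemma gauge_unipotent_iff:
  "gauge_unipotent G P z A \<longleftrightarrow>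
     A \<in> gauge_aut G P z \<and> (\<forall>p\<in>fibre P z. mat_unipotent (gauge_matrix G P A p))"
  unfolding gauge_unipotent_def using gauge_aut_matrix_iff[of A z mat_unipotent] by blast

lemma gauge_semisimple_iff:
  "gauge_semisimple G P z A \<longleftrightarrow>
     A \<in> gauge_aut G P z \<and> (\<forall>p\<in>fibre P z. mat_semisimple (gauge_matrix G P A p))"
  unfolding gauge_semisimple_def using gauge_aut_matrix_iff[of A z mat_semisimple] by blast

text \<open>In each frame \<open>p\<close> a decomposition of \<open>A\<close> into gauge maps is a Jordan-Chevalley decomposition of its
  matrix. That one is unique, is natural under conjugation and stays in \<open>G\<close>.\<close>

lemma unipotent_part_eq:
  assumes A: "A \<in> gauge_aut G P z"
  shows "unipotent_part G P z A = (\<lambda>p\<in>fibre P z. act P p (munip (gauge_matrix G P A p)))"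
    (is "_ = ?u")
  unfolding unipotent_part_def
proof (rule the_equality)
  let ?a = "gauge_matrix G P A"
  let ?s = "\<lambda>p\<in>fibre P z. act P p (msemi (?a p))"
  have a: "?a p \<in> G" "invertible (?a p)" if "p \<in> fibre P z" for p
    using gauge_aut_matrix(1)[OF A that] group(4) by auto
  note jc = jordan_chevalley_msemi_munip[OF a(2)]
  have conj: "g ** matrix_inv g = mat 1" if "g \<in> G" for g
    using that by (simp add: matrix_inv_cancel group(4))
  have u: "?u \<in> gauge_aut G P z"
    by (rule conj_in_gauge_aut)
      (simp_all add: munip_in_group[OF algebraic] a gauge_aut_matrix(3)[OF A] munip_conj conj)
  have s: "?s \<in> gauge_aut G P z"
    by (rule conj_in_gauge_aut)
      (simp_all add: msemi_in_group[OF algebraic] a gauge_aut_matrix(3)[OF A] msemi_conj conj)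
  have um: "gauge_matrix G P ?u p = munip (?a p)" and sm: "gauge_matrix G P ?s p = msemi (?a p)"
    if "p \<in> fibre P z" for p
    using that by (auto intro!: gauge_matrix_eq
        simp: fibreD(1) a munip_in_group[OF algebraic] msemi_in_group[OF algebraic])
  have "compose (fibre P z) ?s ?u p = A p" "compose (fibre P z) ?u ?s p = A p"
    if "p \<in> fibre P z" for p
    using that jc[OF that] gauge_aut_act[OF s that] gauge_aut_act[OF u that]
    by (simp_all add: compose_eq um sm munip_in_group[OF algebraic] msemi_in_group[OF algebraic] a
        jordan_chevalley_def gauge_aut_matrix(2)[OF A])
  then have "compose (fibre P z) ?s ?u = A" "compose (fibre P z) ?u ?s = A"
    using gauge_autD(3)[OF A] by (auto intro!: extensionalityI[of _ "fibre P z"])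
  moreover have "gauge_unipotent G P z ?u" "gauge_semisimple G P z ?s"
    using u s jc by (auto simp: gauge_unipotent_iff gauge_semisimple_iff um sm jordan_chevalley_def
        simp del: restrict_apply)
  ultimately show "gauge_unipotent G P z ?u \<and> (\<exists>s. gauge_semisimple G P z s \<and>
      compose (fibre P z) s ?u = A \<and> compose (fibre P z) ?u s = A)"
    by blast
next
  fix v
  assume v: "gauge_unipotent G P z v \<and> (\<exists>s. gauge_semisimple G P z s \<and>
      compose (fibre P z) s v = A \<and> compose (fibre P z) v s = A)"
  then obtain s where s: "gauge_semisimple G P z s"
      "compose (fibre P z) s v = A" "compose (fibre P z) v s = A"
    by blast
  have va: "v \<in> gauge_aut G P z" and sa: "s \<in> gauge_aut G P z"
    using v s by (auto simp: gauge_unipotent_iff gauge_semisimple_iff)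
  show "v = ?u"
  proof (rule extensionalityI[of _ "fibre P z"])
    fix p assume p: "p \<in> fibre P z"
    note vm = gauge_aut_matrix[OF va p] and sm = gauge_aut_matrix[OF sa p]
    let ?x = "gauge_matrix G P s p" and ?y = "gauge_matrix G P v p"
    have "A p = s (v p)" "A p = v (s p)"
      using fun_cong[OF s(2), of p] fun_cong[OF s(3), of p] p by (simp_all add: compose_eq)
    then have "A p = act P p (?x ** ?y)" "A p = act P p (?y ** ?x)"
      using gauge_aut_act[OF sa p vm(1)] gauge_aut_act[OF va p sm(1)] by (simp_all add: vm(2) sm(2))
    then have "gauge_matrix G P A p = ?x ** ?y" "gauge_matrix G P A p = ?y ** ?x"
      using fibreD(1)[OF p] group(2)[OF sm(1) vm(1)] group(2)[OF vm(1) sm(1)]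
      by (auto intro: gauge_matrix_eq)
    moreover have "mat_semisimple ?x" "mat_unipotent ?y"
      using v s(1) p by (auto simp: gauge_unipotent_iff gauge_semisimple_iff)
    ultimately have "jordan_chevalley (gauge_matrix G P A p) ?x ?y"
      by (simp add: jordan_chevalley_def)
    then have "munip (gauge_matrix G P A p) = gauge_matrix G P v p"
      by (rule munip_eq[OF group(4)[OF gauge_aut_matrix(1)[OF A p]]])
    then show "v p = ?u p"
      using p vm(2) by simp
  qed (use gauge_autD(3)[OF va] in auto)
qed

text \<open>Uniqueness needs \<open>exp (\<xi> p) \<in> G\<close>, since only elements of \<open>G\<close> are determined by their action on \<open>p\<close>. It holds
  because \<open>\<xi> p\<close> is in the Lie algebra.\<close>

lemma gauge_log_eq:
  assumes U: "gauge_unipotent G P z U"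
  shows "gauge_log G P z U = (\<lambda>p\<in>fibre P z. mlog (gauge_matrix G P U p))"
  unfolding gauge_log_def
proof (rule the_equality)
  let ?L = "\<lambda>p\<in>fibre P z. mlog (gauge_matrix G P U p)"
  have Ua: "U \<in> gauge_aut G P z" and unip: "\<And>p. p \<in> fibre P z \<Longrightarrow> mat_unipotent (gauge_matrix G P U p)"
    using U by (auto simp: gauge_unipotent_iff)
  note Um = gauge_aut_matrix[OF Ua]
  have "?L \<in> gauge_lie G P z"
    using mlog_in_lie_algebra[OF algebraic] Um unip
    by (auto simp: gauge_lie_def act_fibre matrix_inv_cancel group(4) unipotent_conj(2))
  moreover have "gauge_exp P z ?L = U"
    using gauge_autD(3)[OF Ua] Um(2) unip
    by (intro extensionalityI[of _ "fibre P z"]) (auto simp: gauge_exp_def mexp_mlog)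
  ultimately show "?L \<in> gauge_lie G P z \<and> (\<forall>p\<in>fibre P z. mat_nilpotent (?L p)) \<and> gauge_exp P z ?L = U"
    using unip by (auto simp: mat_nilpotent_mlog)
  fix \<xi>
  assume \<xi>: "\<xi> \<in> gauge_lie G P z \<and> (\<forall>p\<in>fibre P z. mat_nilpotent (\<xi> p)) \<and> gauge_exp P z \<xi> = U"
  show "\<xi> = ?L"
  proof (rule extensionalityI[of _ "fibre P z"])
    fix p assume p: "p \<in> fibre P z"
    have "\<xi> p \<in> lie_algebra G"
      using \<xi> p by (auto simp: gauge_lie_def)
    then have "mexp (1 *\<^sub>R \<xi> p) \<in> G"
      unfolding lie_algebra_def by blast
    moreover have "U p = act P p (mexp (\<xi> p))"
      using \<xi> p by (auto simp: gauge_exp_def)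
    ultimately have "mexp (\<xi> p) = gauge_matrix G P U p"
      using gauge_matrix_eq[where T = U, OF fibreD(1)[OF p]] by simp
    then show "\<xi> p = ?L p"
      using \<xi> p mlog_unique[OF unip[OF p]] by simp
  qed (use \<xi> in \<open>auto simp: gauge_lie_def PiE_def\<close>)
qed

lemma gauge_exp_scale_log:
  assumes "gauge_unipotent G P z U"
  shows "gauge_exp P z (gauge_scale P z c (gauge_log G P z U)) =
    (\<lambda>p\<in>fibre P z. act P p (upow (gauge_matrix G P U p) c))"
  unfolding gauge_exp_def gauge_scale_def gauge_log_eq[OF assms]
  by (rule restrict_ext) (simp add: upow_def)

end

section \<open>Endomorphisms of a representation\<close>

lemma rep_morphismD:
  assumes "rep_morphism G (P, \<Phi>) (P', \<Phi>') T"
  shows "p \<in> fibre P z \<Longrightarrow> T p \<in> fibre P' z"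
    and "p \<in> fibre P z \<Longrightarrow> g \<in> G \<Longrightarrow> T (act P p g) = act P' (T p) g"
    and "p \<in> fibre P z \<Longrightarrow> T (\<Phi> l z p) = \<Phi>' l z (T p)"
    and "T \<in> total P \<rightarrow>\<^sub>E total P'"
    and "bundle_morphism G P P' T"
proof -
  show T: "bundle_morphism G P P' T"
    using assms by (simp add: rep_morphism_def)
  show "p \<in> fibre P z \<Longrightarrow> T (\<Phi> l z p) = \<Phi>' l z (T p)"
    using assms by (simp add: rep_morphism_def)
  show "p \<in> fibre P z \<Longrightarrow> T p \<in> fibre P' z" "p \<in> fibre P z \<Longrightarrow> g \<in> G \<Longrightarrow> T (act P p g) = act P' (T p) g"
    "T \<in> total P \<rightarrow>\<^sub>E total P'"
    using T by (auto simp: bundle_morphism_def fibre_def)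
qed

lemma bundle_morphism_local:
  assumes "bundle_morphism G P P' T" "(V, \<phi>) \<in> trivs P" "(W, \<psi>) \<in> trivs P'"
  obtains h where "mat_holo_on h (V \<inter> W)"
    "\<And>p z. p \<in> fibre P z \<Longrightarrow> z \<in> V \<Longrightarrow> z \<in> W \<Longrightarrow> \<psi> (T p) = h z ** \<phi> p"
proof -
  have "\<forall>(V, \<phi>)\<in>trivs P. \<forall>(W, \<psi>)\<in>trivs P'.
      \<exists>h. mat_holo_on h (V \<inter> W) \<and> (\<forall>p\<in>over P (V \<inter> W). \<psi> (T p) = h (proj P p) ** \<phi> p)"
    using assms(1) by (simp add: bundle_morphism_def)
  from bspec[OF bspec[OF this assms(2), unfolded prod.case] assms(3), unfolded prod.case]
  obtain h where h: "mat_holo_on h (V \<inter> W)" "\<forall>p\<in>over P (V \<inter> W). \<psi> (T p) = h (proj P p) ** \<phi> p"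
    by blast
  have "\<psi> (T p) = h z ** \<phi> p" if "p \<in> fibre P z" "z \<in> V" "z \<in> W" for p z
    using h(2) that by (auto simp: over_def fibre_def)
  then show thesis
    using that h(1) by blast
qed

locale representation = algebraic_bundle G P
  for G :: "'n::finite cmat set" and P :: "('p, 'n) pbundle" +
  fixes \<Phi> :: "'p arrows_family"
  assumes representation: "groupoid_rep G P \<Phi>"
begin

lemma arrow_gauge: "\<Phi> l z \<in> gauge_arrows G P z (exp l * z)"
  using representation unfolding groupoid_rep_def by blast

lemma arrow_fibre: "p \<in> fibre P z \<Longrightarrow> \<Phi> l z p \<in> fibre P (exp l * z)"
  and arrow_act: "p \<in> fibre P z \<Longrightarrow> g \<in> G \<Longrightarrow> \<Phi> l z (act P p g) = act P (\<Phi> l z p) g"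
  and arrow_extensional: "\<Phi> l z \<in> extensional (fibre P z)"
  using arrow_gauge[of l z] unfolding gauge_arrows_def PiE_def by blast+

lemma arrow_compose:
  assumes "p \<in> fibre P z"
  shows "\<Phi> m (exp l * z) (\<Phi> l z p) = \<Phi> (m + l) z p"
proof -
  have "compose (fibre P z) (\<Phi> m (exp l * z)) (\<Phi> l z) = \<Phi> (m + l) z"
    using representation unfolding groupoid_rep_def by blast
  from fun_cong[OF this, of p] show ?thesis
    using assms by (simp add: compose_eq)
qed

lemma arrow_holomorphic:
  assumes "(V, \<phi>) \<in> trivs P" "(W, \<psi>) \<in> trivs P"
  obtains h where "mat_holo2_on h {(l, z). z \<in> V \<and> exp l * z \<in> W}"
    "\<And>l z p. z \<in> V \<Longrightarrow> exp l * z \<in> W \<Longrightarrow> p \<in> fibre P z \<Longrightarrow> \<psi> (\<Phi> l z p) = h (l, z) ** \<phi> p"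
proof -
  have "\<forall>(V, \<phi>)\<in>trivs P. \<forall>(W, \<psi>)\<in>trivs P.
      \<exists>h. mat_holo2_on h {(l, z). z \<in> V \<and> exp l * z \<in> W} \<and>
        (\<forall>l. \<forall>z\<in>V. exp l * z \<in> W \<longrightarrow> (\<forall>p\<in>fibre P z. \<psi> (\<Phi> l z p) = h (l, z) ** \<phi> p))"
    using representation unfolding groupoid_rep_def by blast
  from bspec[OF bspec[OF this assms(1), unfolded prod.case] assms(2), unfolded prod.case]
  obtain h where "mat_holo2_on h {(l, z). z \<in> V \<and> exp l * z \<in> W}"
    "\<forall>l. \<forall>z\<in>V. exp l * z \<in> W \<longrightarrow> (\<forall>p\<in>fibre P z. \<psi> (\<Phi> l z p) = h (l, z) ** \<phi> p)"
    by blast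
  then show thesis
    by (intro that[of h]) simp_all
qed

abbreviation endo :: "('p \<Rightarrow> 'p) \<Rightarrow> bool" where
  "endo \<equiv> rep_morphism G (P, \<Phi>) (P, \<Phi>)"

abbreviation mx :: "('p \<Rightarrow> 'p) \<Rightarrow> 'p \<Rightarrow> 'n cmat" where
  "mx \<equiv> gauge_matrix G P"

lemma endoD:
  assumes "endo T"
  shows endo_fibre: "p \<in> fibre P z \<Longrightarrow> T p \<in> fibre P z"
    and endo_act: "p \<in> fibre P z \<Longrightarrow> g \<in> G \<Longrightarrow> T (act P p g) = act P (T p) g"
    and endo_arrow: "p \<in> fibre P z \<Longrightarrow> T (\<Phi> l z p) = \<Phi> l z (T p)"
    and endo_extensional: "T \<in> extensional (total P)"
  using rep_morphismD[OF assms] by (auto simp: PiE_def)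

lemma endo_holomorphic:
  assumes "endo T" "(V, \<phi>) \<in> trivs P"
  obtains h where "mat_holo_on h V" "\<And>p z. p \<in> fibre P z \<Longrightarrow> z \<in> V \<Longrightarrow> \<phi> (T p) = h z ** \<phi> p"
  using bundle_morphism_local[OF rep_morphismD(5)[OF assms(1)] assms(2,2)] that by auto

text \<open>The last claim is the rigidity on which everything rests: in frames moved along by the arrows the
  matrix of an endomorphism does not change.\<close>

lemma endo_mx:
  assumes "endo T" "p \<in> fibre P z"
  shows mx_in_group: "mx T p \<in> G"
    and act_mx: "act P p (mx T p) = T p"
    and mx_act: "g \<in> G \<Longrightarrow> mx T (act P p g) = matrix_inv g ** mx T p ** g"
    and mx_arrow: "mx T (\<Phi> l z p) = mx T p"
proof -
  note T = endo_fibre[OF assms]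
  show mx: "mx T p \<in> G" "act P p (mx T p) = T p"
    using gauge_matrix_in_group[where T = T, OF assms(2) T] act_gauge_matrix[where T = T, OF assms(2) T] .
  show "mx T (act P p g) = matrix_inv g ** mx T p ** g" if "g \<in> G"
    by (rule gauge_matrix_act[where T = T, OF assms(2) that T endo_act[OF assms that]])
  show "mx T (\<Phi> l z p) = mx T p"
  proof (rule gauge_matrix_eq)
    show "\<Phi> l z p \<in> total P"
      by (rule fibreD(1)[OF arrow_fibre[OF assms(2)]])
    show "T (\<Phi> l z p) = act P (\<Phi> l z p) (mx T p)"
      by (simp only: endo_arrow[OF assms] arrow_act[OF assms(2) mx(1), symmetric] mx(2))
  qed (rule mx(1))
qed

text \<open>A trivialization \<open>\<phi>\<close> turns \<open>T\<close> into left multiplication by a matrix \<open>h\<close>, which depends on the base point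
  only, whereas the matrix in the frame \<open>p\<close> is the conjugate of \<open>h\<close> by \<open>\<phi> p\<close>.\<close>

lemma triv_mx:
  assumes T: "endo T" and V: "(V, \<phi>) \<in> trivs P" "z \<in> V" and p: "p \<in> fibre P z"
    and h: "\<phi> (T p) = h ** \<phi> p"
  shows "mx T p = matrix_inv (\<phi> p) ** h ** \<phi> p" "h = \<phi> p ** mx T p ** matrix_inv (\<phi> p)"
proof -
  have inv: "invertible (\<phi> p)"
    by (rule group(4)[OF triv_in_group[OF V(1) p V(2)]])
  have "\<phi> p ** mx T p = h ** \<phi> p"
    using triv_act[OF V(1) p V(2) mx_in_group[OF T p]] by (simp only: act_mx[OF T p] h)
  then have *: "h ** \<phi> p = \<phi> p ** mx T p"
    by (rule sym)
  show "mx T p = matrix_inv (\<phi> p) ** h ** \<phi> p"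
    by (simp add: * matrix_inv_cancel[OF inv] flip: matrix_mul_assoc)
       (simp add: matrix_mul_assoc matrix_inv_cancel[OF inv])
  show "h = \<phi> p ** mx T p ** matrix_inv (\<phi> p)"
    by (simp only: *[symmetric] matrix_inv_cancel'[OF inv])
qed

text \<open>The nonzero complex numbers form a single orbit, so over \<open>z \<noteq> 0\<close> the matrices of \<open>T\<close> are conjugate to
  those over \<open>1\<close>. No arrow links \<open>0\<close> to this orbit, but \<open>\<pi>(h(z))\<close> is continuous in a trivialization around \<open>0\<close>.\<close>

lemma annihilator_propagates:
  assumes T: "endo T" and p1: "p1 \<in> fibre P 1" "mpeval \<pi> (mx T p1) = 0"
    and p: "p \<in> fibre P z"
  shows "mpeval \<pi> (mx T p) = 0"
proof -
  have nonzero: "mpeval \<pi> (mx T q) = 0" if q: "q \<in> fibre P w" and "w \<noteq> 0" for q w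
  proof -
    have q': "\<Phi> (Ln w) 1 p1 \<in> fibre P w"
      using arrow_fibre[OF p1(1), of "Ln w"] \<open>w \<noteq> 0\<close> by simp
    obtain g where g: "g \<in> G" "q = act P (\<Phi> (Ln w) 1 p1) g"
      using q' q by (rule act_transitive)
    have "mx T q = matrix_inv g ** mx T p1 ** g"
      using mx_act[OF T q' g(1)] by (simp only: g(2) mx_arrow[OF T p1(1)])
    then show ?thesis
      using mpeval_conj[OF matrix_inv_cancel(1)[OF group(4)[OF g(1)]]] p1(2) by simp
  qed
  obtain V \<phi> where V: "(V, \<phi>) \<in> trivs P" "z \<in> V"
    by (rule trivs_cover)
  obtain h where h: "mat_holo_on h V" "\<And>p z. p \<in> fibre P z \<Longrightarrow> z \<in> V \<Longrightarrow> \<phi> (T p) = h z ** \<phi> p"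
    by (rule endo_holomorphic[OF T V(1)]) (rule that)
  have "mpeval \<pi> (h z) = 0"
  proof (cases "z = 0")
    case True
    have "mpeval \<pi> (h w) = 0" if "w \<in> V" "w \<noteq> 0" for w
    proof -
      obtain q where q: "q \<in> fibre P w"
        by (rule fibre_nonempty)
      note \<phi>q = group(4)[OF triv_in_group[OF V(1) q \<open>w \<in> V\<close>]]
      show ?thesis
        unfolding triv_mx(2)[OF T V(1) \<open>w \<in> V\<close> q h(2)[OF q \<open>w \<in> V\<close>]]
        using mpeval_conj[OF matrix_inv_cancel(2)[OF \<phi>q]] nonzero[OF q \<open>w \<noteq> 0\<close>] by simp
    qed
    then show ?thesis
      using mat_holo_on_zero_extends[OF mat_holo_on_mpeval[OF h(1)] trivsD(1)[OF V(1)], of z \<pi>] V(2) True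
      by blast
  next
    case False
    note \<phi>p = group(4)[OF triv_in_group[OF V(1) p V(2)]]
    show ?thesis
      unfolding triv_mx(2)[OF T V p h(2)[OF p V(2)]]
      using mpeval_conj[OF matrix_inv_cancel(2)[OF \<phi>p]] nonzero[OF p False] by simp
  qed
  then show ?thesis
    unfolding triv_mx(1)[OF T V p h(2)[OF p V(2)]]
    using mpeval_conj[OF matrix_inv_cancel(1)[OF group(4)[OF triv_in_group[OF V(1) p V(2)]]]] by simp
qed

text \<open>Polynomials in the matrix are natural under conjugation, constant along arrows and holomorphic in
  trivializations, because the matrix itself is.\<close>

lemma endo_mpeval:
  assumes T: "endo T" and G: "\<And>p. p \<in> total P \<Longrightarrow> mpeval \<pi> (mx T p) \<in> G"
  shows "endo (\<lambda>p\<in>total P. act P p (mpeval \<pi> (mx T p)))" (is "endo ?E")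
proof -
  have E: "?E p = act P p (mpeval \<pi> (mx T p))" if "p \<in> fibre P z" for p z
    using fibreD(1)[OF that] by simp
  have Efib: "?E p \<in> fibre P z" if "p \<in> fibre P z" for p z
    unfolding E[OF that] using that G[OF fibreD(1)[OF that]] by (rule act_fibre)
  have equiv: "?E (act P p g) = act P (?E p) g" if p: "p \<in> fibre P z" and g: "g \<in> G" for p g z
  proof -
    note inv = matrix_inv_cancel[OF group(4)[OF g]]
    have x: "mpeval \<pi> (mx T p) \<in> G"
      by (rule G[OF fibreD(1)[OF p]])
    have "?E (act P p g) = act P (act P p g) (matrix_inv g ** mpeval \<pi> (mx T p) ** g)"
      by (simp only: E[OF act_fibre[OF p g]] mx_act[OF T p g] mpeval_conj[OF inv(1)])
    also have "\<dots> = act P p (g ** (matrix_inv g ** mpeval \<pi> (mx T p) ** g))"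
      using fibreD(1)[OF p] g x by (simp add: act_act group)
    also have "g ** (matrix_inv g ** mpeval \<pi> (mx T p) ** g) = mpeval \<pi> (mx T p) ** g"
      by (simp add: matrix_mul_assoc inv)
    also have "act P p (mpeval \<pi> (mx T p) ** g) = act P (?E p) g"
      using fibreD(1)[OF p] g x by (simp add: E[OF p] act_act)
    finally show ?thesis .
  qed
  have arrow: "?E (\<Phi> l z p) = \<Phi> l z (?E p)" if p: "p \<in> fibre P z" for l z p
    by (simp only: E[OF arrow_fibre[OF p]] mx_arrow[OF T p] E[OF p]
        arrow_act[OF p G[OF fibreD(1)[OF p]]])
  have holo: "\<exists>h. mat_holo_on h (V \<inter> W) \<and> (\<forall>p\<in>over P (V \<inter> W). \<psi> (?E p) = h (proj P p) ** \<phi> p)"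
    if V: "(V, \<phi>) \<in> trivs P" and W: "(W, \<psi>) \<in> trivs P" for V \<phi> W \<psi>
  proof -
    obtain h where h: "mat_holo_on h V" "\<And>p z. p \<in> fibre P z \<Longrightarrow> z \<in> V \<Longrightarrow> \<phi> (T p) = h z ** \<phi> p"
      by (rule endo_holomorphic[OF T V]) (rule that)
    obtain k where k: "mat_holo_on k (V \<inter> W)" "\<And>p. p \<in> over P (V \<inter> W) \<Longrightarrow> \<psi> p = k (proj P p) ** \<phi> p"
      by (rule trivs_compatible[OF V W]) (rule that)
    have "mat_holo_on h (V \<inter> W)"
      using h(1) Int_lower1 by (rule mat_holo_on_subset)
    then have "mat_holo_on (\<lambda>z. k z ** mpeval \<pi> (h z)) (V \<inter> W)"
      by (rule mat_holo_on_mult[OF k(1) mat_holo_on_mpeval])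
    moreover have "\<psi> (?E p) = k (proj P p) ** mpeval \<pi> (h (proj P p)) ** \<phi> p"
      if "p \<in> over P (V \<inter> W)" for p
    proof -
      define z where "z = proj P p"
      have p: "p \<in> fibre P z" "z \<in> V" "z \<in> W"
        using that by (auto simp: over_def fibre_def z_def)
      note inv = matrix_inv_cancel[OF group(4)[OF triv_in_group[OF V p(1,2)]]]
      have "mpeval \<pi> (mx T p) = matrix_inv (\<phi> p) ** mpeval \<pi> (h z) ** \<phi> p"
        unfolding triv_mx(1)[OF T V p(2,1) h(2)[OF p(1,2)]] by (rule mpeval_conj[OF inv(1)])
      then have "\<phi> p ** mpeval \<pi> (mx T p) = mpeval \<pi> (h z) ** \<phi> p"
        by (simp add: matrix_mul_assoc inv)
      moreover have "\<psi> (?E p) = \<psi> p ** mpeval \<pi> (mx T p)"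
        unfolding E[OF p(1)] by (rule triv_act[OF W p(1,3) G[OF fibreD(1)[OF p(1)]]])
      ultimately show ?thesis
        unfolding z_def[symmetric] using k(2)[OF that]
        by (simp only: z_def[symmetric] matrix_mul_assoc[symmetric])
    qed
    ultimately show ?thesis
      by blast
  qed
  have "bundle_morphism G P P ?E"
    unfolding bundle_morphism_def
  proof (intro conjI)
    show "?E \<in> total P \<rightarrow>\<^sub>E total P"
      using fibreD(1)[OF Efib[OF fibre_proj]] by (auto simp del: restrict_apply simp: PiE_def)
    show "\<forall>p\<in>total P. proj P (?E p) = proj P p"
      using fibreD(2)[OF Efib[OF fibre_proj]] by blast
    show "\<forall>p\<in>total P. \<forall>g\<in>G. ?E (act P p g) = act P (?E p) g"
      using equiv[OF fibre_proj] by blast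
  qed (use holo in blast)
  then show ?thesis
    unfolding rep_morphism_def prod.case using arrow by blast
qed

definition monodromy_total :: "'p \<Rightarrow> 'p" where
  "monodromy_total = (\<lambda>p\<in>total P. monodromy \<Phi> (proj P p) p)"

lemma exp_period: "exp (2 * of_real pi * \<i>) * z = z"
  by simp

lemma monodromy_fibre: "p \<in> fibre P z \<Longrightarrow> monodromy \<Phi> z p \<in> fibre P z"
  using arrow_fibre[of p z "2 * of_real pi * \<i>"] by (simp only: monodromy_def exp_period)

lemma monodromy_gauge_aut: "monodromy \<Phi> z \<in> gauge_aut G P z"
  using arrow_gauge[of "2 * of_real pi * \<i>" z] by (simp only: monodromy_def exp_period)

lemma monodromy_total_eq: "p \<in> fibre P z \<Longrightarrow> monodromy_total p = monodromy \<Phi> z p"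
  by (simp add: monodromy_total_def fibre_def)

text \<open>Holomorphy is that of \<open>\<Phi>\<close> at fixed time \<open>2\<pi>i\<close>. The monodromy commutes with the arrows because times add
  up commutatively.\<close>

lemma endo_monodromy: "endo monodromy_total"
proof -
  let ?T = monodromy_total
  let ?c = "2 * of_real pi * \<i> :: complex"
  have holo: "\<exists>h. mat_holo_on h (V \<inter> W) \<and> (\<forall>p\<in>over P (V \<inter> W). \<psi> (?T p) = h (proj P p) ** \<phi> p)"
    if V: "(V, \<phi>) \<in> trivs P" and W: "(W, \<psi>) \<in> trivs P" for V \<phi> W \<psi>
  proof -
    obtain h where h: "mat_holo2_on h {(l, z). z \<in> V \<and> exp l * z \<in> W}"
      "\<And>l z p. z \<in> V \<Longrightarrow> exp l * z \<in> W \<Longrightarrow> p \<in> fibre P z \<Longrightarrow> \<psi> (\<Phi> l z p) = h (l, z) ** \<phi> p"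
      by (rule arrow_holomorphic[OF V W]) (rule that)
    have "{z. (?c, z) \<in> {(l, z). z \<in> V \<and> exp l * z \<in> W}} = V \<inter> W"
      by auto
    then have "mat_holo_on (\<lambda>z. h (?c, z)) (V \<inter> W)"
      using mat_holo_on_slice[OF h(1), of ?c] by (simp only:)
    moreover have "\<psi> (?T p) = h (?c, proj P p) ** \<phi> p" if "p \<in> over P (V \<inter> W)" for p
      using that h(2)[of "proj P p" ?c p]
      by (simp add: over_def monodromy_total_def monodromy_def fibre_def)
    ultimately show ?thesis
      by (intro exI[of _ "\<lambda>z. h (?c, z)"]) blast
  qed
  have "bundle_morphism G P P ?T"
    unfolding bundle_morphism_def
  proof (intro conjI)
    show "?T \<in> total P \<rightarrow>\<^sub>E total P"
      using fibreD(1)[OF monodromy_fibre[OF fibre_proj]] by (auto simp: monodromy_total_def)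
    show "\<forall>p\<in>total P. proj P (?T p) = proj P p"
      using fibreD(2)[OF monodromy_fibre[OF fibre_proj]] by (auto simp: monodromy_total_def)
    show "\<forall>p\<in>total P. \<forall>g\<in>G. ?T (act P p g) = act P (?T p) g"
    proof (intro ballI)
      fix p g assume p: "p \<in> total P" and g: "g \<in> G"
      show "?T (act P p g) = act P (?T p) g"
        using arrow_act[OF fibre_proj[OF p] g, of ?c]
        by (simp only: monodromy_total_eq[OF act_fibre[OF fibre_proj[OF p] g]]
            monodromy_total_eq[OF fibre_proj[OF p]] monodromy_def)
    qed
  qed (use holo in blast)
  moreover have "?T (\<Phi> l z p) = \<Phi> l z (?T p)" if p: "p \<in> fibre P z" for l z p
  proof -
    have "\<Phi> ?c (exp l * z) (\<Phi> l z p) = \<Phi> l (exp ?c * z) (\<Phi> ?c z p)"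
      by (simp only: arrow_compose[OF p] add.commute)
    then show ?thesis
      by (simp only: monodromy_total_eq[OF p] monodromy_total_eq[OF arrow_fibre[OF p]]
          monodromy_def exp_period)
  qed
  ultimately show ?thesis
    unfolding rep_morphism_def prod.case by blast
qed

definition unip_endo :: "('p \<Rightarrow> 'p) \<Rightarrow> bool" where
  "unip_endo U \<longleftrightarrow> endo U \<and> (\<forall>p\<in>total P. mat_unipotent (mx U p))"

lemma unip_endoD:
  assumes "unip_endo U"
  shows "endo U" "p \<in> fibre P z \<Longrightarrow> mat_unipotent (mx U p)"
  using assms by (auto simp: unip_endo_def fibreD)

text \<open>The annihilator \<open>(X - 1)\<^sup>K\<close> over the point \<open>1\<close> propagates to the whole bundle, so one bound on the
  nilpotency order serves all fibres.\<close>

lemma unip_endo_order: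
  assumes "unip_endo U"
  obtains K where "\<And>p z. p \<in> fibre P z \<Longrightarrow> mpow (mx U p - mat 1) K = 0"
proof -
  obtain p1 where p1: "p1 \<in> fibre P 1"
    by (rule fibre_nonempty)
  obtain K where "mpow (mx U p1 - mat 1) K = 0"
    by (rule mat_unipotentE[OF unip_endoD(2)[OF assms p1]])
  then have "mpeval ([:- 1, 1:] ^ K) (mx U p1) = 0"
    by (simp only: mpeval_power mpeval_linear)
  from annihilator_propagates[OF unip_endoD(1)[OF assms] p1 this]
  have "mpow (mx U p - mat 1) K = 0" if "p \<in> fibre P z" for p z
    using that by (simp only: mpeval_power mpeval_linear)
  then show thesis
    by (rule that)
qed

lemma endo_upow:
  assumes "unip_endo U"
  shows "endo (\<lambda>p\<in>total P. act P p (upow (mx U p) c))"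
proof -
  obtain K where K: "\<And>p z. p \<in> fibre P z \<Longrightarrow> mpow (mx U p - mat 1) K = 0"
    by (rule unip_endo_order[OF assms]) (rule that)
  define \<pi> where "\<pi> = pcompose (truncate_fps K (fps_binomial c)) [:- 1, 1:]"
  have \<pi>: "mpeval \<pi> (mx U p) = upow (mx U p) c" if "p \<in> total P" for p
    by (simp only: \<pi>_def mpeval_pcompose mpeval_linear upow_nil_eval[OF K[OF fibre_proj[OF that]]])
  have "upow (mx U p) c \<in> G" if "p \<in> total P" for p
    using algebraic mx_in_group[OF unip_endoD(1)[OF assms] fibre_proj[OF that]]
      unip_endoD(2)[OF assms fibre_proj[OF that]]
    by (rule unipotent_powers_in_group)
  then have "endo (\<lambda>p\<in>total P. act P p (mpeval \<pi> (mx U p)))"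
    by (intro endo_mpeval unip_endoD(1)[OF assms]) (simp only: \<pi>)
  also have "(\<lambda>p\<in>total P. act P p (mpeval \<pi> (mx U p))) = (\<lambda>p\<in>total P. act P p (upow (mx U p) c))"
    by (rule restrict_ext) (simp only: \<pi>)
  finally show ?thesis .
qed

lemma mx_commuting_act:
  assumes "endo U" "p \<in> fibre P z" "g \<in> G" "g ** mx U p = mx U p ** g"
  shows "mx U (act P p g) = mx U p"
  by (simp add: mx_act[OF assms(1-3)] assms(4)[symmetric] matrix_inv_cancel[OF group(4)[OF assms(3)]]
      flip: matrix_mul_assoc)
     (simp add: assms(4)[symmetric] matrix_mul_assoc matrix_inv_cancel[OF group(4)[OF assms(3)]])

lemma upow_mx:
  assumes "unip_endo U" "p \<in> fibre P z"
  shows upow_mx_in_group: "upow (mx U p) c \<in> G"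
    and mx_act_upow: "mx U (act P p (upow (mx U p) c)) = mx U p"
proof -
  note U = mx_in_group[OF unip_endoD(1)[OF assms(1)] assms(2)] unip_endoD(2)[OF assms]
  show "upow (mx U p) c \<in> G"
    using algebraic U by (rule unipotent_powers_in_group)
  then show "mx U (act P p (upow (mx U p) c)) = mx U p"
    by (rule mx_commuting_act[OF unip_endoD(1)[OF assms(1)] assms(2)])
      (rule upow_commute[OF U(2) refl, symmetric])
qed

text \<open>The inverse of \<open>U\<close> is the power \<open>U\<^sup>c\<close> with \<open>c = - 1\<close>, which is again a polynomial in \<open>U\<close>.\<close>

lemma unip_endo_automorphism:
  assumes U: "unip_endo U"
  shows "rep_automorphism G P \<Phi> U"
proof -
  note endoU = unip_endoD(1)[OF U]
  let ?V = "\<lambda>p\<in>total P. act P p (upow (mx U p) (- 1))"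
  have inverse: "?V (U p) = p \<and> U (?V p) = p" if "p \<in> total P" for p
  proof
    note p = fibre_proj[OF that]
    note u = mx_in_group[OF endoU p] unip_endoD(2)[OF U p]
    have up: "upow (mx U p) c \<in> G" for c
      by (rule upow_mx_in_group[OF U p])
    have Up: "U p = act P p (upow (mx U p) 1)"
      by (simp only: upow_1[OF u(2)] act_mx[OF endoU p])
    have eq: "act P (act P p (upow (mx U p) a)) (upow (mx U p) (- a)) = p" for a
      by (simp only: act_act[OF that up up] upow_minus[OF u(2)] act_one[OF that])
    have "U p \<in> total P"
      by (rule fibreD(1)[OF endo_fibre[OF endoU p]])
    then show "?V (U p) = p"
      using eq[of 1] mx_act_upow[OF U p, of 1] by (simp only: restrict_apply if_True Up[symmetric])
    have "act P p (upow (mx U p) (- 1)) \<in> fibre P (proj P p)"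
      by (rule act_fibre[OF p up])
    from act_mx[OF endoU this] eq[of "- 1"] show "U (?V p) = p"
      by (simp add: that mx_act_upow[OF U p] upow_1[OF u(2)])
  qed
  then show ?thesis
    unfolding rep_automorphism_def using endoU endo_upow[OF U] by blast
qed

lemma restrict_fibre_gauge:
  assumes "endo U"
  shows "restrict U (fibre P z) \<in> gauge_aut G P z"
    and "p \<in> fibre P z \<Longrightarrow> mx (restrict U (fibre P z)) p = mx U p"
  using endo_fibre[OF assms] endo_act[OF assms] act_fibre
  by (auto simp: gauge_arrows_def gauge_matrix_def)

text \<open>The right-hand side is the condition on \<open>U\<close> in the objects \<open>(P, \<Psi>, U)\<close>. The inverse that it asks for exists for
  every unipotent endomorphism, as a power of \<open>U\<close>.\<close>

lemma unip_endo_iff: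
  "unip_endo U \<longleftrightarrow> rep_automorphism G P \<Phi> U \<and> (\<forall>z. gauge_unipotent G P z (restrict U (fibre P z)))"
proof
  assume U: "unip_endo U"
  then show "rep_automorphism G P \<Phi> U \<and> (\<forall>z. gauge_unipotent G P z (restrict U (fibre P z)))"
    using unip_endo_automorphism restrict_fibre_gauge[OF unip_endoD(1)[OF U]] unip_endoD(2)[OF U]
    by (simp add: gauge_unipotent_iff)
next
  assume *: "rep_automorphism G P \<Phi> U \<and> (\<forall>z. gauge_unipotent G P z (restrict U (fibre P z)))"
  then have U: "endo U"
    by (simp add: rep_automorphism_def)
  have "mat_unipotent (mx U p)" if "p \<in> total P" for p
  proof -
    have "mat_unipotent (mx (restrict U (fibre P (proj P p))) p)"
      using * fibre_proj[OF that] by (simp only: gauge_unipotent_iff)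
    then show ?thesis
      by (simp only: restrict_fibre_gauge(2)[OF U fibre_proj[OF that]])
  qed
  then show "unip_endo U"
    using U by (simp add: unip_endo_def)
qed

abbreviation monodromy_unipotent :: "'p \<Rightarrow> 'p" where
  "monodromy_unipotent \<equiv> monodromy_unip G P \<Phi>"

lemma mx_monodromy:
  assumes "p \<in> fibre P z"
  shows "mx (monodromy \<Phi> z) p = mx monodromy_total p"
  by (simp add: gauge_matrix_def monodromy_total_eq[OF assms])

lemma monodromy_unip_eq:
  "monodromy_unipotent = (\<lambda>p\<in>total P. act P p (munip (mx monodromy_total p)))"
  unfolding monodromy_unip_def
proof (rule restrict_ext)
  fix p assume "p \<in> total P"
  then show "unipotent_part G P (proj P p) (monodromy \<Phi> (proj P p)) p =
      act P p (munip (mx monodromy_total p))"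
    using fibre_proj by (simp add: unipotent_part_eq[OF monodromy_gauge_aut] mx_monodromy)
qed

lemma mx_monodromy_unip:
  assumes "p \<in> fibre P z"
  shows "mx monodromy_unipotent p = munip (mx monodromy_total p)"
proof (rule gauge_matrix_eq[OF fibreD(1)[OF assms]])
  show "munip (mx monodromy_total p) \<in> G"
    by (rule munip_in_group[OF algebraic mx_in_group[OF endo_monodromy assms]])
  show "monodromy_unipotent p = act P p (munip (mx monodromy_total p))"
    using fibreD(1)[OF assms] by (simp add: monodromy_unip_eq)
qed

text \<open>An annihilator of the monodromy over \<open>1\<close> annihilates it everywhere. So one polynomial \<open>Y\<close> computes the
  unipotent part in all fibres, and the unipotent part is an endomorphism along with the monodromy.\<close>

lemma unip_endo_monodromy_unip: "unip_endo monodromy_unipotent"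
proof -
  let ?M = monodromy_total
  note M = endo_monodromy
  have inv: "invertible (mx ?M p)" if "p \<in> fibre P z" for p z
    by (rule group(4)[OF mx_in_group[OF M that]])
  obtain p1 where p1: "p1 \<in> fibre P 1"
    by (rule fibre_nonempty)
  obtain \<pi> where \<pi>: "poly \<pi> 0 \<noteq> 0" "mpeval \<pi> (mx ?M p1) = 0"
    by (rule annihilating_polynomial_invertible[OF inv[OF p1]])
  obtain S Y where Y: "\<And>A :: 'n cmat. mpeval \<pi> A = 0 \<Longrightarrow> jordan_chevalley A (mpeval S A) (mpeval Y A)"
    by (rule jordan_chevalley_polynomials[OF \<pi>(1)]) (rule that)
  have munip: "munip (mx ?M p) = mpeval Y (mx ?M p)" if "p \<in> total P" for p
    using munip_eq[OF inv[OF fibre_proj[OF that]]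
        Y[OF annihilator_propagates[OF M p1 \<pi>(2) fibre_proj[OF that]]]] .
  have "munip (mx ?M p) \<in> G" if "p \<in> total P" for p
    by (rule munip_in_group[OF algebraic mx_in_group[OF M fibre_proj[OF that]]])
  then have "endo (\<lambda>p\<in>total P. act P p (mpeval Y (mx ?M p)))"
    by (intro endo_mpeval M) (simp only: munip[symmetric])
  also have "(\<lambda>p\<in>total P. act P p (mpeval Y (mx ?M p))) = monodromy_unipotent"
    unfolding monodromy_unip_eq by (rule restrict_ext) (simp only: munip)
  finally show ?thesis
    unfolding unip_endo_def
    using mx_monodromy_unip[OF fibre_proj] mat_unipotent_munip[OF inv[OF fibre_proj]] by simp
qed

end

section \<open>Twisting by the flow of a unipotent automorphism\<close>

text \<open>The family \<open>exp (k l log U)\<close>. The two cocycles of the theorem are the cases \<open>k = -1/(2\<pi>i)\<close>, for the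
  unipotent part of the monodromy, and \<open>k = 1/(2\<pi>i)\<close>.\<close>

definition unip_flow ::
    "'n::finite cmat set \<Rightarrow> ('p, 'n) pbundle \<Rightarrow> ('p \<Rightarrow> 'p) \<Rightarrow> complex \<Rightarrow> 'p arrows_family" where
  "unip_flow G P U k =
     (\<lambda>l z. \<lambda>p\<in>fibre P (exp l * z). act P p (upow (gauge_matrix G P U p) (k * l)))"

abbreviation period :: complex where
  "period \<equiv> 2 * of_real pi * \<i>"

lemma representationI:
  assumes "linear_algebraic_group G" "groupoid_rep G P \<Phi>"
  shows "representation G P \<Phi>"
proof unfold_locales
  show "principal_bundle G P"
    using assms(2) unfolding groupoid_rep_def by blast
qed (use assms in auto)

text \<open>An equivariant map carries frames to frames. Intertwining gauge maps therefore amounts to equality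
  of their matrices in corresponding frames, and it is inherited by everything that is computed from
  the matrices.\<close>

lemma gauge_matrix_intertwined:
  assumes "representation G P \<Phi>" "representation G P' \<Phi>'"
    and T: "rep_morphism G (P, \<Phi>) (P', \<Phi>') T" and p: "p \<in> fibre P z" "A p \<in> fibre P z"
    and A: "T (A p) = A' (T p)"
  shows "gauge_matrix G P' A' (T p) = gauge_matrix G P A p"
proof -
  interpret P: representation G P \<Phi> by fact
  interpret P': representation G P' \<Phi>' by fact
  note a = P.gauge_matrix_in_group[where T = A, OF p] P.act_gauge_matrix[where T = A, OF p]
  show ?thesis
  proof (rule P'.gauge_matrix_eq)
    show "T p \<in> total P'"
      by (rule P'.fibreD(1)[OF rep_morphismD(1)[OF T p(1)]])
    show "A' (T p) = act P' (T p) (gauge_matrix G P A p)"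
      by (simp only: A[symmetric] rep_morphismD(2)[OF T p(1) a(1), symmetric] a(2))
  qed (rule a(1))
qed

context representation
begin

lemma twist_flow_eq:
  assumes "unip_endo U" "p \<in> fibre P z"
  shows "twist P (unip_flow G P U k) \<Phi> l z p = act P (\<Phi> l z p) (upow (mx U p) (k * l))"
  by (simp add: twist_def compose_eq assms(2) unip_flow_def arrow_fibre
      mx_arrow[OF unip_endoD(1)[OF assms(1)] assms(2)])

lemma flow_gauge_aut:
  assumes U: "unip_endo U"
  shows "unip_flow G P U k l z \<in> gauge_aut G P (exp l * z)"
  unfolding unip_flow_def
proof (rule conj_in_gauge_aut)
  fix p assume p: "p \<in> fibre P (exp l * z)"
  show "upow (mx U p) (k * l) \<in> G"
    by (rule upow_mx_in_group[OF U p])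
  fix g assume g: "g \<in> G"
  show "upow (mx U (act P p g)) (k * l) = matrix_inv g ** upow (mx U p) (k * l) ** g"
    unfolding mx_act[OF unip_endoD(1)[OF U] p g]
    by (rule unipotent_conj(3)[OF matrix_inv_cancel(1)[OF group(4)[OF g]] unip_endoD(2)[OF U p]])
qed

lemma flow_holomorphic:
  assumes U: "unip_endo U" and V: "(V, \<phi>) \<in> trivs P"
  shows "\<exists>h. mat_holo2_on h {(l, z). exp l * z \<in> V} \<and>
    (\<forall>l z. exp l * z \<in> V \<longrightarrow>
      (\<forall>p\<in>fibre P (exp l * z). \<phi> (unip_flow G P U k l z p) = h (l, z) ** \<phi> p))"
proof -
  let ?W = "{(l, z). exp l * z \<in> V}"
  note endoU = unip_endoD(1)[OF U]
  obtain K where K: "\<And>p z. p \<in> fibre P z \<Longrightarrow> mpow (mx U p - mat 1) K = 0"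
    by (rule unip_endo_order[OF U]) (rule that)
  obtain u where u: "mat_holo_on u V" "\<And>p z. p \<in> fibre P z \<Longrightarrow> z \<in> V \<Longrightarrow> \<phi> (U p) = u z ** \<phi> p"
    by (rule endo_holomorphic[OF endoU V]) (rule that)
  define h where "h = (\<lambda>x. nil_eval K (fps_binomial (k * fst x)) (u (exp (fst x) * snd x) - mat 1))"
  have "mat_holo2_on h ?W"
    unfolding h_def
  proof (rule mat_holo2_on_binomial)
    show "mat_holo2_on (\<lambda>x. u (exp (fst x) * snd x)) ?W"
      by (rule mat_holo2_on_compose[OF u(1) trivsD(1)[OF V] holo2_on_target]) auto
    show "holo2_on (\<lambda>x. k * fst x) ?W"
      by (rule holo2_on_mult[OF holo2_on_const holo2_on_fst])
  qed
  moreover have "\<phi> (unip_flow G P U k l z p) = h (l, z) ** \<phi> p"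
    if z: "exp l * z \<in> V" and p: "p \<in> fibre P (exp l * z)" for l z p
  proof -
    let ?w = "exp l * z"
    let ?x = "upow (mx U p) (k * l)"
    note inv = matrix_inv_cancel[OF group(4)[OF triv_in_group[OF V p z]]]
    have mxU: "mx U p = matrix_inv (\<phi> p) ** u ?w ** \<phi> p"
      by (rule triv_mx(1)[OF endoU V z p u(2)[OF p z]])
    have "mx U p - mat 1 = matrix_inv (\<phi> p) ** (u ?w - mat 1) ** \<phi> p"
      by (simp add: mxU matrix_diff_distribs inv)
    then have "?x = matrix_inv (\<phi> p) ** h (l, z) ** \<phi> p"
      by (simp add: upow_nil_eval[OF K[OF p]] mpeval_conj[OF inv(1)] h_def)
    then have "\<phi> p ** ?x = h (l, z) ** \<phi> p"
      by (simp add: matrix_mul_assoc inv)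
    then show ?thesis
      using p by (simp add: unip_flow_def triv_act[OF V p z upow_mx_in_group[OF U p]])
  qed
  ultimately show ?thesis
    by blast
qed

text \<open>The matrix of \<open>U\<close> is the same in the frames \<open>p\<close>, \<open>\<Phi> p\<close> and \<open>p u\<^sup>c\<close>, where \<open>u\<close> denotes that matrix. So both sides of
  the cocycle identity act on \<open>\<Phi> p\<close> by a power of \<open>u\<close>, and the exponents agree.\<close>

lemma one_cocycle_flow:
  assumes U: "unip_endo U"
  shows "one_cocycle G P \<Phi> (unip_flow G P U k)"
  unfolding one_cocycle_def
proof (intro conjI allI ballI)
  let ?\<sigma> = "unip_flow G P U k"
  show "?\<sigma> l z \<in> gauge_aut G P (exp l * z)" for l z
    by (rule flow_gauge_aut[OF U])
  show "case x of (V, \<phi>) \<Rightarrow> \<exists>h. mat_holo2_on h {(l, z). exp l * z \<in> V} \<and>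
      (\<forall>l z. exp l * z \<in> V \<longrightarrow> (\<forall>p\<in>fibre P (exp l * z). \<phi> (?\<sigma> l z p) = h (l, z) ** \<phi> p))"
    if "x \<in> trivs P" for x
    using flow_holomorphic[OF U, of "fst x" "snd x" k] that by (simp add: case_prod_beta)
  fix m l z p assume p: "p \<in> fibre P (exp l * z)"
  let ?w = "exp l * z"
  let ?q = "\<Phi> m ?w p"
  have q: "?q \<in> fibre P (exp m * ?w)"
    by (rule arrow_fibre[OF p])
  note up = upow_mx_in_group[OF U p]
  note mxq = mx_arrow[OF unip_endoD(1)[OF U] p, of m]
  have qx: "act P ?q (upow (mx U p) c) \<in> fibre P (exp m * ?w)" for c
    by (rule act_fibre[OF q up])
  have "mx U (act P ?q (upow (mx U p) c)) = mx U p" for c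
    using mx_act_upow[OF U q, of c] by (simp only: mxq)
  then have "?\<sigma> m ?w (\<Phi> m ?w (?\<sigma> l z p)) =
      act P (act P ?q (upow (mx U p) (k * l))) (upow (mx U p) (k * m))"
    using p qx by (simp add: unip_flow_def arrow_act[OF p up])
  also have "\<dots> = act P ?q (upow (mx U p) (k * l) ** upow (mx U p) (k * m))"
    by (rule act_act[OF fibreD(1)[OF q] up up])
  also have "upow (mx U p) (k * l) ** upow (mx U p) (k * m) = upow (mx U p) (k * (m + l))"
    by (simp add: upow_add[OF unip_endoD(2)[OF U p], symmetric] algebra_simps)
  also have "act P ?q (upow (mx U p) (k * (m + l))) = ?\<sigma> (m + l) z ?q"
    using q by (simp add: unip_flow_def mxq exp_add mult.assoc)
  finally show "?\<sigma> m ?w (\<Phi> m ?w (?\<sigma> l z p)) = ?\<sigma> (m + l) z ?q" .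
qed

lemma groupoid_rep_twist:
  assumes \<sigma>: "one_cocycle G P \<Phi> \<sigma>"
  shows "groupoid_rep G P (twist P \<sigma> \<Phi>)"
proof -
  let ?\<Psi> = "twist P \<sigma> \<Phi>"
  have aut: "\<sigma> l z \<in> gauge_aut G P (exp l * z)" for l z
    using \<sigma> by (simp add: one_cocycle_def)
  have cocycle: "\<sigma> m (exp l * z) (\<Phi> m (exp l * z) (\<sigma> l z p)) = \<sigma> (m + l) z (\<Phi> m (exp l * z) p)"
    if "p \<in> fibre P (exp l * z)" for m l z p
    using \<sigma> that unfolding one_cocycle_def by blast
  have eq: "?\<Psi> l z p = \<sigma> l z (\<Phi> l z p)" if "p \<in> fibre P z" for l z p
    using that by (simp add: twist_def compose_eq)
  have fib: "?\<Psi> l z p \<in> fibre P (exp l * z)" if "p \<in> fibre P z" for l z p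
    unfolding eq[OF that] by (rule gauge_autD(1)[OF aut arrow_fibre[OF that]])
  have ext: "?\<Psi> l z \<in> extensional (fibre P z)" for l z
    by (simp add: twist_def)
  have "?\<Psi> l z \<in> gauge_arrows G P z (exp l * z)" for l z
  proof -
    have "?\<Psi> l z (act P p g) = act P (?\<Psi> l z p) g" if p: "p \<in> fibre P z" and g: "g \<in> G" for p g
      by (simp only: eq[OF p] eq[OF act_fibre[OF p g]] arrow_act[OF p g]
          gauge_autD(2)[OF aut arrow_fibre[OF p] g])
    then show ?thesis
      using fib ext by (auto simp: gauge_arrows_def PiE_def)
  qed
  moreover have "compose (fibre P z) (?\<Psi> m (exp l * z)) (?\<Psi> l z) = ?\<Psi> (m + l) z" for l m z
  proof (rule extensionalityI[of _ "fibre P z"])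
    fix p assume p: "p \<in> fibre P z"
    note q = arrow_fibre[OF p, of l]
    have "?\<Psi> m (exp l * z) (?\<Psi> l z p) = \<sigma> m (exp l * z) (\<Phi> m (exp l * z) (?\<Psi> l z p))"
      by (rule eq[OF fib[OF p]])
    also have "\<dots> = \<sigma> (m + l) z (\<Phi> m (exp l * z) (\<Phi> l z p))"
      by (simp only: eq[OF p] cocycle[OF q])
    finally show "compose (fibre P z) (?\<Psi> m (exp l * z)) (?\<Psi> l z) p = ?\<Psi> (m + l) z p"
      by (simp only: compose_eq[OF p] arrow_compose[OF p] eq[OF p])
  qed (simp, rule ext)
  moreover have "\<exists>h. mat_holo2_on h {(l, z). z \<in> V \<and> exp l * z \<in> W} \<and>
      (\<forall>l. \<forall>z\<in>V. exp l * z \<in> W \<longrightarrow> (\<forall>p\<in>fibre P z. \<psi> (?\<Psi> l z p) = h (l, z) ** \<phi> p))"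
    if V: "(V, \<phi>) \<in> trivs P" and W: "(W, \<psi>) \<in> trivs P" for V \<phi> W \<psi>
  proof -
    let ?D = "{(l, z). z \<in> V \<and> exp l * z \<in> W}"
    obtain h where h: "mat_holo2_on h ?D"
      "\<And>l z p. z \<in> V \<Longrightarrow> exp l * z \<in> W \<Longrightarrow> p \<in> fibre P z \<Longrightarrow> \<psi> (\<Phi> l z p) = h (l, z) ** \<phi> p"
      by (rule arrow_holomorphic[OF V W]) (rule that)
    have "\<forall>(V, \<phi>)\<in>trivs P. \<exists>h. mat_holo2_on h {(l, z). exp l * z \<in> V} \<and>
        (\<forall>l z. exp l * z \<in> V \<longrightarrow> (\<forall>p\<in>fibre P (exp l * z). \<phi> (\<sigma> l z p) = h (l, z) ** \<phi> p))"
      using \<sigma> by (simp add: one_cocycle_def)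
    from bspec[OF this W, unfolded prod.case]
    obtain s where s: "mat_holo2_on s {(l, z). exp l * z \<in> W}"
      "\<And>l z p. exp l * z \<in> W \<Longrightarrow> p \<in> fibre P (exp l * z) \<Longrightarrow> \<psi> (\<sigma> l z p) = s (l, z) ** \<psi> p"
      by blast
    have "mat_holo2_on s ?D"
      using s(1) by (rule mat_holo2_on_subset) auto
    then have "mat_holo2_on (\<lambda>x. s x ** h x) ?D"
      using h(1) by (rule mat_holo2_on_mult)
    moreover have "\<psi> (?\<Psi> l z p) = (s (l, z) ** h (l, z)) ** \<phi> p"
      if "z \<in> V" "exp l * z \<in> W" "p \<in> fibre P z" for l z p
      by (simp only: eq[OF that(3)] s(2)[OF that(2) arrow_fibre[OF that(3)]] h(2)[OF that]
          matrix_mul_assoc)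
    ultimately show ?thesis
      by blast
  qed
  ultimately show ?thesis
    unfolding groupoid_rep_def using principal by blast
qed

lemma representation_twist_flow:
  assumes "unip_endo U"
  shows "representation G P (twist P (unip_flow G P U k) \<Phi>)"
  using algebraic groupoid_rep_twist[OF one_cocycle_flow[OF assms]] by (rule representationI)

lemma representation_self: "representation G P \<Phi>"
  using algebraic representation by (rule representationI)

text \<open>The monodromy is an arrow, so the matrix of \<open>T\<close> is the same in the frames \<open>p\<close> and \<open>p m\<close>, where \<open>m\<close> is the
  matrix of the monodromy.\<close>

lemma mx_commute_monodromy:
  assumes T: "endo T" and p: "p \<in> fibre P z"
  shows "mx monodromy_total p ** mx T p = mx T p ** mx monodromy_total p"
proof -
  let ?m = "mx monodromy_total p"
  note m = mx_in_group[OF endo_monodromy p]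
  have "act P p ?m = \<Phi> period z p"
    using act_mx[OF endo_monodromy p] by (simp only: monodromy_total_eq[OF p] monodromy_def)
  then have "matrix_inv ?m ** mx T p ** ?m = mx T p"
    using mx_act[OF T p m] mx_arrow[OF T p, of period] by (simp only:)
  then have "?m ** (matrix_inv ?m ** mx T p ** ?m) = ?m ** mx T p"
    by (simp only:)
  then show ?thesis
    by (simp add: matrix_mul_assoc matrix_inv_cancel[OF group(4)[OF m]])
qed

text \<open>In a frame, twisting multiplies the monodromy by the power \<open>U\<^sup>c\<close> with \<open>c = 2\<pi>i k\<close>.\<close>

lemma mx_twisted_monodromy:
  assumes U: "unip_endo U" and p: "p \<in> fibre P z"
  shows "mx (monodromy (twist P (unip_flow G P U k) \<Phi>) z) p =
    mx monodromy_total p ** upow (mx U p) (k * period)"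
proof (rule gauge_matrix_eq[OF fibreD(1)[OF p]])
  note m = mx_in_group[OF endo_monodromy p] and u = upow_mx_in_group[OF U p, of "k * period"]
  show "mx monodromy_total p ** upow (mx U p) (k * period) \<in> G"
    using m u by (rule group(2))
  have "monodromy \<Phi> z p = act P p (mx monodromy_total p)"
    by (simp only: act_mx[OF endo_monodromy p] monodromy_total_eq[OF p])
  then show "monodromy (twist P (unip_flow G P U k) \<Phi>) z p =
      act P p (mx monodromy_total p ** upow (mx U p) (k * period))"
    using act_act[OF fibreD(1)[OF p] m u] by (simp only: monodromy_def twist_flow_eq[OF U p])
qed

lemma sigma_cocycle_eq: "sigma_cocycle G P \<Phi> = unip_flow G P monodromy_unipotent (- 1 / period)"
proof (intro ext)
  fix l z :: complex and x
  let ?U = monodromy_unipotent and ?w = "exp l * z"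
  note U = unip_endo_monodromy_unip
  have part: "unipotent_part G P ?w (monodromy \<Phi> ?w) = restrict ?U (fibre P ?w)"
    unfolding unipotent_part_eq[OF monodromy_gauge_aut]
    by (rule restrict_ext) (simp add: monodromy_unip_eq mx_monodromy fibreD(1))
  have unip: "gauge_unipotent G P ?w (restrict ?U (fibre P ?w))"
    using U unfolding unip_endo_iff by blast
  have "sigma_cocycle G P \<Phi> l z =
      (\<lambda>p\<in>fibre P ?w. act P p (upow (mx (restrict ?U (fibre P ?w)) p) (- l / period)))"
    unfolding sigma_cocycle_def Let_def part by (rule gauge_exp_scale_log[OF unip])
  also have "\<dots> = unip_flow G P ?U (- 1 / period) l z"
    unfolding unip_flow_def
    by (rule restrict_ext) (simp add: restrict_fibre_gauge(2)[OF unip_endoD(1)[OF U]])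
  finally show "sigma_cocycle G P \<Phi> l z x = unip_flow G P ?U (- 1 / period) l z x"
    by simp
qed

lemma tau_cocycle_eq:
  assumes U: "unip_endo U"
  shows "tau_cocycle G P U = unip_flow G P U (1 / period)"
proof (intro ext)
  fix l z :: complex and x
  let ?w = "exp l * z"
  have unip: "gauge_unipotent G P ?w (restrict U (fibre P ?w))"
    using U unfolding unip_endo_iff by blast
  have "tau_cocycle G P U l z =
      (\<lambda>p\<in>fibre P ?w. act P p (upow (mx (restrict U (fibre P ?w)) p) (l / period)))"
    unfolding tau_cocycle_def Let_def by (rule gauge_exp_scale_log[OF unip])
  also have "\<dots> = unip_flow G P U (1 / period) l z"
    unfolding unip_flow_def
    by (rule restrict_ext) (simp add: restrict_fibre_gauge(2)[OF unip_endoD(1)[OF U]])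
  finally show "tau_cocycle G P U l z x = unip_flow G P U (1 / period) l z x"
    by simp
qed

end

lemma rep_morphism_twist_flow:
  assumes P: "representation G P \<Phi>" and P': "representation G P' \<Phi>'"
    and U: "representation.unip_endo G P \<Phi> U" and U': "representation.unip_endo G P' \<Phi>' U'"
    and T: "rep_morphism G (P, \<Phi>) (P', \<Phi>') T" and TU: "\<And>p. p \<in> total P \<Longrightarrow> T (U p) = U' (T p)"
  shows "rep_morphism G (P, twist P (unip_flow G P U k) \<Phi>) (P', twist P' (unip_flow G P' U' k) \<Phi>') T"
proof -
  interpret P: representation G P \<Phi> by fact
  interpret P': representation G P' \<Phi>' by fact
  have "T (twist P (unip_flow G P U k) \<Phi> l z p) = twist P' (unip_flow G P' U' k) \<Phi>' l z (T p)"
    if p: "p \<in> fibre P z" for l z p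
  proof -
    have "gauge_matrix G P' U' (T p) = gauge_matrix G P U p"
      by (rule gauge_matrix_intertwined[where A = U and A' = U',
            OF P P' T p P.endo_fibre[OF P.unip_endoD(1)[OF U] p]
            TU[OF P.fibreD(1)[OF p]]])
    then show ?thesis
      by (simp only: P.twist_flow_eq[OF U p] P'.twist_flow_eq[OF U' rep_morphismD(1)[OF T p]]
          rep_morphismD(2)[OF T P.arrow_fibre[OF p] P.upow_mx_in_group[OF U p]]
          rep_morphismD(3)[OF T p])
  qed
  then show ?thesis
    using rep_morphismD(5)[OF T] by (simp add: rep_morphism_def)
qed

context representation
begin

lemma unip_endo_twist_flow:
  assumes U: "unip_endo U"
  shows "representation.unip_endo G P (twist P (unip_flow G P U k) \<Phi>) U"
proof -
  let ?\<Psi> = "twist P (unip_flow G P U k) \<Phi>"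
  have "rep_morphism G (P, ?\<Psi>) (P, ?\<Psi>) U"
    using representation_self representation_self U U unip_endoD(1)[OF U] refl
    by (rule rep_morphism_twist_flow)
  then show ?thesis
    using U by (simp add: representation.unip_endo_def[OF representation_twist_flow[OF U]] unip_endo_def)
qed

lemma twist_flow_inverse:
  assumes U: "unip_endo U" and "k + k' = 0"
  shows "twist P (unip_flow G P U k') (twist P (unip_flow G P U k) \<Phi>) = \<Phi>"
proof (intro ext)
  let ?\<Psi> = "twist P (unip_flow G P U k) \<Phi>"
  interpret T: representation G P ?\<Psi>
    by (rule representation_twist_flow[OF U])
  fix l z p
  show "twist P (unip_flow G P U k') ?\<Psi> l z p = \<Phi> l z p"
  proof (cases "p \<in> fibre P z")
    case p: True
    note q = arrow_fibre[OF p, of l] and u = upow_mx_in_group[OF U p]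
    have "twist P (unip_flow G P U k') ?\<Psi> l z p =
        act P (act P (\<Phi> l z p) (upow (mx U p) (k * l))) (upow (mx U p) (k' * l))"
      by (simp only: T.twist_flow_eq[OF unip_endo_twist_flow[OF U] p] twist_flow_eq[OF U p])
    also have "\<dots> = act P (\<Phi> l z p) (upow (mx U p) (k * l + k' * l))"
      by (simp only: act_act[OF fibreD(1)[OF q] u u] upow_add[OF unip_endoD(2)[OF U p]])
    also have "k * l + k' * l = 0"
      using assms(2) by (simp only: distrib_right[symmetric] mult_zero_left)
    also have "act P (\<Phi> l z p) (upow (mx U p) 0) = \<Phi> l z p"
      by (simp only: upow_0[OF unip_endoD(2)[OF U p]] act_one[OF fibreD(1)[OF q]])
    finally show ?thesis .
  next
    case False
    then show ?thesis
      using arrow_extensional[of l z] by (simp add: twist_def compose_def extensional_def)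
  qed
qed

text \<open>For this twist \<open>k = -1/(2\<pi>i)\<close>, so the new monodromy is \<open>M\<close> times the inverse of \<open>M\<^sub>u\<close>, that is \<open>M\<^sub>s\<close>.\<close>

lemma semisimple_sigma_twist:
  "gauge_semisimple G P z (monodromy (twist P (sigma_cocycle G P \<Phi>) \<Phi>) z)"
proof -
  let ?U = monodromy_unipotent
  note U = unip_endo_monodromy_unip
  interpret T: representation G P "twist P (unip_flow G P ?U (- 1 / period)) \<Phi>"
    by (rule representation_twist_flow[OF U])
  have "mat_semisimple (mx (monodromy (twist P (unip_flow G P ?U (- 1 / period)) \<Phi>) z) p)"
    if p: "p \<in> fibre P z" for p
  proof -
    let ?m = "mx monodromy_total p"
    have jc: "jordan_chevalley ?m (msemi ?m) (munip ?m)"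
      by (rule jordan_chevalley_msemi_munip[OF group(4)[OF mx_in_group[OF endo_monodromy p]]])
    have unip: "mat_unipotent (munip ?m)"
      using jc by (simp add: jordan_chevalley_def)
    have "mx (monodromy (twist P (unip_flow G P ?U (- 1 / period)) \<Phi>) z) p = ?m ** upow (munip ?m) (- 1)"
      unfolding mx_twisted_monodromy[OF U p] mx_monodromy_unip[OF p] by simp
    also have "\<dots> = msemi ?m ** (munip ?m ** upow (munip ?m) (- 1))"
      using jc by (simp add: jordan_chevalley_def matrix_mul_assoc)
    also have "\<dots> = msemi ?m"
      using upow_minus[OF unip, of 1] by (simp add: upow_1[OF unip])
    finally show ?thesis
      using jc by (simp add: jordan_chevalley_def)
  qed
  then show ?thesis
    unfolding sigma_cocycle_eq gauge_semisimple_iff using T.monodromy_gauge_aut by blast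
qed

text \<open>For this twist \<open>k = 1/(2\<pi>i)\<close>, so the new monodromy is the product of the semisimple old one with \<open>U\<close>. The factors commute,
  hence uniqueness of the Jordan-Chevalley decomposition identifies \<open>U\<close> as its unipotent part.\<close>

lemma monodromy_unip_tau_twist:
  assumes semisimple: "\<And>z. gauge_semisimple G P z (monodromy \<Phi> z)" and U: "unip_endo U"
  shows "monodromy_unip G P (twist P (tau_cocycle G P U) \<Phi>) = U"
proof -
  let ?\<Psi> = "twist P (unip_flow G P U (1 / period)) \<Phi>"
  interpret T: representation G P ?\<Psi>
    by (rule representation_twist_flow[OF U])
  note endoU = unip_endoD(1)[OF U]
  have "act P p (munip (mx T.monodromy_total p)) = U p" if "p \<in> total P" for p
  proof -
    note p = fibre_proj[OF that]
    let ?m = "mx monodromy_total p"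
    have "mat_semisimple ?m"
      using semisimple p by (simp add: gauge_semisimple_iff mx_monodromy[OF p, symmetric])
    moreover have "mx T.monodromy_total p = ?m ** mx U p"
      using mx_twisted_monodromy[OF U p, of "1 / period"] upow_1[OF unip_endoD(2)[OF U p]]
      by (simp add: T.mx_monodromy[OF p])
    ultimately have "jordan_chevalley (mx T.monodromy_total p) ?m (mx U p)"
      using unip_endoD(2)[OF U p] mx_commute_monodromy[OF endoU p] by (simp add: jordan_chevalley_def)
    then have "munip (mx T.monodromy_total p) = mx U p"
      by (rule munip_eq[OF group(4)[OF T.mx_in_group[OF T.endo_monodromy p]]])
    then show ?thesis
      by (simp only: act_mx[OF endoU p])
  qed
  then have "T.monodromy_unipotent = restrict U (total P)"
    unfolding T.monodromy_unip_eq by (rule restrict_ext)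
  also have "\<dots> = U"
    by (rule extensional_restrict[OF endo_extensional[OF endoU]])
  finally show ?thesis
    by (simp only: tau_cocycle_eq[OF U])
qed

end

lemma rep_morphism_monodromy_unip:
  assumes P: "representation G P \<Phi>" and P': "representation G P' \<Phi>'"
    and T: "rep_morphism G (P, \<Phi>) (P', \<Phi>') T" and "p \<in> total P"
  shows "T (monodromy_unip G P \<Phi> p) = monodromy_unip G P' \<Phi>' (T p)"
proof -
  interpret P: representation G P \<Phi> by fact
  interpret P': representation G P' \<Phi>' by fact
  note p = P.fibre_proj[OF assms(4)] and p' = rep_morphismD(1)[OF T P.fibre_proj[OF assms(4)]]
  have "T (P.monodromy_total p) = P'.monodromy_total (T p)"
    by (simp only: P.monodromy_total_eq[OF p] P'.monodromy_total_eq[OF p'] monodromy_def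
        rep_morphismD(3)[OF T p])
  then have eq: "gauge_matrix G P' P'.monodromy_total (T p) = gauge_matrix G P P.monodromy_total p"
    by (rule gauge_matrix_intertwined[where A = P.monodromy_total and A' = P'.monodromy_total,
          OF P P' T p P.endo_fibre[OF P.endo_monodromy p]])
  have "munip (gauge_matrix G P P.monodromy_total p) \<in> G"
    by (rule munip_in_group[OF P.algebraic P.mx_in_group[OF P.endo_monodromy p]])
  from rep_morphismD(2)[OF T p this] show ?thesis
    using P'.fibreD(1)[OF p'] assms(4) by (simp add: P.monodromy_unip_eq P'.monodromy_unip_eq eq)
qed

section \<open>The categories\<close>

lemma (in representation) endo_id: "endo (\<lambda>p\<in>total P. p)"
proof -
  have "endo (\<lambda>p\<in>total P. act P p (mpeval 1 (mx monodromy_total p)))"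
    by (rule endo_mpeval[OF endo_monodromy]) (simp add: group(1))
  also have "(\<lambda>p\<in>total P. act P p (mpeval 1 (mx monodromy_total p))) = (\<lambda>p\<in>total P. p)"
    by (rule restrict_ext) (simp add: act_one)
  finally show ?thesis .
qed

text \<open>In trivializations of \<open>P\<close> and \<open>P''\<close> the composite is multiplication by some \<open>h\<close>, read off from a choice \<open>s\<close> of
  one frame over each point. Holomorphy of \<open>h\<close> is a local matter, and near each point a trivialization
  of \<open>P'\<close> exhibits \<open>h\<close> as a product of two holomorphic functions.\<close>

lemma rep_morphism_compose:
  assumes P: "representation G P \<Phi>" and P': "representation G P' \<Phi>'" and P'': "representation G P'' \<Phi>''"
    and T: "rep_morphism G (P, \<Phi>) (P', \<Phi>') T" and T': "rep_morphism G (P', \<Phi>') (P'', \<Phi>'') T'"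
  shows "rep_morphism G (P, \<Phi>) (P'', \<Phi>'') (compose (total P) T' T)" (is "rep_morphism _ _ _ ?C")
proof -
  interpret P: representation G P \<Phi> by fact
  interpret P': representation G P' \<Phi>' by fact
  interpret P'': representation G P'' \<Phi>'' by fact
  have C: "?C p = T' (T p)" if "p \<in> fibre P z" for p z
    by (rule compose_eq[OF P.fibreD(1)[OF that]])
  have fib: "?C p \<in> fibre P'' z" if "p \<in> fibre P z" for p z
    unfolding C[OF that] by (rule rep_morphismD(1)[OF T' rep_morphismD(1)[OF T that]])
  have equiv: "?C (act P p g) = act P'' (?C p) g" if p: "p \<in> fibre P z" and g: "g \<in> G" for p g z
    by (simp only: C[OF p] C[OF P.act_fibre[OF p g]] rep_morphismD(2)[OF T p g]
        rep_morphismD(2)[OF T' rep_morphismD(1)[OF T p] g])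
  have holo: "\<exists>h. mat_holo_on h (V \<inter> W) \<and> (\<forall>p\<in>over P (V \<inter> W). \<psi> (?C p) = h (proj P p) ** \<phi> p)"
    if V: "(V, \<phi>) \<in> trivs P" and W: "(W, \<psi>) \<in> trivs P''" for V \<phi> W \<psi>
  proof -
    define s where "s = (\<lambda>z. SOME p. p \<in> fibre P z)"
    have s: "s z \<in> fibre P z" for z
      unfolding s_def using P.fibre_nonempty someI_ex by metis
    define h where "h = (\<lambda>z. \<psi> (?C (s z)) ** matrix_inv (\<phi> (s z)))"
    have h: "\<psi> (?C p) = h z ** \<phi> p" if p: "p \<in> fibre P z" and z: "z \<in> V" "z \<in> W" for p z
    proof -
      obtain g where g: "g \<in> G" "p = act P (s z) g"
        using s p by (rule P.act_transitive)
      have "\<psi> (?C p) = \<psi> (?C (s z)) ** g"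
        unfolding g(2) equiv[OF s g(1)] by (rule P''.triv_act[OF W fib[OF s] z(2) g(1)])
      moreover have "\<phi> p = \<phi> (s z) ** g"
        unfolding g(2) by (rule P.triv_act[OF V s z(1) g(1)])
      ultimately show ?thesis
        by (simp add: h_def matrix_mul_assoc
            matrix_inv_cancel'[OF P.group(4)[OF P.triv_in_group[OF V s z(1)]]])
    qed
    have unique: "h z = k" if "z \<in> V" "z \<in> W" "\<psi> (?C (s z)) = k ** \<phi> (s z)" for z k
      by (simp only: h_def that(3)
          matrix_inv_cancel'[OF P.group(4)[OF P.triv_in_group[OF V s that(1)]]])
    have "mat_holo_on h (V \<inter> W)"
    proof (rule mat_holo_on_local)
      fix z assume z: "z \<in> V \<inter> W"
      obtain V' \<theta> where V': "(V', \<theta>) \<in> trivs P'" "z \<in> V'"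
        by (rule P'.trivs_cover)
      obtain h1 where h1: "mat_holo_on h1 (V \<inter> V')"
          "\<And>p z. p \<in> fibre P z \<Longrightarrow> z \<in> V \<Longrightarrow> z \<in> V' \<Longrightarrow> \<theta> (T p) = h1 z ** \<phi> p"
        by (rule bundle_morphism_local[OF rep_morphismD(5)[OF T] V V'(1)]) (rule that)
      obtain h2 where h2: "mat_holo_on h2 (V' \<inter> W)"
          "\<And>p z. p \<in> fibre P' z \<Longrightarrow> z \<in> V' \<Longrightarrow> z \<in> W \<Longrightarrow> \<psi> (T' p) = h2 z ** \<theta> p"
        by (rule bundle_morphism_local[OF rep_morphismD(5)[OF T'] V'(1) W]) (rule that)
      let ?B = "V \<inter> V' \<inter> W"
      have "h w = h2 w ** h1 w" if "w \<in> ?B" for w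
      proof (rule unique)
        have w: "w \<in> V" "w \<in> V'" "w \<in> W"
          using that by auto
        show "\<psi> (?C (s w)) = h2 w ** h1 w ** \<phi> (s w)"
          by (simp only: C[OF s] h2(2)[OF rep_morphismD(1)[OF T s] w(2,3)] h1(2)[OF s w(1,2)]
              matrix_mul_assoc)
      qed (use that in auto)
      moreover have "mat_holo_on (\<lambda>w. h2 w ** h1 w) ?B"
        by (intro mat_holo_on_mult mat_holo_on_subset[OF h2(1)] mat_holo_on_subset[OF h1(1)]) auto
      moreover have "open ?B"
        using P.trivsD(1)[OF V] P'.trivsD(1)[OF V'(1)] P''.trivsD(1)[OF W] by (intro open_Int)
      ultimately show "\<exists>B g. open B \<and> z \<in> B \<and> mat_holo_on g B \<and> (\<forall>w\<in>B. h w = g w)"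
        using z V'(2) by (intro exI[of _ ?B] exI[of _ "\<lambda>w. h2 w ** h1 w"]) auto
    qed
    moreover have "\<psi> (?C p) = h (proj P p) ** \<phi> p" if "p \<in> over P (V \<inter> W)" for p
      using that by (intro h) (auto simp: over_def fibre_def)
    ultimately show ?thesis
      by blast
  qed
  have "bundle_morphism G P P'' ?C"
    unfolding bundle_morphism_def
  proof (intro conjI)
    show "?C \<in> total P \<rightarrow>\<^sub>E total P''"
      using P''.fibreD(1)[OF fib[OF P.fibre_proj]] by (auto simp: PiE_def)
    show "\<forall>p\<in>total P. proj P'' (?C p) = proj P p"
      using P''.fibreD(2)[OF fib[OF P.fibre_proj]] by blast
    show "\<forall>p\<in>total P. \<forall>g\<in>G. ?C (act P p g) = act P'' (?C p) g"
      using equiv[OF P.fibre_proj] by blast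
  qed (use holo in blast)
  moreover have "?C (\<Phi> l z p) = \<Phi>'' l z (?C p)" if p: "p \<in> fibre P z" for l z p
    by (simp only: C[OF p] C[OF P.arrow_fibre[OF p]] rep_morphismD(3)[OF T p]
        rep_morphismD(3)[OF T' rep_morphismD(1)[OF T p]])
  ultimately show ?thesis
    unfolding rep_morphism_def prod.case by blast
qed

lemma Rep_catD:
  shows "(P, \<Phi>) \<in> Obj (Rep_cat G) \<longleftrightarrow> groupoid_rep G P \<Phi>"
    and "Hom (Rep_cat G) X Y = {T. rep_morphism G X Y T}"
    and "Idt (Rep_cat G) (P, \<Phi>) = (\<lambda>p\<in>total P. p)"
    and "Cmp (Rep_cat G) (P, \<Phi>) Y Z g f = compose (total P) g f"
  by (simp_all add: Rep_cat_def)

lemma JC_catD: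
  shows "Hom (JC_cat G) (P, \<Psi>, U) (P', \<Psi>', U') =
      {T. rep_morphism G (P, \<Psi>) (P', \<Psi>') T \<and> (\<forall>p\<in>total P. T (U p) = U' (T p))}"
    and "Idt (JC_cat G) (P, \<Psi>, U) = (\<lambda>p\<in>total P. p)"
    and "Cmp (JC_cat G) (P, \<Psi>, U) Y Z g f = compose (total P) g f"
  by (simp_all add: JC_cat_def)

lemma JC_cat_Obj:
  assumes "linear_algebraic_group G"
  shows "(P, \<Psi>, U) \<in> Obj (JC_cat G) \<longleftrightarrow> groupoid_rep G P \<Psi> \<and>
    (\<forall>z. gauge_semisimple G P z (monodromy \<Psi> z)) \<and> representation.unip_endo G P \<Psi> U"
  using representation.unip_endo_iff[OF representationI[OF assms], of P \<Psi> U]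
  by (auto simp: JC_cat_def)

lemma compose_restrict_id:
  assumes "f \<in> A \<rightarrow>\<^sub>E B"
  shows "compose A f (\<lambda>x\<in>A. x) = f" "compose A (\<lambda>x\<in>B. x) f = f"
  using assms compose_Id[of f A B] Id_compose[of f A B] by (auto simp: PiE_def)

lemma category_Rep_cat:
  assumes G: "linear_algebraic_group G"
  shows "category (Rep_cat G :: (('p, 'n::finite) pbundle \<times> 'p arrows_family, 'p \<Rightarrow> 'p) cat)"
proof -
  note rep = representationI[OF G]
  show ?thesis
    unfolding category_def
  proof (intro conjI; intro ballI; unfold split_paired_all Rep_catD mem_Collect_eq)
    show "rep_morphism G (P, \<Phi>) (P, \<Phi>) (\<lambda>p\<in>total P. p)"
      if "groupoid_rep G P \<Phi>" for P :: "('p, 'n) pbundle" and \<Phi>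
      by (rule representation.endo_id[OF rep[OF that]])
    show "rep_morphism G (P, \<Phi>) (P'', \<Phi>'') (compose (total P) g f)"
      if "groupoid_rep G P \<Phi>" "groupoid_rep G P' \<Phi>'" "groupoid_rep G P'' \<Phi>''"
        "rep_morphism G (P, \<Phi>) (P', \<Phi>') f" "rep_morphism G (P', \<Phi>') (P'', \<Phi>'') g"
      for P P' P'' :: "('p, 'n) pbundle" and \<Phi> \<Phi>' \<Phi>'' f g
      by (rule rep_morphism_compose[OF rep rep rep]) (rule that)+
    show "compose (total P) f (\<lambda>p\<in>total P. p) = f \<and> compose (total P) (\<lambda>p\<in>total P'. p) f = f"
      if "rep_morphism G (P, \<Phi>) (P', \<Phi>') f"
      for P P' :: "('p, 'n) pbundle" and \<Phi> \<Phi>' f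
      using rep_morphismD(4)[OF that] by (intro conjI compose_restrict_id)
    show "compose (total P) h (compose (total P) g f) = compose (total P) (compose (total P') h g) f"
      if "rep_morphism G (P, \<Phi>) (P', \<Phi>') f"
      for P P' :: "('p, 'n) pbundle" and \<Phi> \<Phi>' f g h
      using rep_morphismD(4)[OF that] by (intro compose_assoc) auto
  qed
qed

lemma category_JC_cat:
  assumes G: "linear_algebraic_group G"
  shows "category (JC_cat G ::
    (('p, 'n::finite) pbundle \<times> 'p arrows_family \<times> ('p \<Rightarrow> 'p), 'p \<Rightarrow> 'p) cat)"
proof -
  note rep = representationI[OF G]
  show ?thesis
    unfolding category_def
  proof (intro conjI; intro ballI; unfold split_paired_all JC_catD JC_cat_Obj[OF G] mem_Collect_eq)
    show "rep_morphism G (P, \<Psi>) (P, \<Psi>) (\<lambda>p\<in>total P. p) \<and>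
        (\<forall>p\<in>total P. (\<lambda>p\<in>total P. p) (U p) = U ((\<lambda>p\<in>total P. p) p))"
      if "groupoid_rep G P \<Psi> \<and> (\<forall>z. gauge_semisimple G P z (monodromy \<Psi> z)) \<and>
        representation.unip_endo G P \<Psi> U"
      for P :: "('p, 'n) pbundle" and \<Psi> U
    proof -
      interpret representation G P \<Psi>
        using that by (intro rep) blast
      have "U p \<in> total P" if p: "p \<in> total P" for p
        using fibreD(1)[OF endo_fibre[OF unip_endoD(1) fibre_proj[OF p]]]
          \<open>groupoid_rep G P \<Psi> \<and> _\<close> by blast
      then show ?thesis
        using endo_id by simp
    qed
    show "rep_morphism G (P, \<Psi>) (P'', \<Psi>'') (compose (total P) g f) \<and>
        (\<forall>p\<in>total P. compose (total P) g f (U p) = U'' (compose (total P) g f p))"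
      if X: "groupoid_rep G P \<Psi> \<and> (\<forall>z. gauge_semisimple G P z (monodromy \<Psi> z)) \<and>
          representation.unip_endo G P \<Psi> U"
        and Y: "groupoid_rep G P' \<Psi>' \<and> (\<forall>z. gauge_semisimple G P' z (monodromy \<Psi>' z)) \<and>
          representation.unip_endo G P' \<Psi>' U'"
        and Z: "groupoid_rep G P'' \<Psi>'' \<and> (\<forall>z. gauge_semisimple G P'' z (monodromy \<Psi>'' z)) \<and>
          representation.unip_endo G P'' \<Psi>'' U''"
        and f: "rep_morphism G (P, \<Psi>) (P', \<Psi>') f \<and> (\<forall>p\<in>total P. f (U p) = U' (f p))"
        and g: "rep_morphism G (P', \<Psi>') (P'', \<Psi>'') g \<and> (\<forall>p\<in>total P'. g (U' p) = U'' (g p))"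
      for P P' P'' :: "('p, 'n) pbundle" and \<Psi> \<Psi>' \<Psi>'' U U' U'' f g
    proof
      show "rep_morphism G (P, \<Psi>) (P'', \<Psi>'') (compose (total P) g f)"
        using X Y Z f g by (blast intro: rep_morphism_compose[OF rep rep rep])
      interpret representation G P \<Psi>
        using X by (intro rep) blast
      show "\<forall>p\<in>total P. compose (total P) g f (U p) = U'' (compose (total P) g f p)"
      proof
        fix p assume p: "p \<in> total P"
        have "U p \<in> total P"
          using fibreD(1)[OF endo_fibre[OF unip_endoD(1) fibre_proj[OF p]]] X by blast
        moreover have "f p \<in> total P'"
          using f rep_morphismD(4) p by blast
        ultimately show "compose (total P) g f (U p) = U'' (compose (total P) g f p)"
          using f g p by (simp add: compose_eq)
      qed
    qed
    show "compose (total P) f (\<lambda>p\<in>total P. p) = f \<and> compose (total P) (\<lambda>p\<in>total P'. p) f = f"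
      if "rep_morphism G (P, \<Psi>) (P', \<Psi>') f \<and> (\<forall>p\<in>total P. f (U p) = U' (f p))"
      for P P' :: "('p, 'n) pbundle" and \<Psi> \<Psi>' f U U'
      using rep_morphismD(4)[OF conjunct1[OF that]] by (intro conjI compose_restrict_id)
    show "compose (total P) h (compose (total P) g f) = compose (total P) (compose (total P') h g) f"
      if "rep_morphism G (P, \<Psi>) (P', \<Psi>') f \<and> (\<forall>p\<in>total P. f (U p) = U' (f p))"
      for P P' :: "('p, 'n) pbundle" and \<Psi> \<Psi>' f g h U U'
      using rep_morphismD(4)[OF conjunct1[OF that]] by (intro compose_assoc) auto
  qed
qed

lemma Rep_to_JC_Obj:
  assumes G: "linear_algebraic_group G" and \<Phi>: "groupoid_rep G P \<Phi>"
  shows "(P, twist P (sigma_cocycle G P \<Phi>) \<Phi>, monodromy_unip G P \<Phi>) \<in> Obj (JC_cat G)"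
proof -
  interpret representation G P \<Phi>
    using G \<Phi> by (rule representationI)
  note U = unip_endo_monodromy_unip
  show ?thesis
    unfolding JC_cat_Obj[OF G]
  proof (intro conjI allI)
    show "groupoid_rep G P (twist P (sigma_cocycle G P \<Phi>) \<Phi>)"
      unfolding sigma_cocycle_eq by (rule groupoid_rep_twist[OF one_cocycle_flow[OF U]])
    show "representation.unip_endo G P (twist P (sigma_cocycle G P \<Phi>) \<Phi>) monodromy_unipotent"
      unfolding sigma_cocycle_eq by (rule unip_endo_twist_flow[OF U])
  qed (rule semisimple_sigma_twist)
qed

lemma cat_functor_to_JC:
  assumes G: "linear_algebraic_group (G :: 'n::finite cmat set)"
  shows "cat_functor (Rep_cat G :: (('p, 'n) pbundle \<times> 'p arrows_family, 'p \<Rightarrow> 'p) cat) (JC_cat G)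
    (\<lambda>(P, \<Phi>). (P, twist P (sigma_cocycle G P \<Phi>) \<Phi>, monodromy_unip G P \<Phi>)) (\<lambda>X Y T. T)"
  unfolding cat_functor_def
proof (intro conjI category_Rep_cat category_JC_cat G; intro ballI;
    unfold split_paired_all prod.case Rep_catD JC_catD mem_Collect_eq)
  note rep = representationI[OF G]
  show "(P, twist P (sigma_cocycle G P \<Phi>) \<Phi>, monodromy_unip G P \<Phi>) \<in> Obj (JC_cat G)"
    if "groupoid_rep G P \<Phi>" for P :: "('p, 'n) pbundle" and \<Phi>
    using G that by (rule Rep_to_JC_Obj)
  show "rep_morphism G (P, twist P (sigma_cocycle G P \<Phi>) \<Phi>) (P', twist P' (sigma_cocycle G P' \<Phi>') \<Phi>') T \<and>
      (\<forall>p\<in>total P. T (monodromy_unip G P \<Phi> p) = monodromy_unip G P' \<Phi>' (T p))"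
    if "groupoid_rep G P \<Phi>" "groupoid_rep G P' \<Phi>'" and T: "rep_morphism G (P, \<Phi>) (P', \<Phi>') T"
    for P P' :: "('p, 'n) pbundle" and \<Phi> \<Phi>' T
  proof (intro conjI ballI)
    note P = rep[OF that(1)] and P' = rep[OF that(2)]
    note intertwines = rep_morphism_monodromy_unip[OF P P' T]
    then show "T (monodromy_unip G P \<Phi> p) = monodromy_unip G P' \<Phi>' (T p)" if "p \<in> total P" for p
      using that .
    show "rep_morphism G (P, twist P (sigma_cocycle G P \<Phi>) \<Phi>) (P', twist P' (sigma_cocycle G P' \<Phi>') \<Phi>') T"
      unfolding representation.sigma_cocycle_eq[OF P] representation.sigma_cocycle_eq[OF P']
      using P P' representation.unip_endo_monodromy_unip[OF P]
        representation.unip_endo_monodromy_unip[OF P'] T intertwines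
      by (rule rep_morphism_twist_flow)
  qed
qed (rule refl)+

lemma cat_functor_from_JC:
  assumes G: "linear_algebraic_group (G :: 'n::finite cmat set)"
  shows "cat_functor (JC_cat G)
    (Rep_cat G :: (('p, 'n) pbundle \<times> 'p arrows_family, 'p \<Rightarrow> 'p) cat)
    (\<lambda>(P, \<Psi>, U). (P, twist P (tau_cocycle G P U) \<Psi>)) (\<lambda>X Y T. T)"
  unfolding cat_functor_def
proof (intro conjI category_Rep_cat category_JC_cat G; intro ballI;
    unfold split_paired_all prod.case Rep_catD JC_catD JC_cat_Obj[OF G] mem_Collect_eq)
  note rep = representationI[OF G]
  show "groupoid_rep G P (twist P (tau_cocycle G P U) \<Psi>)"
    if "groupoid_rep G P \<Psi> \<and> (\<forall>z. gauge_semisimple G P z (monodromy \<Psi> z)) \<and>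
      representation.unip_endo G P \<Psi> U"
    for P :: "('p, 'n) pbundle" and \<Psi> U
  proof -
    interpret representation G P \<Psi>
      using that by (intro rep) blast
    have U: "unip_endo U"
      using that by blast
    show ?thesis
      unfolding tau_cocycle_eq[OF U] by (rule groupoid_rep_twist[OF one_cocycle_flow[OF U]])
  qed
  show "rep_morphism G (P, twist P (tau_cocycle G P U) \<Psi>) (P', twist P' (tau_cocycle G P' U') \<Psi>') T"
    if X: "groupoid_rep G P \<Psi> \<and> (\<forall>z. gauge_semisimple G P z (monodromy \<Psi> z)) \<and>
        representation.unip_endo G P \<Psi> U"
      and Y: "groupoid_rep G P' \<Psi>' \<and> (\<forall>z. gauge_semisimple G P' z (monodromy \<Psi>' z)) \<and>
        representation.unip_endo G P' \<Psi>' U'"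
      and T: "rep_morphism G (P, \<Psi>) (P', \<Psi>') T \<and> (\<forall>p\<in>total P. T (U p) = U' (T p))"
    for P P' :: "('p, 'n) pbundle" and \<Psi> \<Psi>' U U' T
  proof -
    note P = rep[OF conjunct1[OF X]] and P' = rep[OF conjunct1[OF Y]]
    have U: "representation.unip_endo G P \<Psi> U" and U': "representation.unip_endo G P' \<Psi>' U'"
      using X Y by blast+
    have TU: "T (U p) = U' (T p)" if "p \<in> total P" for p
      using T that by blast
    show ?thesis
      unfolding representation.tau_cocycle_eq[OF P U] representation.tau_cocycle_eq[OF P' U']
      using P P' U U' conjunct1[OF T] TU by (rule rep_morphism_twist_flow)
  qed
qed (rule refl)+

lemma tau_twist_sigma_twist:
  assumes G: "linear_algebraic_group G" and \<Phi>: "groupoid_rep G P \<Phi>"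
  shows "twist P (tau_cocycle G P (monodromy_unip G P \<Phi>)) (twist P (sigma_cocycle G P \<Phi>) \<Phi>) = \<Phi>"
proof -
  interpret representation G P \<Phi>
    using G \<Phi> by (rule representationI)
  note U = unip_endo_monodromy_unip
  show ?thesis
    unfolding sigma_cocycle_eq tau_cocycle_eq[OF U] by (rule twist_flow_inverse[OF U]) simp
qed

lemma sigma_twist_tau_twist:
  assumes G: "linear_algebraic_group G" and \<Psi>: "(P, \<Psi>, U) \<in> Obj (JC_cat G)"
  defines "\<Phi> \<equiv> twist P (tau_cocycle G P U) \<Psi>"
  shows "twist P (sigma_cocycle G P \<Phi>) \<Phi> = \<Psi>" "monodromy_unip G P \<Phi> = U"
proof -
  interpret representation G P \<Psi>
    using \<Psi> by (intro representationI[OF G]) (simp add: JC_cat_Obj[OF G])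
  have U: "unip_endo U" and semisimple: "\<And>z. gauge_semisimple G P z (monodromy \<Psi> z)"
    using \<Psi> by (simp_all add: JC_cat_Obj[OF G])
  have \<Phi>: "\<Phi> = twist P (unip_flow G P U (1 / period)) \<Psi>"
    unfolding \<Phi>_def tau_cocycle_eq[OF U] by (rule refl)
  interpret T: representation G P \<Phi>
    unfolding \<Phi> by (rule representation_twist_flow[OF U])
  show unip: "monodromy_unip G P \<Phi> = U"
    unfolding \<Phi>_def by (rule monodromy_unip_tau_twist[OF semisimple U])
  show "twist P (sigma_cocycle G P \<Phi>) \<Phi> = \<Psi>"
    unfolding T.sigma_cocycle_eq unip unfolding \<Phi> by (rule twist_flow_inverse[OF U]) simp
qed

theorem theorem3p9:
  fixes G :: "'n::finite cmat set"
  assumes "connected_reductive_group G"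
  shows "inverse_functors
           (Rep_cat G :: (('p, 'n) pbundle \<times> 'p arrows_family, 'p \<Rightarrow> 'p) cat)
           (JC_cat G)
           (\<lambda>(P, \<Phi>). (P, twist P (sigma_cocycle G P \<Phi>) \<Phi>, monodromy_unip G P \<Phi>))
           (\<lambda>X Y T. T)
           (\<lambda>(P, \<Psi>, U). (P, twist P (tau_cocycle G P U) \<Psi>))
           (\<lambda>X Y T. T) \<and>
         (\<forall>(P :: ('p, 'n) pbundle, \<Phi>) \<in> Obj (Rep_cat G). one_cocycle G P \<Phi> (sigma_cocycle G P \<Phi>)) \<and>
         (\<forall>(P :: ('p, 'n) pbundle, \<Psi>, U) \<in> Obj (JC_cat G). one_cocycle G P \<Psi> (tau_cocycle G P U))"
proof -
  have G: "linear_algebraic_group G"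
    using assms by (simp add: connected_reductive_group_def reductive_group_def)
  note rep = representationI[OF G]
  show ?thesis
    unfolding inverse_functors_def
  proof (intro conjI cat_functor_to_JC cat_functor_from_JC G ballI;
      unfold split_paired_all prod.case Rep_catD)
    fix P :: "('p, 'n) pbundle" and \<Phi>
    assume \<Phi>: "groupoid_rep G P \<Phi>"
    show "(P, twist P (tau_cocycle G P (monodromy_unip G P \<Phi>)) (twist P (sigma_cocycle G P \<Phi>) \<Phi>)) = (P, \<Phi>)"
      by (simp only: tau_twist_sigma_twist[OF G \<Phi>])
    interpret representation G P \<Phi>
      using \<Phi> by (rule rep)
    show "one_cocycle G P \<Phi> (sigma_cocycle G P \<Phi>)"
      unfolding sigma_cocycle_eq by (rule one_cocycle_flow[OF unip_endo_monodromy_unip])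
  next
    fix P :: "('p, 'n) pbundle" and \<Psi> U
    assume Y: "(P, \<Psi>, U) \<in> Obj (JC_cat G)"
    let ?\<Phi> = "twist P (tau_cocycle G P U) \<Psi>"
    show "(P, twist P (sigma_cocycle G P ?\<Phi>) ?\<Phi>, monodromy_unip G P ?\<Phi>) = (P, \<Psi>, U)"
      by (simp only: sigma_twist_tau_twist[OF G Y])
    have \<Psi>: "groupoid_rep G P \<Psi>" and U: "representation.unip_endo G P \<Psi> U"
      using Y by (simp_all add: JC_cat_Obj[OF G])
    interpret representation G P \<Psi>
      using \<Psi> by (rule rep)
    show "one_cocycle G P \<Psi> (tau_cocycle G P U)"
      unfolding tau_cocycle_eq[OF U] by (rule one_cocycle_flow[OF U])
  qed (rule refl)+
qed

end
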